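(* Let $(E,\tau,M,\rho)$ be a Lie algebroid on a smooth manifold $M$. For each smooth section $V\in A^1(M,E)$ there exists a unique graded ($\mathbb R$-linear) endomorphism of degree $0$ of the graded algebra of multivectors $A(M,E)$, called the Lie derivative with respect to $V$ and denoted by $\mathcal L_\rho(V)$, which satisfies: (i) for a smooth function $f\in A^0(M,E)=C^\infty(M,\mathbb R)$, $\mathcal L_\rho(V)f=i(\rho\circ V)df=\mathcal L(\rho\circ V)f$, where $\mathcal L(\rho\circ V)$ is the usual Lie derivative with respect to the vector field $\rho\circ V$; (ii) for an integer $p\ge1$ and $P\in A^p(M,E)$, $\mathcal L_\rho(V)P$ is the unique element of $A^p(M,E)$ such that, for all $\eta\in\Omega^p(M,E)$, $$\bigl\langle\eta,\mathcal L_\rho(V)P\bigr\rangle=\mathcal L_\rho(V)\bigl(\langle\eta,P\rangle\bigr)-\bigl\langle\mathcal L_\rho(V)\eta,P\bigr\rangle.$$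
   Context: A Lie algebroid $(E,\tau,M,\rho)$ is a smooth real vector bundle $\tau:E\to M$ of finite rank over a smooth manifold, with a real Lie algebra bracket $\{\ ,\ \}$ on its smooth sections and a smooth vector bundle map $\rho:E\to TM$ over $\mathrm{id}_M$ (anchor) such that $\{s_1,fs_2\}=f\{s_1,s_2\}+(\mathcal L(\rho\circ s_1)f)s_2$. $A^p(M,E)$ and $\Omega^p(M,E)$ are the spaces of smooth sections of $\bigwedge^pE$ and $\bigwedge^pE^*$ (both $C^\infty(M,\mathbb R)$ for $p=0$, $\{0\}$ for $p<0$); $A(M,E)=\bigoplus_pA^p(M,E)$. The pairing is the $C^\infty(M,\mathbb R)$-bilinear map with $\langle\eta,V_1\wedge\cdots\wedge V_p\rangle=\eta(V_1,\dots,V_p)$ for $\eta\in\Omega^p(M,E)$. On forms, $\mathcal L_\rho(V)$ is given by $\mathcal L_\rho(V)f=\mathcal L(\rho\circ V)f$ for functions and, for $\eta\in\Omega^p(M,E)$, $p>0$, $(\mathcal L_\rho(V)\eta)(V_1,\dots,V_p)=\mathcal L_\rho(V)(\eta(V_1,\dots,V_p))-\sum_{i=1}^p\eta(V_1,\dots,V_{i-1},\{V,V_i\},V_{i+1},\dots,V_p)$. "Graded endomorphism of degree $0$" means a linear map of the graded vector space preserving degrees. *)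

theory Defs
  imports "HOL-Analysis.Analysis"
begin

section \<open>Smooth real functions on open subsets of \<open>\<real>\<^sup>n\<close>\<close>

text \<open>
  \<open>\<real>\<^sup>n\<close> is the library space \<^const>\<open>Euclidean_space\<close>, whose points are the functions
  \<open>nat \<Rightarrow> real\<close> vanishing from index \<open>n\<close> on, so that the dimension is a natural number (possibly \<open>0\<close>).
\<close>

definition pderiv_at :: "nat \<Rightarrow> ((nat \<Rightarrow> real) \<Rightarrow> real) \<Rightarrow> (nat \<Rightarrow> real) \<Rightarrow> real" where
  "pderiv_at i f x = deriv (\<lambda>t. f (x(i := t))) (x i)"

primrec Ck_on :: "nat \<Rightarrow> nat \<Rightarrow> (nat \<Rightarrow> real) set \<Rightarrow> ((nat \<Rightarrow> real) \<Rightarrow> real) \<Rightarrow> bool" where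
  "Ck_on n 0 S f \<longleftrightarrow> continuous_map (subtopology (Euclidean_space n) S) euclideanreal f"
| "Ck_on n (Suc k) S f \<longleftrightarrow>
     continuous_map (subtopology (Euclidean_space n) S) euclideanreal f \<and>
     (\<forall>i<n. (\<forall>x\<in>S. (\<lambda>t. f (x(i := t))) differentiable (at (x i))) \<and>
            Ck_on n k S (pderiv_at i f))"

definition smooth_on :: "nat \<Rightarrow> (nat \<Rightarrow> real) set \<Rightarrow> ((nat \<Rightarrow> real) \<Rightarrow> real) \<Rightarrow> bool" where
  "smooth_on n S f \<longleftrightarrow> openin (Euclidean_space n) S \<and> (\<forall>k. Ck_on n k S f)"


section \<open>Smooth manifolds\<close>

text \<open>A chart is a pair \<open>(U, \<phi>)\<close>; only the restriction of \<open>\<phi>\<close> to \<open>U\<close> is relevant.\<close>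

record 'm manifold =
  mtop :: "'m topology"
  mdim :: nat
  charts :: "('m set \<times> ('m \<Rightarrow> nat \<Rightarrow> real)) set"

abbreviation pts :: "'m manifold \<Rightarrow> 'm set" where
  "pts M \<equiv> topspace (mtop M)"

definition smooth_fun_on :: "'m manifold \<Rightarrow> 'm set \<Rightarrow> ('m \<Rightarrow> real) \<Rightarrow> bool" where
  "smooth_fun_on M W f \<longleftrightarrow>
     openin (mtop M) W \<and>
     (\<forall>(U, \<phi>) \<in> charts M. smooth_on (mdim M) (\<phi> ` (U \<inter> W)) (f \<circ> inv_into U \<phi>))"

definition smooth_funs :: "'m manifold \<Rightarrow> ('m \<Rightarrow> real) set" where
  "smooth_funs M = {f. smooth_fun_on M (pts M) f}"

definition smooth_manifold :: "'m manifold \<Rightarrow> bool" where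
  "smooth_manifold M \<longleftrightarrow>
     Hausdorff_space (mtop M) \<and> second_countable (mtop M) \<and>
     pts M \<subseteq> (\<Union>(U, \<phi>) \<in> charts M. U) \<and>
     (\<forall>(U, \<phi>) \<in> charts M.
        openin (mtop M) U \<and> openin (Euclidean_space (mdim M)) (\<phi> ` U) \<and>
        homeomorphic_map (subtopology (mtop M) U)
          (subtopology (Euclidean_space (mdim M)) (\<phi> ` U)) \<phi>) \<and>
     (\<forall>(U, \<phi>) \<in> charts M. \<forall>(U', \<phi>') \<in> charts M. \<forall>i < mdim M.
        smooth_on (mdim M) (\<phi> ` (U \<inter> U')) (\<lambda>y. \<phi>' (inv_into U \<phi> y) i))"


section \<open>Smooth real vector bundles\<close>

text \<open>Vector spaces on an explicit carrier, for use with the fibres of a bundle.\<close>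

definition real_vector_space_on ::
    "'e set \<Rightarrow> ('e \<Rightarrow> 'e \<Rightarrow> 'e) \<Rightarrow> (real \<Rightarrow> 'e \<Rightarrow> 'e) \<Rightarrow> 'e \<Rightarrow> bool" where
  "real_vector_space_on C plus_on smul zr \<longleftrightarrow>
     zr \<in> C \<and> (\<forall>u\<in>C. \<forall>v\<in>C. plus_on u v \<in> C) \<and> (\<forall>a. \<forall>u\<in>C. smul a u \<in> C) \<and>
     (\<forall>u\<in>C. \<forall>v\<in>C. \<forall>w\<in>C. plus_on (plus_on u v) w = plus_on u (plus_on v w)) \<and>
     (\<forall>u\<in>C. \<forall>v\<in>C. plus_on u v = plus_on v u) \<and>
     (\<forall>u\<in>C. plus_on zr u = u) \<and>
     (\<forall>u\<in>C. plus_on (smul (- 1) u) u = zr) \<and>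
     (\<forall>a. \<forall>u\<in>C. \<forall>v\<in>C. smul a (plus_on u v) = plus_on (smul a u) (smul a v)) \<and>
     (\<forall>a b. \<forall>u\<in>C. smul (a + b) u = plus_on (smul a u) (smul b u)) \<and>
     (\<forall>a b. \<forall>u\<in>C. smul a (smul b u) = smul (a * b) u) \<and>
     (\<forall>u\<in>C. smul 1 u = u)"

text \<open>
  A vector bundle of rank \<open>r\<close> over \<open>M\<close> is given by a total space, a projection, the operations of
  the fibres and a vector bundle atlas. A member \<open>(U, \<Psi>)\<close> of the atlas stands for the local
  trivialisation \<open>v \<mapsto> (proj v, \<Psi> v)\<close> from \<open>proj -` U\<close> to \<open>U \<times> \<real>\<^sup>r\<close>. The topology
  and the smooth structure of the total space are those for which all of these maps are
  diffeomorphisms; they are determined by the atlas and are not recorded separately.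
\<close>

record ('e, 'm) vector_bundle =
  total :: "'e set"
  proj :: "'e \<Rightarrow> 'm"
  vadd :: "'e \<Rightarrow> 'e \<Rightarrow> 'e"
  vscale :: "real \<Rightarrow> 'e \<Rightarrow> 'e"
  vzero :: "'m \<Rightarrow> 'e"
  vrank :: nat
  trivs :: "('m set \<times> ('e \<Rightarrow> nat \<Rightarrow> real)) set"

definition fibre :: "('e, 'm) vector_bundle \<Rightarrow> 'm \<Rightarrow> 'e set" where
  "fibre E x = {v \<in> total E. proj E v = x}"

text \<open>The local frame \<open>e\<^sub>0, \<dots>, e\<^sub>r\<^sub>-\<^sub>1\<close> corresponding to a local trivialisation.\<close>

definition frame ::
    "('e, 'm) vector_bundle \<Rightarrow> ('e \<Rightarrow> nat \<Rightarrow> real) \<Rightarrow> 'm \<Rightarrow> nat \<Rightarrow> 'e" where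
  "frame E \<Psi> x i = inv_into (fibre E x) \<Psi> (\<lambda>k. if k = i then 1 else 0)"

text \<open>
  The last clause below says that the transition matrices are smooth.
\<close>

definition smooth_vector_bundle :: "'m manifold \<Rightarrow> ('e, 'm) vector_bundle \<Rightarrow> bool" where
  "smooth_vector_bundle M E \<longleftrightarrow>
     proj E ` total E = pts M \<and>
     (\<forall>x \<in> pts M. real_vector_space_on (fibre E x) (vadd E) (vscale E) (vzero E x)) \<and>
     pts M \<subseteq> (\<Union>(U, \<Psi>) \<in> trivs E. U) \<and>
     (\<forall>(U, \<Psi>) \<in> trivs E. openin (mtop M) U \<and>
        (\<forall>x\<in>U. bij_betw \<Psi> (fibre E x) (topspace (Euclidean_space (vrank E))) \<and>
          (\<forall>u \<in> fibre E x. \<forall>v \<in> fibre E x. \<Psi> (vadd E u v) = (\<lambda>k. \<Psi> u k + \<Psi> v k)) \<and>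
          (\<forall>a. \<forall>u \<in> fibre E x. \<Psi> (vscale E a u) = (\<lambda>k. a * \<Psi> u k)))) \<and>
     (\<forall>(U, \<Psi>) \<in> trivs E. \<forall>(U', \<Psi>') \<in> trivs E. \<forall>i < vrank E. \<forall>j < vrank E.
        smooth_fun_on M (U \<inter> U') (\<lambda>x. \<Psi>' (frame E \<Psi> x i) j))"

definition smooth_sections :: "'m manifold \<Rightarrow> ('e, 'm) vector_bundle \<Rightarrow> ('m \<Rightarrow> 'e) set" where
  "smooth_sections M E =
     {s \<in> (\<Pi>\<^sub>E x \<in> pts M. fibre E x).
        \<forall>(U, \<Psi>) \<in> trivs E. \<forall>i < vrank E. smooth_fun_on M U (\<lambda>x. \<Psi> (s x) i)}"

definition sec_add ::
    "'m manifold \<Rightarrow> ('e, 'm) vector_bundle \<Rightarrow> ('m \<Rightarrow> 'e) \<Rightarrow> ('m \<Rightarrow> 'e) \<Rightarrow> 'm \<Rightarrow> 'e" where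
  "sec_add M E s t = (\<lambda>x \<in> pts M. vadd E (s x) (t x))"

definition sec_mult ::
    "'m manifold \<Rightarrow> ('e, 'm) vector_bundle \<Rightarrow> ('m \<Rightarrow> real) \<Rightarrow> ('m \<Rightarrow> 'e) \<Rightarrow> 'm \<Rightarrow> 'e" where
  "sec_mult M E f s = (\<lambda>x \<in> pts M. vscale E (f x) (s x))"

definition sec_zero :: "'m manifold \<Rightarrow> ('e, 'm) vector_bundle \<Rightarrow> 'm \<Rightarrow> 'e" where
  "sec_zero M E = (\<lambda>x \<in> pts M. vzero E x)"

text \<open>
  Smooth vector bundle maps over the identity: in local trivialisations such a map is
  \<open>(x, y) \<mapsto> (x, A(x) y)\<close>, and it is smooth precisely when the matrix \<open>A\<close> is.
\<close>

definition smooth_bundle_map ::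
    "'m manifold \<Rightarrow> ('e, 'm) vector_bundle \<Rightarrow> ('d, 'm) vector_bundle \<Rightarrow> ('e \<Rightarrow> 'd) \<Rightarrow> bool" where
  "smooth_bundle_map M E F h \<longleftrightarrow>
     (\<forall>x \<in> pts M. \<forall>u \<in> fibre E x. h u \<in> fibre F x \<and>
        (\<forall>v \<in> fibre E x. h (vadd E u v) = vadd F (h u) (h v)) \<and>
        (\<forall>a. h (vscale E a u) = vscale F a (h u))) \<and>
     (\<forall>(U, \<Psi>) \<in> trivs E. \<forall>(W, \<Theta>) \<in> trivs F. \<forall>i < vrank E. \<forall>j < vrank F.
        smooth_fun_on M (U \<inter> W) (\<lambda>x. \<Theta> (h (frame E \<Psi> x i)) j))"


section \<open>The tangent bundle\<close>

text \<open>
  A tangent vector at \<open>x\<close> is a combination of the coordinate derivations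
  \<open>\<partial>/\<partial>\<phi>\<^sub>j\<close> at \<open>x\<close>, acting on the functions which are smooth near \<open>x\<close> (and set to \<open>0\<close> on all other
  functions, so that tangent vectors are equal when they agree as derivations).
\<close>

type_synonym 'm derivation = "('m \<Rightarrow> real) \<Rightarrow> real"

definition smooth_near :: "'m manifold \<Rightarrow> 'm \<Rightarrow> ('m \<Rightarrow> real) \<Rightarrow> bool" where
  "smooth_near M x f \<longleftrightarrow> (\<exists>W. x \<in> W \<and> smooth_fun_on M W f)"

definition tangent_space :: "'m manifold \<Rightarrow> 'm \<Rightarrow> 'm derivation set" where
  "tangent_space M x =
     {D. \<exists>(U, \<phi>) \<in> charts M. x \<in> U \<and> (\<exists>a :: nat \<Rightarrow> real.
        D = (\<lambda>f. if smooth_near M x f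
                 then \<Sum>j < mdim M. a j * pderiv_at j (f \<circ> inv_into U \<phi>) (\<phi> x)
                 else 0))}"

text \<open>
  The trivialisation of the tangent bundle over a chart domain reads off the components
  \<open>D(\<phi>\<^sub>j)\<close> of a tangent vector \<open>D\<close>.
\<close>

definition tangent_bundle :: "'m manifold \<Rightarrow> ('m \<times> 'm derivation, 'm) vector_bundle" where
  "tangent_bundle M =
     \<lparr> total = (SIGMA x : pts M. tangent_space M x),
       proj = fst,
       vadd = (\<lambda>u v. (fst u, \<lambda>f. snd u f + snd v f)),
       vscale = (\<lambda>a u. (fst u, \<lambda>f. a * snd u f)),
       vzero = (\<lambda>x. (x, \<lambda>f. 0)),
       vrank = mdim M,
       trivs = (\<lambda>(U, \<phi>). (U, \<lambda>u j. snd u (\<lambda>y. \<phi> y j))) ` charts M \<rparr>"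

definition differential :: "('m \<Rightarrow> real) \<Rightarrow> 'm \<times> 'm derivation \<Rightarrow> real" where
  "differential f u = snd u f"

definition contraction ::
    "('m \<Rightarrow> 'm \<times> 'm derivation) \<Rightarrow> ('m \<times> 'm derivation \<Rightarrow> real) \<Rightarrow> 'm \<Rightarrow> real" where
  "contraction X \<alpha> x = \<alpha> (X x)"

definition lie_deriv_fun ::
    "('m \<Rightarrow> 'm \<times> 'm derivation) \<Rightarrow> ('m \<Rightarrow> real) \<Rightarrow> 'm \<Rightarrow> real" where
  "lie_deriv_fun X f x = snd (X x) f"


section \<open>Lie algebroids\<close>

definition lie_algebroid ::
    "'m manifold \<Rightarrow> ('e, 'm) vector_bundle \<Rightarrow> ('e \<Rightarrow> 'm \<times> 'm derivation) \<Rightarrow>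
     (('m \<Rightarrow> 'e) \<Rightarrow> ('m \<Rightarrow> 'e) \<Rightarrow> 'm \<Rightarrow> 'e) \<Rightarrow> bool" where
  "lie_algebroid M E \<rho> br \<longleftrightarrow>
     smooth_manifold M \<and> smooth_vector_bundle M E \<and>
     smooth_bundle_map M E (tangent_bundle M) \<rho> \<and>
     (\<forall>s \<in> smooth_sections M E. \<forall>t \<in> smooth_sections M E. br s t \<in> smooth_sections M E) \<and>
     (\<forall>s \<in> smooth_sections M E. \<forall>t \<in> smooth_sections M E. \<forall>u \<in> smooth_sections M E.
        br (sec_add M E s t) u = sec_add M E (br s u) (br t u) \<and>
        br u (sec_add M E s t) = sec_add M E (br u s) (br u t)) \<and>
     (\<forall>a. \<forall>s \<in> smooth_sections M E. \<forall>t \<in> smooth_sections M E.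
        br (sec_mult M E (\<lambda>_. a) s) t = sec_mult M E (\<lambda>_. a) (br s t) \<and>
        br s (sec_mult M E (\<lambda>_. a) t) = sec_mult M E (\<lambda>_. a) (br s t)) \<and>
     (\<forall>s \<in> smooth_sections M E. br s s = sec_zero M E) \<and>
     (\<forall>s \<in> smooth_sections M E. \<forall>t \<in> smooth_sections M E. \<forall>u \<in> smooth_sections M E.
        sec_add M E (br s (br t u)) (sec_add M E (br t (br u s)) (br u (br s t)))
          = sec_zero M E) \<and>
     (\<forall>s \<in> smooth_sections M E. \<forall>t \<in> smooth_sections M E. \<forall>f \<in> smooth_funs M.
        br s (sec_mult M E f t) =
          sec_add M E (sec_mult M E f (br s t)) (sec_mult M E (lie_deriv_fun (\<rho> \<circ> s) f) t))"


section \<open>Exterior powers of the fibres\<close>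

text \<open>
  An alternating \<open>p\<close>-linear form on the fibre over \<open>x\<close>, i.e. an element of the \<open>p\<close>-th exterior power
  of the dual of the fibre, is a function on lists of length \<open>p\<close> of vectors of the fibre; it is \<open>0\<close> on
  all other lists.
\<close>

definition alt_forms :: "('e, 'm) vector_bundle \<Rightarrow> 'm \<Rightarrow> nat \<Rightarrow> ('e list \<Rightarrow> real) set" where
  "alt_forms E x p =
     {\<eta>. (\<forall>vs. \<not> (length vs = p \<and> set vs \<subseteq> fibre E x) \<longrightarrow> \<eta> vs = 0) \<and>
         (\<forall>vs i u v a. length vs = p \<and> set vs \<subseteq> fibre E x \<and> i < p \<and>
              u \<in> fibre E x \<and> v \<in> fibre E x \<longrightarrow>
            \<eta> (vs[i := vadd E u v]) = \<eta> (vs[i := u]) + \<eta> (vs[i := v]) \<and>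
            \<eta> (vs[i := vscale E a u]) = a * \<eta> (vs[i := u])) \<and>
         (\<forall>vs i j. length vs = p \<and> set vs \<subseteq> fibre E x \<and> i < j \<and> j < p \<and> vs ! i = vs ! j \<longrightarrow>
            \<eta> vs = 0)}"

text \<open>
  The product \<open>v\<^sub>1 \<and> \<dots> \<and> v\<^sub>p\<close> is represented by the functional \<open>\<eta> \<mapsto> \<eta>(v\<^sub>1, \<dots>, v\<^sub>p)\<close> on alternating forms,
  and the \<open>p\<close>-th exterior power of the fibre by the span of these products. Alternating
  forms are the linear functionals on the exterior power and separate its points, so the usual
  quotient of the tensor power is canonically isomorphic to this span. (Functionals are \<open>0\<close> away
  from the alternating forms.)
\<close>

definition wedge :: "('e, 'm) vector_bundle \<Rightarrow> 'm \<Rightarrow> 'e list \<Rightarrow> ('e list \<Rightarrow> real) \<Rightarrow> real" where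
  "wedge E x vs \<eta> = (if \<eta> \<in> alt_forms E x (length vs) then \<eta> vs else 0)"

definition ext_power ::
    "('e, 'm) vector_bundle \<Rightarrow> 'm \<Rightarrow> nat \<Rightarrow> (('e list \<Rightarrow> real) \<Rightarrow> real) set" where
  "ext_power E x p =
     {T. \<exists>(m::nat) c w. (\<forall>k<m. length (w k) = p \<and> set (w k) \<subseteq> fibre E x) \<and>
           T = (\<lambda>\<eta>. \<Sum>k<m. c k * wedge E x (w k) \<eta>)}"

text \<open>The products so defined are multilinear and alternating in their factors.\<close>

lemma wedge_multilinear:
  assumes "set vs \<subseteq> fibre E x" "i < length vs" "u \<in> fibre E x" "v \<in> fibre E x"
  shows "wedge E x (vs[i := vadd E u v]) \<eta> = wedge E x (vs[i := u]) \<eta> + wedge E x (vs[i := v]) \<eta>"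
    and "wedge E x (vs[i := vscale E a u]) \<eta> = a * wedge E x (vs[i := u]) \<eta>"
proof -
  have "\<eta> (vs[i := vadd E u v]) = \<eta> (vs[i := u]) + \<eta> (vs[i := v]) \<and>
        \<eta> (vs[i := vscale E a u]) = a * \<eta> (vs[i := u])"
    if "\<eta> \<in> alt_forms E x (length vs)"
    using that assms unfolding alt_forms_def by blast
  then show "wedge E x (vs[i := vadd E u v]) \<eta> = wedge E x (vs[i := u]) \<eta> + wedge E x (vs[i := v]) \<eta>"
    and "wedge E x (vs[i := vscale E a u]) \<eta> = a * wedge E x (vs[i := u]) \<eta>"
    by (simp_all add: wedge_def)
qed

lemma wedge_alternating:
  assumes "set vs \<subseteq> fibre E x" "i < j" "j < length vs" "vs ! i = vs ! j"
  shows "wedge E x vs \<eta> = 0"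
proof -
  have "\<eta> vs = 0" if "\<eta> \<in> alt_forms E x (length vs)"
    using that assms unfolding alt_forms_def by blast
  then show ?thesis
    by (simp add: wedge_def)
qed


section \<open>Forms and multivectors\<close>

text \<open>
  Strictly increasing multi-indices \<open>i\<^sub>1 < \<dots> < i\<^sub>p\<close> below \<open>r\<close>, labelling the induced local frame
  \<open>e\<^sub>i\<^sub>1 \<and> \<dots> \<and> e\<^sub>i\<^sub>p\<close> of the \<open>p\<close>-th exterior power of a bundle of rank \<open>r\<close>.
\<close>

definition multi_indices :: "nat \<Rightarrow> nat \<Rightarrow> nat list set" where
  "multi_indices r p = {I. length I = p \<and> sorted_wrt (<) I \<and> set I \<subseteq> {..<r}}"

type_synonym ('e, 'm) form = "'m \<Rightarrow> 'e list \<Rightarrow> real"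
type_synonym ('e, 'm) multivector = "'m \<Rightarrow> ('e list \<Rightarrow> real) \<Rightarrow> real"

definition forms :: "'m manifold \<Rightarrow> ('e, 'm) vector_bundle \<Rightarrow> nat \<Rightarrow> ('e, 'm) form set" where
  "forms M E p =
     {\<eta>. (\<forall>x \<in> pts M. \<eta> x \<in> alt_forms E x p) \<and> (\<forall>x. x \<notin> pts M \<longrightarrow> \<eta> x = (\<lambda>_. 0)) \<and>
         (\<forall>(U, \<Psi>) \<in> trivs E. \<forall>I \<in> multi_indices (vrank E) p.
            smooth_fun_on M U (\<lambda>x. \<eta> x (map (frame E \<Psi> x) I)))}"

definition multivectors ::
    "'m manifold \<Rightarrow> ('e, 'm) vector_bundle \<Rightarrow> nat \<Rightarrow> ('e, 'm) multivector set" where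
  "multivectors M E p =
     {P. (\<forall>x \<in> pts M. P x \<in> ext_power E x p) \<and> (\<forall>x. x \<notin> pts M \<longrightarrow> P x = (\<lambda>_. 0)) \<and>
         (\<forall>(U, \<Psi>) \<in> trivs E. \<exists>c.
            (\<forall>I \<in> multi_indices (vrank E) p. smooth_fun_on M U (c I)) \<and>
            (\<forall>x \<in> U. P x = (\<lambda>\<eta>. \<Sum>I \<in> multi_indices (vrank E) p.
                                  c I x * wedge E x (map (frame E \<Psi> x) I) \<eta>)))}"

text \<open>The identification of a function with a multivector of degree \<open>0\<close> (a multiple of the empty product).\<close>

definition fun_mv ::
    "'m manifold \<Rightarrow> ('e, 'm) vector_bundle \<Rightarrow> ('m \<Rightarrow> real) \<Rightarrow> ('e, 'm) multivector" where
  "fun_mv M E f x = (\<lambda>\<eta>. if x \<in> pts M then f x * wedge E x [] \<eta> else 0)"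

definition pairing :: "('e, 'm) form \<Rightarrow> ('e, 'm) multivector \<Rightarrow> 'm \<Rightarrow> real" where
  "pairing \<eta> P x = P x (\<eta> x)"

lemma pairing_wedge:
  assumes "\<eta> \<in> forms M E (length Vs)" "x \<in> pts M"
  shows "pairing \<eta> (\<lambda>x. wedge E x (map (\<lambda>s. s x) Vs)) x = \<eta> x (map (\<lambda>s. s x) Vs)"
  using assms by (simp add: pairing_def wedge_def forms_def)

text \<open>
  The Lie derivative of a \<open>p\<close>-form is the \<open>p\<close>-form with the prescribed values on smooth sections.
  For \<open>p = 0\<close> the formula reduces to the derivative of a function.
\<close>

definition lie_deriv_form ::
    "'m manifold \<Rightarrow> ('e, 'm) vector_bundle \<Rightarrow> ('e \<Rightarrow> 'm \<times> 'm derivation) \<Rightarrow>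
     (('m \<Rightarrow> 'e) \<Rightarrow> ('m \<Rightarrow> 'e) \<Rightarrow> 'm \<Rightarrow> 'e) \<Rightarrow> ('m \<Rightarrow> 'e) \<Rightarrow> nat \<Rightarrow>
     ('e, 'm) form \<Rightarrow> ('e, 'm) form" where
  "lie_deriv_form M E \<rho> br V p \<eta> =
     (THE \<zeta>. \<zeta> \<in> forms M E p \<and>
        (\<forall>Vs. length Vs = p \<and> set Vs \<subseteq> smooth_sections M E \<longrightarrow>
           (\<forall>x \<in> pts M. \<zeta> x (map (\<lambda>s. s x) Vs) =
              lie_deriv_fun (\<rho> \<circ> V) (\<lambda>y. \<eta> y (map (\<lambda>s. s y) Vs)) x -
              (\<Sum>i<p. \<eta> x (map (\<lambda>s. s x) (Vs[i := br V (Vs ! i)]))))))"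


section \<open>The graded space of multivectors\<close>

text \<open>
  Elements of the direct sum of the spaces of \<open>p\<close>-vectors are families with finitely many nonzero
  components. Degrees are natural numbers, the components of negative degree being zero.
\<close>

type_synonym ('e, 'm) graded_mv = "nat \<Rightarrow> ('e, 'm) multivector"

definition graded_multivectors ::
    "'m manifold \<Rightarrow> ('e, 'm) vector_bundle \<Rightarrow> ('e, 'm) graded_mv set" where
  "graded_multivectors M E =
     {a. (\<forall>p. a p \<in> multivectors M E p) \<and> finite {p. a p \<noteq> (\<lambda>x \<eta>. 0)}}"

definition homogeneous :: "nat \<Rightarrow> ('e, 'm) multivector \<Rightarrow> ('e, 'm) graded_mv" where
  "homogeneous p P = (\<lambda>q. if q = p then P else (\<lambda>x \<eta>. 0))"

text \<open>
  Endomorphisms are extensional functions, so that they are equal when they agree on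
  \<^const>\<open>graded_multivectors\<close>.
\<close>

definition graded_endomorphism0 ::
    "'m manifold \<Rightarrow> ('e, 'm) vector_bundle \<Rightarrow> (('e, 'm) graded_mv \<Rightarrow> ('e, 'm) graded_mv) \<Rightarrow> bool" where
  "graded_endomorphism0 M E L \<longleftrightarrow>
     L \<in> graded_multivectors M E \<rightarrow>\<^sub>E graded_multivectors M E \<and>
     (\<forall>a \<in> graded_multivectors M E. \<forall>b \<in> graded_multivectors M E.
        L (\<lambda>p x \<eta>. a p x \<eta> + b p x \<eta>) = (\<lambda>p x \<eta>. L a p x \<eta> + L b p x \<eta>)) \<and>
     (\<forall>c. \<forall>a \<in> graded_multivectors M E. L (\<lambda>p x \<eta>. c * a p x \<eta>) = (\<lambda>p x \<eta>. c * L a p x \<eta>)) \<and>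
     (\<forall>p. \<forall>P \<in> multivectors M E p. \<exists>Q \<in> multivectors M E p. L (homogeneous p P) = homogeneous p Q)"

end

theory Submission
  imports Defs
begin

text \<open>
  The difference \<open>\<L>\<^sub>\<rho>(V)\<langle>\<eta>, P\<rangle> - \<langle>\<L>\<^sub>\<rho>(V)\<eta>, P\<rangle>\<close> is linear over the smooth functions in \<open>\<eta>\<close>. If
  \<open>P = \<Sum> c\<^sub>I e\<^sub>I\<close> in a local frame, the derivatives of the functions \<open>\<eta>(e\<^sub>I)\<close> cancel and what remains
  is the pairing of \<open>\<eta>\<close> with \<open>\<Sum> (\<rho>(V) c\<^sub>I) e\<^sub>I + c\<^sub>I \<Sum>\<^sub>k e\<^sub>i\<^sub>1 \<and> \<dots> \<and> {V, e\<^sub>i\<^sub>k} \<and> \<dots> \<and> e\<^sub>i\<^sub>p\<close>; its coefficients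
  are smooth. Every alternating form on a fibre is the value of a global form, so the local expressions
  agree on overlaps and the pairing determines the multivector. In degree \<open>0\<close> the same formula gives the
  derivative of a function. Global sections and forms with prescribed local behaviour come from bump
  functions. The bracket is defined only for global sections, so its locality, and the fact that
  \<open>\<L>\<^sub>\<rho>(V)\<eta>\<close> takes pointwise values, are deduced from the Leibniz rule with cutoff functions.
\<close>

section \<open>Calculus on open subsets of \<open>\<real>\<^sup>n\<close>\<close>

text \<open>Smoothness means existence and continuity of iterated partial derivatives, tested in
  every chart. No total derivative is at hand, so the chain rule is proved coordinate by coordinate;
  change of charts and of coordinates of tangent vectors rest on it. Fibres carry explicit binary
  operations. Frame expansions are therefore stated for real-valued linear maps, and sums of
  sections are built one summand at a time. Forms and multivectors are smooth by a condition on
  strictly increasing multi-indices, but replacing one frame vector by the components of a bracket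
  yields unsorted index lists. The signs produced by sorting must be constants, the same for all
  points and all forms; this is what the combinatorial section provides. A multivector at a point is
  a functional on alternating forms, so the right-hand side of the defining formula can itself be
  taken as its definition, evaluated at any global form through the given one. Uniqueness draws on
  both clauses: (ii) says nothing about degree 0, (i) covers it, and additivity on finite families
  does the rest.\<close>

abbreviation Rn :: "nat \<Rightarrow> (nat \<Rightarrow> real) set" where
  "Rn n \<equiv> topspace (Euclidean_space n)"

section \<open>The topology of \<open>Rn n\<close> in coordinates\<close>

lemma Rn_iff: "x \<in> Rn n \<longleftrightarrow> (\<forall>i\<ge>n. x i = 0)"
  by (simp add: topspace_Euclidean_space)

text \<open>Bridges the abstract topology and the type-class topology on functions, so that facts
  about \<open>open\<close>, \<open>continuous_on\<close> and limits become available.\<close>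

lemma Euclidean_space_top_of_set: "Euclidean_space n = top_of_set (Rn n)"
  by (simp add: Euclidean_space_def euclidean_product_topology topspace_Euclidean_space)

lemma openin_Euclidean_iff: "openin (Euclidean_space n) S \<longleftrightarrow> (\<exists>T. open T \<and> S = Rn n \<inter> T)"
  by (subst Euclidean_space_top_of_set) (rule openin_open)

lemma openin_Euclidean_subset: "openin (Euclidean_space n) S \<Longrightarrow> S \<subseteq> Rn n"
  by (rule openin_subset)

lemma subtopology_Euclidean_space:
  assumes "S \<subseteq> Rn n"
  shows "subtopology (Euclidean_space n) S = top_of_set S"
  by (subst Euclidean_space_top_of_set) (simp only: subtopology_subtopology Int_absorb1[OF assms])

lemma continuous_map_Euclidean_iff:
  fixes f :: "(nat \<Rightarrow> real) \<Rightarrow> real"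
  assumes "S \<subseteq> Rn n"
  shows "continuous_map (subtopology (Euclidean_space n) S) euclideanreal f \<longleftrightarrow> continuous_on S f"
  by (simp add: subtopology_Euclidean_space[OF assms])

text \<open>A basic open set of the product topology restricts only finitely many coordinates, so
  one bound on their indices and one radius suffice.\<close>

lemma open_fun_contains_cube:
  fixes x :: "nat \<Rightarrow> real"
  assumes "open T" "x \<in> T"
  shows "\<exists>n e. e > 0 \<and> (\<forall>y. (\<forall>i<n. \<bar>y i - x i\<bar> \<le> e) \<longrightarrow> y \<in> T)"
proof -
  have *: "openin (product_topology (\<lambda>_. euclidean) UNIV) T"
    using assms(1) by (simp add: euclidean_product_topology)
  obtain X where X: "x \<in> Pi\<^sub>E UNIV X" "\<And>i. open (X i)" "finite {i. X i \<noteq> UNIV}" "Pi\<^sub>E UNIV X \<subseteq> T"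
    using product_topology_open_contains_basis[OF * assms(2)] by auto
  have "\<exists>e>0. \<forall>t. \<bar>t - x i\<bar> \<le> e \<longrightarrow> t \<in> X i" for i
  proof -
    have "x i \<in> X i" using X(1) by auto
    then obtain e where "e > 0" "cball (x i) e \<subseteq> X i"
      using X(2)[of i] open_contains_cball_eq by blast
    then show ?thesis by (intro exI[of _ e]) (auto simp: dist_real_def subset_iff abs_minus_commute)
  qed
  then obtain e where e: "\<And>i. e i > 0" "\<And>i t. \<bar>t - x i\<bar> \<le> e i \<Longrightarrow> t \<in> X i" by metis
  define F where "F = {i. X i \<noteq> UNIV}"
  obtain n where n: "F \<subseteq> {..<n}"
    using X(3) unfolding F_def by (metis finite_nat_set_iff_bounded lessThan_iff subsetI)
  \<comment> \<open>The element 1 keeps the minimum meaningful when no coordinate is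
    restricted.\<close>
  define d where "d = Min (insert 1 (e ` F))"
  have fin: "finite (insert 1 (e ` F))" using X(3) F_def by simp
  have "y \<in> T" if y: "\<forall>i<n. \<bar>y i - x i\<bar> \<le> d" for y
  proof -
    have "y i \<in> X i" for i
    proof (cases "i \<in> F")
      case True
      then have "d \<le> e i" unfolding d_def using fin by (intro Min_le) auto
      then show ?thesis using y n True e(2)[of "y i" i] by auto
    qed (auto simp: F_def)
    then show "y \<in> T" using X(4) by auto
  qed
  moreover have "d > 0" unfolding d_def using fin e(1) by (subst Min_gr_iff) auto
  ultimately show ?thesis by blast
qed

text \<open>Coordinates from \<open>n\<close> on vanish for both points, so the number of restricted
  coordinates, unknown before, can be replaced by the dimension.\<close>

lemma openin_Euclidean_contains_cube:
  assumes "openin (Euclidean_space n) S" "x \<in> S"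
  shows "\<exists>e>0. \<forall>y\<in>Rn n. (\<forall>i<n. \<bar>y i - x i\<bar> \<le> e) \<longrightarrow> y \<in> S"
proof -
  obtain T where T: "open T" "S = Rn n \<inter> T"
    using assms(1) unfolding openin_Euclidean_iff by auto
  obtain m e where me: "e > 0" "\<And>y. \<forall>i<m. \<bar>y i - x i\<bar> \<le> e \<Longrightarrow> y \<in> T"
    using open_fun_contains_cube[of T x] T assms(2) by auto
  have x: "x \<in> Rn n" using assms T by auto
  have "y \<in> S" if y: "y \<in> Rn n" "\<forall>i<n. \<bar>y i - x i\<bar> \<le> e" for y
  proof -
    have "\<bar>y i - x i\<bar> \<le> e" for i
      using y x me(1) by (cases "i < n") (auto simp: Rn_iff)
    then show "y \<in> S" using me(2) T(2) y(1) by blast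
  qed
  then show ?thesis using me(1) by blast
qed

lemma tendsto_fun_coordinatewise:
  fixes g :: "'a \<Rightarrow> nat \<Rightarrow> real"
  assumes "\<And>i. ((\<lambda>t. g t i) \<longlongrightarrow> l i) F"
  shows "(g \<longlongrightarrow> l) F"
proof (rule topological_tendstoI)
  fix S assume "open S" "l \<in> S"
  then obtain n e where e: "e > 0" "\<And>y. \<forall>i<n. \<bar>y i - l i\<bar> \<le> e \<Longrightarrow> y \<in> S"
    using open_fun_contains_cube by blast
  have "\<forall>\<^sub>F t in F. \<forall>i\<in>{..<n}. dist (g t i) (l i) < e"
    using assms e(1) by (intro eventually_ball_finite) (auto simp: tendsto_iff)
  then show "\<forall>\<^sub>F t in F. g t \<in> S"
    by eventually_elim (auto intro!: e(2) simp: dist_real_def less_imp_le)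
qed

lemma fun_upd_in_Rn: "x \<in> Rn n \<Longrightarrow> i < n \<Longrightarrow> x(i := t) \<in> Rn n"
  by (auto simp: Rn_iff)

lemma eventually_in_openin_Euclidean:
  assumes "openin (Euclidean_space n) S" "(g \<longlongrightarrow> x) F" "x \<in> S" "\<forall>\<^sub>F t in F. g t \<in> Rn n"
  shows "\<forall>\<^sub>F t in F. g t \<in> S"
proof -
  obtain T where T: "open T" "S = Rn n \<inter> T"
    using assms(1) unfolding openin_Euclidean_iff by auto
  have "\<forall>\<^sub>F t in F. g t \<in> T" using topological_tendstoD[OF assms(2)] T assms(3) by auto
  with assms(4) show ?thesis by eventually_elim (use T in auto)
qed

text \<open>Because of this a partial derivative at a point of \<open>S\<close> sees only the values
  of the function on \<open>S\<close>, although \<open>pderiv_at\<close> refers to no set.\<close>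

lemma eventually_line_in_openin:
  assumes "openin (Euclidean_space n) S" "x \<in> S" "i < n"
  shows "\<forall>\<^sub>F t in nhds (x i). x(i := t) \<in> S"
proof -
  have a: "((\<lambda>t. x(i := t)) \<longlongrightarrow> x) (nhds (x i))"
  proof (rule tendsto_fun_coordinatewise)
    fix j show "((\<lambda>t. (x(i := t)) j) \<longlongrightarrow> x j) (nhds (x i))"
      by (cases "j = i") (simp_all add: filterlim_ident)
  qed
  have "x \<in> Rn n" using subsetD[OF openin_Euclidean_subset[OF assms(1)] assms(2)] .
  then have "x(i := t) \<in> Rn n" for t
    using fun_upd_in_Rn assms(3) by blast
  then have b: "\<forall>\<^sub>F t in nhds (x i). x(i := t) \<in> Rn n"
    by simp
  show ?thesis by (rule eventually_in_openin_Euclidean[OF assms(1) a assms(2) b])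
qed

subsection \<open>Functions of class \<open>C\<^sup>k\<close>\<close>

declare Ck_on.simps [simp del]

lemma Ck_on_continuous_on:
  assumes "Ck_on n k S f" "S \<subseteq> Rn n"
  shows "continuous_on S f"
  using assms by (cases k) (auto simp: Ck_on.simps continuous_map_Euclidean_iff)

lemma Ck_on_0:
  assumes "openin (Euclidean_space n) S"
  shows "Ck_on n 0 S f \<longleftrightarrow> continuous_on S f"
  using assms by (simp add: Ck_on.simps continuous_map_Euclidean_iff openin_Euclidean_subset)

text \<open>\<open>deriv\<close> has a meaning only where a derivative exists. Fusing
  differentiability with the value of \<open>pderiv_at\<close> gives the form in which derivative
  rules apply directly.\<close>

lemma Ck_on_Suc:
  assumes "openin (Euclidean_space n) S"
  shows "Ck_on n (Suc k) S f \<longleftrightarrow> continuous_on S f \<and>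
    (\<forall>i<n. (\<forall>x\<in>S. ((\<lambda>t. f (x(i := t))) has_real_derivative pderiv_at i f x) (at (x i))) \<and>
           Ck_on n k S (pderiv_at i f))"
  using assms
  by (simp add: Ck_on.simps continuous_map_Euclidean_iff openin_Euclidean_subset pderiv_at_def
      DERIV_deriv_iff_real_differentiable)

lemma pderiv_at_cong:
  assumes "openin (Euclidean_space n) S" "x \<in> S" "i < n" "\<And>y. y \<in> S \<Longrightarrow> f y = g y"
  shows "pderiv_at i f x = pderiv_at i g x"
  unfolding pderiv_at_def
proof (rule deriv_cong_ev[OF _ refl])
  show "\<forall>\<^sub>F t in nhds (x i). f (x(i := t)) = g (x(i := t))"
    using eventually_line_in_openin[OF assms(1-3)] by eventually_elim (rule assms(4))
qed

lemma Ck_on_cong: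
  assumes "openin (Euclidean_space n) S" "\<And>x. x \<in> S \<Longrightarrow> f x = g x"
  shows "Ck_on n k S f \<longleftrightarrow> Ck_on n k S g"
  using assms(2)
proof (induction k arbitrary: f g)
  case 0
  then have "continuous_on S f \<longleftrightarrow> continuous_on S g" by (intro continuous_on_cong refl)
  then show ?case by (simp only: Ck_on_0[OF assms(1)])
next
  case (Suc k)
  have p: "pderiv_at i f x = pderiv_at i g x" if "i < n" "x \<in> S" for i x
    using pderiv_at_cong[OF assms(1)] that Suc.prems by blast
  have d: "((\<lambda>t. f (x(i := t))) has_real_derivative D) (at (x i)) \<longleftrightarrow>
      ((\<lambda>t. g (x(i := t))) has_real_derivative D) (at (x i))" if "i < n" "x \<in> S" for i x D
  proof -
    have "\<forall>\<^sub>F t in nhds (x i). f (x(i := t)) = g (x(i := t))"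
      using eventually_line_in_openin[OF assms(1) that(2,1)] by eventually_elim (rule Suc.prems)
    then show ?thesis by (intro DERIV_cong_ev refl)
  qed
  have "continuous_on S f \<longleftrightarrow> continuous_on S g" by (intro continuous_on_cong refl Suc.prems)
  moreover have "Ck_on n k S (pderiv_at i f) \<longleftrightarrow> Ck_on n k S (pderiv_at i g)" if "i < n" for i
    by (rule Suc.IH) (rule p[OF that])
  ultimately show ?case
    by (simp add: Ck_on_Suc[OF assms(1)] p d cong: conj_cong)
qed

text \<open>Lets a closed expression \<open>g i\<close> stand for the partial derivative, so that
  closure properties can be applied to \<open>g i\<close> in inductions on the order.\<close>

lemma Ck_on_SucI:
  assumes "openin (Euclidean_space n) S" "continuous_on S f"
    and "\<And>i x. i < n \<Longrightarrow> x \<in> S \<Longrightarrow> ((\<lambda>t. f (x(i := t))) has_real_derivative g i x) (at (x i))"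
    and "\<And>i. i < n \<Longrightarrow> Ck_on n k S (g i)"
  shows "Ck_on n (Suc k) S f"
proof -
  have "pderiv_at i f x = g i x" if "i < n" "x \<in> S" for i x
    unfolding pderiv_at_def using assms(3)[OF that] by (rule DERIV_imp_deriv)
  then show ?thesis
    using assms Ck_on_cong[OF assms(1), of "pderiv_at _ f"] by (auto simp: Ck_on_Suc)
qed

lemma Ck_on_SucD:
  assumes "openin (Euclidean_space n) S" "Ck_on n (Suc k) S f"
  shows "Ck_on n k S f"
  using assms(2)
proof (induction k arbitrary: f)
  case 0
  then show ?case using assms(1) by (auto simp: Ck_on_Suc Ck_on_0)
next
  case (Suc k)
  then show ?case using assms(1) by (auto simp only: Ck_on_Suc)
qed

lemma Ck_on_mono:
  assumes S: "openin (Euclidean_space n) S" and "Ck_on n l S f" "k \<le> l"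
  shows "Ck_on n k S f"
  using assms(3,2)
proof (induction l rule: dec_induct)
  case (step l)
  from step.IH[OF Ck_on_SucD[OF S step.prems]] show ?case .
qed

text \<open>Every clause is local. For continuity this needs that \<open>T\<close> is the trace on
  \<open>S\<close> of an open set, so that the filters within \<open>T\<close> and within
  \<open>S\<close> coincide at the point.\<close>

lemma Ck_on_local:
  assumes S: "openin (Euclidean_space n) S"
    and loc: "\<And>x. x \<in> S \<Longrightarrow> \<exists>T. openin (Euclidean_space n) T \<and> x \<in> T \<and> T \<subseteq> S \<and> Ck_on n k T f"
  shows "Ck_on n k S f"
  using loc
proof (induction k arbitrary: f)
  have *: "continuous_on S f"
    if loc: "\<And>x. x \<in> S \<Longrightarrow> \<exists>T. openin (Euclidean_space n) T \<and> x \<in> T \<and> T \<subseteq> S \<and> continuous_on T f"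
    for f :: "(nat \<Rightarrow> real) \<Rightarrow> real"
  proof -
    have "continuous (at x within S) f" if x: "x \<in> S" for x
    proof -
      obtain T where T: "openin (Euclidean_space n) T" "x \<in> T" "T \<subseteq> S" "continuous_on T f"
        using loc x by blast
      obtain O1 where O: "open O1" "T = Rn n \<inter> O1"
        using T(1) unfolding openin_Euclidean_iff by auto
      have "T = S \<inter> O1" using O T(3) openin_Euclidean_subset[OF S] by auto
      then have "at x within T = at x within S"
        using T(2) O(1) by (intro at_within_nhd[of x O1]) auto
      then show ?thesis using T(2,4) by (metis continuous_on_eq_continuous_within)
    qed
    then show ?thesis by (simp add: continuous_on_eq_continuous_within)
  qed
  {
    case 0
    show ?case unfolding Ck_on_0[OF S] using 0 by (intro *) (metis Ck_on_0)
  next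
    case (Suc k)
    show ?case unfolding Ck_on_Suc[OF S]
    proof (intro conjI allI impI ballI)
      show "continuous_on S f" using Suc.prems by (intro *) (metis Ck_on_Suc)
      fix i assume i: "i < n"
      show "Ck_on n k S (pderiv_at i f)" using Suc.prems i by (intro Suc.IH) (metis Ck_on_Suc)
      fix x assume "x \<in> S"
      then show "((\<lambda>t. f (x(i := t))) has_real_derivative pderiv_at i f x) (at (x i))"
        using Suc.prems i by (metis Ck_on_Suc)
    qed
  }
qed

lemma Ck_on_subset:
  assumes "Ck_on n k S f" "openin (Euclidean_space n) S" "openin (Euclidean_space n) T" "T \<subseteq> S"
  shows "Ck_on n k T f"
  using assms(1)
proof (induction k arbitrary: f)
  case 0
  then show ?case using assms(2-4) continuous_on_subset by (auto simp: Ck_on_0)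
next
  case (Suc k)
  then show ?case using assms(2-4) continuous_on_subset by (auto simp: Ck_on_Suc)
qed

lemma Ck_on_const: "openin (Euclidean_space n) S \<Longrightarrow> Ck_on n k S (\<lambda>x. c)"
proof (induction k arbitrary: c)
  case 0
  then show ?case by (simp add: Ck_on_0)
next
  case (Suc k)
  then show ?case by (intro Ck_on_SucI[where g="\<lambda>_ _. 0"]) auto
qed

lemma Ck_on_coordinate:
  assumes S: "openin (Euclidean_space n) S"
  shows "Ck_on n k S (\<lambda>x. x j)"
proof -
  have c: "continuous_on S (\<lambda>x. x j :: real)"
    by (rule continuous_on_subset[OF continuous_on_product_coordinates subset_UNIV])
  show ?thesis
  proof (cases k)
    case 0
    then show ?thesis using c by (simp add: Ck_on_0[OF S])
  next
    case (Suc k')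
    show ?thesis unfolding Suc
      by (rule Ck_on_SucI[where g="\<lambda>i x. if i = j then 1 else 0", OF S c])
        (auto intro: Ck_on_const[OF S])
  qed
qed

lemma Ck_on_add:
  assumes S: "openin (Euclidean_space n) S"
  shows "Ck_on n k S f \<Longrightarrow> Ck_on n k S g \<Longrightarrow> Ck_on n k S (\<lambda>x. f x + g x)"
proof (induction k arbitrary: f g)
  case 0
  then show ?case using S by (auto simp: Ck_on_0 intro!: continuous_intros)
next
  case (Suc k)
  show ?case
  proof (rule Ck_on_SucI[where g="\<lambda>i x. pderiv_at i f x + pderiv_at i g x", OF S])
    show "continuous_on S (\<lambda>x. f x + g x)"
      using Suc.prems S by (auto simp: Ck_on_Suc intro!: continuous_intros)
    fix i assume i: "i < n"
    show "Ck_on n k S (\<lambda>x. pderiv_at i f x + pderiv_at i g x)"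
      using Suc.prems S i by (auto simp: Ck_on_Suc intro!: Suc.IH)
    fix x assume x: "x \<in> S"
    show "((\<lambda>t. f (x(i := t)) + g (x(i := t))) has_real_derivative
        pderiv_at i f x + pderiv_at i g x) (at (x i))"
      using Suc.prems S i x by (intro DERIV_add) (auto simp: Ck_on_Suc)
  qed
qed

lemma Ck_on_mult:
  assumes S: "openin (Euclidean_space n) S"
  shows "Ck_on n k S f \<Longrightarrow> Ck_on n k S g \<Longrightarrow> Ck_on n k S (\<lambda>x. f x * g x)"
proof (induction k arbitrary: f g)
  case 0
  then show ?case using S by (auto simp: Ck_on_0 intro!: continuous_intros)
next
  case (Suc k)
  have fg: "Ck_on n k S f" "Ck_on n k S g" using Suc.prems Ck_on_SucD[OF S] by auto
  show ?case
  proof (rule Ck_on_SucI[where g="\<lambda>i x. pderiv_at i f x * g x + pderiv_at i g x * f x", OF S])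
    show "continuous_on S (\<lambda>x. f x * g x)" using Suc.prems S by (auto simp: Ck_on_Suc intro!: continuous_intros)
    fix i assume i: "i < n"
    show "Ck_on n k S (\<lambda>x. pderiv_at i f x * g x + pderiv_at i g x * f x)"
      using Suc.prems S i fg by (auto simp: Ck_on_Suc intro!: Ck_on_add Suc.IH)
    fix x assume x: "x \<in> S"
    show "((\<lambda>t. f (x(i := t)) * g (x(i := t))) has_real_derivative
        pderiv_at i f x * g x + pderiv_at i g x * f x) (at (x i))"
      using Suc.prems S i x DERIV_mult[of "\<lambda>t. f (x(i := t))" "pderiv_at i f x" "x i" UNIV
          "\<lambda>t. g (x(i := t))" "pderiv_at i g x"] by (auto simp: Ck_on_Suc)
  qed
qed

lemma Ck_on_sum:
  assumes S: "openin (Euclidean_space n) S" and "\<And>i. i \<in> I \<Longrightarrow> Ck_on n k S (f i)"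
  shows "Ck_on n k S (\<lambda>x. \<Sum>i\<in>I. f i x)"
  using assms(2)
proof (induction I rule: infinite_finite_induct)
  case (insert i I)
  then show ?case by (simp add: Ck_on_add[OF S])
qed (simp_all add: Ck_on_const[OF S])

lemma Ck_on_inverse:
  assumes S: "openin (Euclidean_space n) S" and nz: "\<And>x. x \<in> S \<Longrightarrow> f x \<noteq> 0"
  shows "Ck_on n k S f \<Longrightarrow> Ck_on n k S (\<lambda>x. inverse (f x))"
proof (induction k)
  case 0
  then show ?case using S nz by (auto simp: Ck_on_0 intro!: continuous_intros)
next
  case (Suc k)
  have f: "Ck_on n k S f" using Suc.prems Ck_on_SucD[OF S] by auto
  \<comment> \<open>The derivative is written as a product of factors already known to be of class
    \<open>k\<close>; for \<open>inverse (f x)\<close> this is the induction hypothesis.\<close>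
  show ?case
  proof (rule Ck_on_SucI[where g="\<lambda>i x. (- 1) * (pderiv_at i f x * (inverse (f x) * inverse (f x)))", OF S])
    show "continuous_on S (\<lambda>x. inverse (f x))"
      using Suc.prems S nz by (auto simp: Ck_on_Suc intro!: continuous_intros)
    fix i assume i: "i < n"
    show "Ck_on n k S (\<lambda>x. (- 1) * (pderiv_at i f x * (inverse (f x) * inverse (f x))))"
      using Suc.prems S i f by (intro Ck_on_mult[OF S] Ck_on_const Suc.IH) (auto simp: Ck_on_Suc)
    fix x assume x: "x \<in> S"
    show "((\<lambda>t. inverse (f (x(i := t)))) has_real_derivative
       (- 1) * (pderiv_at i f x * (inverse (f x) * inverse (f x)))) (at (x i))"
      using Suc.prems S i x DERIV_inverse'[of "\<lambda>t. f (x(i := t))" "pderiv_at i f x" "x i" UNIV] nz[OF x]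
      by (auto simp: Ck_on_Suc algebra_simps)
  qed
qed

subsection \<open>The chain rule\<close>

text \<open>In the chain rule the increment of a coordinate can have either sign or vanish, so
  nothing may be assumed about the order of \<open>a\<close> and \<open>b\<close>.\<close>

lemma mean_value_any_order:
  fixes f f' :: "real \<Rightarrow> real"
  assumes "\<And>t. min a b \<le> t \<Longrightarrow> t \<le> max a b \<Longrightarrow> (f has_real_derivative f' t) (at t)"
  shows "\<exists>\<xi>. min a b \<le> \<xi> \<and> \<xi> \<le> max a b \<and> f b - f a = (b - a) * f' \<xi>"
proof (cases a b rule: linorder_cases)
  case less
  then obtain z where "a < z" "z < b" "f b - f a = (b - a) * f' z"
    using MVT2[of a b f f'] assms by auto
  then show ?thesis using less by (intro exI[of _ z]) auto
next
  case greater
  then obtain z where "b < z" "z < a" "f a - f b = (a - b) * f' z"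
    using MVT2[of b a f f'] assms by auto
  then show ?thesis using greater by (intro exI[of _ z]) (auto simp: algebra_simps)
qed auto

text \<open>Only one coordinate moves in each step, so that the one-variable mean value theorem applies.\<close>

lemma chain_rule_step:
  assumes T: "openin (Euclidean_space n) T" and f: "Ck_on n (Suc 0) T f" and m: "m < n"
    and z0: "z t0 \<in> T" and zR: "\<And>t. z t \<in> Rn n"
    and z: "\<And>i. ((\<lambda>t. z t i) \<longlongrightarrow> z t0 i) (at t0)"
    and zm: "\<And>t. z t m = z t0 m"
    and g: "(g has_real_derivative d) (at t0)" and g0: "g t0 = z t0 m"
  shows "((\<lambda>t. f ((z t)(m := g t)) - f (z t)) has_real_derivative pderiv_at m f (z t0) * d) (at t0)"
proof -
  obtain e where e: "e > 0" "\<And>y. y \<in> Rn n \<Longrightarrow> \<forall>i<n. \<bar>y i - z t0 i\<bar> \<le> e \<Longrightarrow> y \<in> T"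
    using openin_Euclidean_contains_cube[OF T z0] by blast
  have gc: "(g \<longlongrightarrow> z t0 m) (at t0)" using DERIV_isCont[OF g] g0 by (simp add: isCont_def)
  have "\<forall>\<^sub>F t in at t0. \<bar>g t - z t0 m\<bar> < e"
    using tendstoD[OF gc e(1)] by (simp add: dist_real_def)
  moreover have "\<forall>\<^sub>F t in at t0. \<forall>i\<in>{..<n}. \<bar>z t i - z t0 i\<bar> < e"
    using tendstoD[OF z e(1)] by (intro eventually_ball_finite) (auto simp: dist_real_def)
  ultimately have ev: "\<forall>\<^sub>F t in at t0. \<exists>\<xi>. min (z t0 m) (g t) \<le> \<xi> \<and> \<xi> \<le> max (z t0 m) (g t) \<and>
      f ((z t)(m := g t)) - f (z t) = (g t - z t0 m) * pderiv_at m f ((z t)(m := \<xi>))"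
  proof eventually_elim
    case (elim t)
    have "((\<lambda>s. f ((z t)(m := s))) has_real_derivative pderiv_at m f ((z t)(m := s))) (at s)"
      if s: "min (z t0 m) (g t) \<le> s" "s \<le> max (z t0 m) (g t)" for s
    proof -
      have *: "(z t)(m := s) \<in> T"
        using s elim e(1) m zR by (intro e(2) fun_upd_in_Rn) (auto simp: less_imp_le)
      have "\<forall>x\<in>T. ((\<lambda>r. f (x(m := r))) has_real_derivative pderiv_at m f x) (at (x m))"
        using f m by (simp add: Ck_on_Suc[OF T])
      from bspec[OF this *] show ?thesis by simp
    qed
    from mean_value_any_order[of "z t0 m" "g t" "\<lambda>s. f ((z t)(m := s))", OF this]
    show ?case using zm[of t] by (metis fun_upd_triv)
  qed
  \<comment> \<open>One intermediate point for each parameter; it is meaningful only for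
    \<open>t\<close> close to \<open>t0\<close>, which is enough for a limit.\<close>
  define \<xi> where "\<xi> t = (SOME \<xi>. min (z t0 m) (g t) \<le> \<xi> \<and> \<xi> \<le> max (z t0 m) (g t) \<and>
      f ((z t)(m := g t)) - f (z t) = (g t - z t0 m) * pderiv_at m f ((z t)(m := \<xi>)))" for t
  have xi: "\<forall>\<^sub>F t in at t0. min (z t0 m) (g t) \<le> \<xi> t \<and> \<xi> t \<le> max (z t0 m) (g t) \<and>
      f ((z t)(m := g t)) - f (z t) = (g t - z t0 m) * pderiv_at m f ((z t)(m := \<xi> t))"
    using ev unfolding \<xi>_def by eventually_elim (rule someI_ex)
  have xil: "(\<xi> \<longlongrightarrow> z t0 m) (at t0)"
  proof (rule tendsto_sandwich)
    show "\<forall>\<^sub>F t in at t0. min (z t0 m) (g t) \<le> \<xi> t" "\<forall>\<^sub>F t in at t0. \<xi> t \<le> max (z t0 m) (g t)"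
      using xi by (eventually_elim, blast)+
    show "((\<lambda>t. min (z t0 m) (g t)) \<longlongrightarrow> z t0 m) (at t0)" "((\<lambda>t. max (z t0 m) (g t)) \<longlongrightarrow> z t0 m) (at t0)"
      using tendsto_min[OF tendsto_const gc, of "z t0 m"] tendsto_max[OF tendsto_const gc, of "z t0 m"]
      by simp_all
  qed
  have lim: "((\<lambda>t. (z t)(m := \<xi> t)) \<longlongrightarrow> z t0) (at t0)"
  proof (rule tendsto_fun_coordinatewise)
    fix i show "((\<lambda>t. ((z t)(m := \<xi> t)) i) \<longlongrightarrow> z t0 i) (at t0)"
      using z[of i] xil by (cases "i = m") auto
  qed
  have inT: "\<forall>\<^sub>F t in at t0. (z t)(m := \<xi> t) \<in> T"
    using eventually_in_openin_Euclidean[OF T lim z0] zR m fun_upd_in_Rn by auto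
  \<comment> \<open>Here class \<open>C^1\<close> is used and not mere existence of partial
    derivatives: the intermediate points tend to \<open>z t0\<close>, where the partial derivative
    is continuous.\<close>
  have "((\<lambda>t. pderiv_at m f ((z t)(m := \<xi> t))) \<longlongrightarrow> pderiv_at m f (z t0)) (at t0)"
    using f m Ck_on_Suc[OF T] Ck_on_0[OF T] by (intro continuous_on_tendsto_compose[OF _ lim z0 inT]) auto
  then have "((\<lambda>t. pderiv_at m f ((z t)(m := \<xi> t)) * ((g t - g t0) / (t - t0))) \<longlongrightarrow> pderiv_at m f (z t0) * d) (at t0)"
    using g by (intro tendsto_mult) (auto simp: has_field_derivative_iff)
  \<comment> \<open>The subtracted value at \<open>t0\<close> is zero because
    \<open>g t0 = z t0 m\<close>; it gives the quotient the shape of a difference quotient.\<close>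
  then have "((\<lambda>t. (f ((z t)(m := g t)) - f (z t) - (f ((z t0)(m := g t0)) - f (z t0))) / (t - t0))
      \<longlongrightarrow> pderiv_at m f (z t0) * d) (at t0)"
  proof (rule Lim_transform_eventually)
    show "\<forall>\<^sub>F t in at t0. pderiv_at m f ((z t)(m := \<xi> t)) * ((g t - g t0) / (t - t0)) =
        (f ((z t)(m := g t)) - f (z t) - (f ((z t0)(m := g t0)) - f (z t0))) / (t - t0)"
      using xi by eventually_elim (auto simp: g0)
  qed
  then show ?thesis by (simp add: has_field_derivative_iff)
qed

lemma chain_rule:
  assumes T: "openin (Euclidean_space n) T" and f: "Ck_on n (Suc 0) T f"
    and g0: "g t0 \<in> T" and gR: "\<And>t. g t \<in> Rn n"
    and g: "\<And>j. j < n \<Longrightarrow> ((\<lambda>t. g t j) has_real_derivative d j) (at t0)"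
  shows "((\<lambda>t. f (g t)) has_real_derivative (\<Sum>j<n. pderiv_at j f (g t0) * d j)) (at t0)"
proof -
  \<comment> \<open>In \<open>z m t\<close> the first \<open>m\<close> coordinates have moved to
    time \<open>t\<close> and the others rest at time \<open>t0\<close>. Passing from
    \<open>m\<close> to \<open>Suc m\<close> moves one coordinate and adds one summand.\<close>
  define z where "z m t = (\<lambda>i. if i < m then g t i else g t0 i)" for m t
  have zR: "z m t \<in> Rn n" for m t using gR by (auto simp: z_def Rn_iff)
  have z0: "z m t0 = g t0" for m by (auto simp: z_def)
  have *: "((\<lambda>t. f (z m t)) has_real_derivative (\<Sum>j<m. pderiv_at j f (g t0) * d j)) (at t0)"
    if "m \<le> n" for m
    using that
  proof (induction m)
    case 0
    then show ?case by (simp add: z_def)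
  next
    case (Suc m)
    have zl: "((\<lambda>t. z m t i) \<longlongrightarrow> z m t0 i) (at t0)" for i
    proof (cases "i < m")
      case True
      then show ?thesis using DERIV_isCont[OF g[of i]] Suc.prems by (simp add: z_def isCont_def)
    qed (simp add: z_def)
    have upd: "(z m t)(m := g t m) = z (Suc m) t" for t by (auto simp: z_def less_Suc_eq)
    have "((\<lambda>t. f ((z m t)(m := g t m)) - f (z m t)) has_real_derivative pderiv_at m f (z m t0) * d m) (at t0)"
    proof (rule chain_rule_step[where z="z m" and g="\<lambda>t. g t m", OF T f])
      show "m < n" "z m t0 \<in> T" "g t0 m = z m t0 m"
        using Suc.prems g0 by (simp_all add: z0)
      show "z m t \<in> Rn n" for t by (rule zR)
      show "((\<lambda>t. g t m) has_real_derivative d m) (at t0)" using g Suc.prems by simp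
      show "((\<lambda>t. z m t i) \<longlongrightarrow> z m t0 i) (at t0)" for i by (rule zl)
      show "z m t m = z m t0 m" for t by (simp add: z_def)
    qed
    from DERIV_add[OF this Suc.IH] Suc.prems show ?case by (simp add: upd z0 add.commute)
  qed
  \<comment> \<open>Coordinates from \<open>n\<close> on are zero at all times.\<close>
  have "z n = g"
  proof (intro ext)
    fix t i show "z n t i = g t i" using gR[of t] gR[of t0] by (simp add: z_def Rn_iff)
  qed
  with *[of n] show ?thesis by simp
qed

lemma chain_rule_partial:
  assumes T: "openin (Euclidean_space n) T" and S: "openin (Euclidean_space m) S"
    and f: "Ck_on n (Suc 0) T f" and g: "\<And>j. j < n \<Longrightarrow> Ck_on m (Suc 0) S (\<lambda>x. g x j)"
    and gT: "\<And>x. x \<in> S \<Longrightarrow> g x \<in> T" and x: "x \<in> S" and i: "i < m"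
  shows "((\<lambda>t. f (g (x(i := t)))) has_real_derivative
      (\<Sum>j<n. pderiv_at j f (g x) * pderiv_at i (\<lambda>x. g x j) x)) (at (x i))"
proof -
  text \<open>Off \<open>S\<close> the curve may leave \<open>\<real>\<^sup>n\<close>, so it is modified away from the parameter of interest.\<close>
  define h where "h t = (if x(i := t) \<in> S then g (x(i := t)) else g x)" for t
  have ev: "\<forall>\<^sub>F t in nhds (x i). h t = g (x(i := t))"
    using eventually_line_in_openin[OF S x i] by eventually_elim (simp add: h_def)
  have hx: "h (x i) = g x" by (simp add: h_def)
  have d: "((\<lambda>t. f (h t)) has_real_derivative (\<Sum>j<n. pderiv_at j f (h (x i)) * pderiv_at i (\<lambda>x. g x j) x)) (at (x i))"
  proof (rule chain_rule[OF T f])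
    show "h (x i) \<in> T" using gT x hx by simp
    show "h t \<in> Rn n" for t using gT x openin_Euclidean_subset[OF T] by (auto simp: h_def)
    fix j assume "j < n"
    then have d: "((\<lambda>t. g (x(i := t)) j) has_real_derivative pderiv_at i (\<lambda>x. g x j) x) (at (x i))"
      using g[of j] x i by (simp add: Ck_on_Suc[OF S])
    have "\<forall>\<^sub>F t in nhds (x i). h t j = g (x(i := t)) j"
      using ev by eventually_elim simp
    from iffD2[OF DERIV_cong_ev[OF refl this refl] d]
    show "((\<lambda>t. h t j) has_real_derivative pderiv_at i (\<lambda>x. g x j) x) (at (x i))" .
  qed
  have "\<forall>\<^sub>F t in nhds (x i). f (h t) = f (g (x(i := t)))"
    using ev by eventually_elim simp
  from iffD1[OF DERIV_cong_ev[OF refl this refl] d]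
  show "((\<lambda>t. f (g (x(i := t)))) has_real_derivative
      (\<Sum>j<n. pderiv_at j f (g x) * pderiv_at i (\<lambda>x. g x j) x)) (at (x i))"
    unfolding hx .
qed

text \<open>Induction on the order with \<open>f\<close> arbitrary: a derivative of the composite is
  a sum of products whose first factors are partial derivatives of \<open>f\<close> composed with
  the same \<open>g\<close>.\<close>

lemma Ck_on_compose:
  assumes T: "openin (Euclidean_space n) T" and S: "openin (Euclidean_space m) S"
    and f: "Ck_on n k T f" and g: "\<And>j. j < n \<Longrightarrow> Ck_on m k S (\<lambda>x. g x j)"
    and gT: "\<And>x. x \<in> S \<Longrightarrow> g x \<in> T"
  shows "Ck_on m k S (\<lambda>x. f (g x))"
proof -
  have gc: "continuous_on S g" if "\<And>j. j < n \<Longrightarrow> continuous_on S (\<lambda>x. g x j)"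
  proof (rule continuous_on_coordinatewise_then_product)
    fix i show "continuous_on S (\<lambda>x. g x i)"
    proof (cases "i < n")
      \<comment> \<open>Smoothness is assumed for the coordinates below \<open>n\<close> only; the
        others vanish since the values of \<open>g\<close> lie in \<open>T\<close>.\<close>
      case False
      then have "g x i = 0" if "x \<in> S" for x using gT[OF that] openin_Euclidean_subset[OF T] by (auto simp: Rn_iff)
      then show ?thesis using continuous_on_cong[of S S "\<lambda>x. g x i" "\<lambda>_. 0"] by auto
    qed (use that in auto)
  qed
  have fg: "continuous_on S (\<lambda>x. f (g x))" if "Ck_on n k T f" "\<And>j. j < n \<Longrightarrow> Ck_on m k S (\<lambda>x. g x j)" for f k
  proof (rule continuous_on_compose2[of T f S g])
    show "continuous_on T f" by (rule Ck_on_continuous_on[OF that(1) openin_Euclidean_subset[OF T]])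
    show "continuous_on S g" using that(2) by (intro gc Ck_on_continuous_on[OF _ openin_Euclidean_subset[OF S]])
  qed (use gT in auto)
  from f g show ?thesis
  proof (induction k arbitrary: f)
    case 0
    then show ?case using fg[of 0] S by (simp add: Ck_on_0)
  next
    case (Suc k)
    have f1: "Ck_on n (Suc 0) T f"
      by (rule Ck_on_mono[OF T Suc.prems(1)]) simp
    show ?case
    proof (rule Ck_on_SucI[where g="\<lambda>i x. \<Sum>j<n. pderiv_at j f (g x) * pderiv_at i (\<lambda>x. g x j) x", OF S])
      show "continuous_on S (\<lambda>x. f (g x))" using fg Suc.prems by blast
      fix i assume i: "i < m"
      show "Ck_on m k S (\<lambda>x. \<Sum>j<n. pderiv_at j f (g x) * pderiv_at i (\<lambda>x. g x j) x)"
      proof (intro Ck_on_sum[OF S] Ck_on_mult[OF S])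
        fix j assume "j \<in> {..<n}"
        then have j: "j < n" by simp
        show "Ck_on m k S (\<lambda>x. pderiv_at j f (g x))"
        proof (rule Suc.IH)
          show "Ck_on n k T (pderiv_at j f)" using Suc.prems(1) j by (simp add: Ck_on_Suc[OF T])
          show "Ck_on m k S (\<lambda>x. g x l)" if "l < n" for l
            by (rule Ck_on_SucD[OF S Suc.prems(2)[OF that]])
        qed
        show "Ck_on m k S (\<lambda>x. pderiv_at i (\<lambda>x. g x j) x)"
          using Suc.prems(2)[OF j] i by (simp add: Ck_on_Suc[OF S])
      qed
      fix x assume x: "x \<in> S"
      show "((\<lambda>t. f (g (x(i := t)))) has_real_derivative
          (\<Sum>j<n. pderiv_at j f (g x) * pderiv_at i (\<lambda>x. g x j) x)) (at (x i))"
        by (rule chain_rule_partial[OF T S f1 Ck_on_mono[OF S Suc.prems(2)] gT x i]) simp_all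
    qed
  qed
qed

subsection \<open>Smooth bump functions\<close>

text \<open>\<open>flat 1\<close> is the classical function exp(-1/t) extended by zero. The
  polynomial factor makes the family closed under differentiation.\<close>

definition flat :: "real poly \<Rightarrow> real \<Rightarrow> real" where
  "flat P t = (if t > 0 then poly P (1 / t) * exp (- (1 / t)) else 0)"

lemma poly_exp_tendsto_0: "((\<lambda>u. poly P u * exp (- u)) \<longlongrightarrow> (0::real)) at_top"
proof -
  have "((\<lambda>u. \<Sum>i\<le>degree P. coeff P i * (u ^ i / exp u)) \<longlongrightarrow> (\<Sum>i\<le>degree P. coeff P i * 0)) at_top"
    by (intro tendsto_intros tendsto_power_div_exp_0)
  moreover have "(\<Sum>i\<le>degree P. coeff P i * (u ^ i / exp u)) = poly P u * exp (- u)" for u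
    by (simp add: poly_altdef sum_distrib_right exp_minus divide_inverse mult.assoc)
  ultimately show ?thesis by simp
qed

text \<open>With u = 1/t one has du/dt = -u^2, so P(u) exp(-u) has derivative u^2 (P - P')(u)
  exp(-u). At 0 the right difference quotient is u P(u) exp(-u), which tends to 0 as u grows; the
  left one is 0.\<close>

lemma DERIV_flat: "(flat P has_real_derivative flat (monom 1 2 * (P - pderiv P)) x) (at x)"
proof (cases x "0::real" rule: linorder_cases)
  case less
  then have "\<forall>\<^sub>F t in nhds x. t < 0" by (intro eventually_nhds_in_open[of "{..<0}", simplified]) auto
  then have "\<forall>\<^sub>F t in nhds x. flat P t = 0" by eventually_elim (simp add: flat_def)
  then show ?thesis using less DERIV_cong_ev[of x x "flat P" "\<lambda>_. 0" 0 0] by (simp add: flat_def)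
next
  case greater
  have "\<forall>\<^sub>F t in nhds x. t > 0"
    using greater by (intro eventually_nhds_in_open[of "{0<..}", simplified]) auto
  then have ev: "\<forall>\<^sub>F t in nhds x. flat P t = poly P (1 / t) * exp (- (1 / t))"
    by eventually_elim (simp add: flat_def)
  have "((\<lambda>t. poly P (1 / t) * exp (- (1 / t))) has_real_derivative
      flat (monom 1 2 * (P - pderiv P)) x) (at x)"
    using greater
    by (auto intro!: derivative_eq_intros DERIV_chain2[OF poly_DERIV]
        simp: flat_def poly_monom power2_eq_square field_simps)
  with ev show ?thesis by (simp add: DERIV_cong_ev)
next
  case equal
  have "((\<lambda>u. poly (monom 1 1 * P) u * exp (- u)) \<longlongrightarrow> 0) at_top" by (rule poly_exp_tendsto_0)
  then have "((\<lambda>t. poly (monom 1 1 * P) (inverse t) * exp (- inverse t)) \<longlongrightarrow> 0) (at_right 0)"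
    by (rule filterlim_compose[OF _ filterlim_inverse_at_top_right])
  moreover have "\<forall>\<^sub>F t in at_right (0::real).
      poly (monom 1 1 * P) (inverse t) * exp (- inverse t) = (flat P t - flat P 0) / (t - 0)"
    using eventually_at_right_less[of 0]
    by eventually_elim (simp add: flat_def poly_monom field_simps)
  ultimately have r: "((\<lambda>t. (flat P t - flat P 0) / (t - 0)) \<longlongrightarrow> 0) (at_right 0)"
    by (rule Lim_transform_eventually)
  have "\<forall>\<^sub>F t in at_left (0::real). t < 0" by (simp add: eventually_at_filter)
  then have "\<forall>\<^sub>F t in at_left (0::real). (0::real) = (flat P t - flat P 0) / (t - 0)"
    by eventually_elim (simp add: flat_def)
  then have l: "((\<lambda>t. (flat P t - flat P 0) / (t - 0)) \<longlongrightarrow> 0) (at_left 0)"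
    by (rule Lim_transform_eventually[OF tendsto_const])
  have "((\<lambda>t. (flat P t - flat P 0) / (t - 0)) \<longlongrightarrow> 0) (at 0)"
    using filterlim_split_at[OF l r] .
  then show ?thesis by (simp add: equal has_field_derivative_iff flat_def)
qed

text \<open>The polynomial changes with each derivative, hence the induction is over all
  \<open>P\<close> at once.\<close>

lemma Ck_on_flat:
  assumes S: "openin (Euclidean_space n) S"
  shows "Ck_on n k S f \<Longrightarrow> Ck_on n k S (\<lambda>x. flat P (f x))"
proof (induction k arbitrary: P)
  have cont: "continuous_on S (\<lambda>x. flat P (f x))" if "continuous_on S f" for P
  proof (rule continuous_on_compose2[OF _ that])
    show "continuous_on UNIV (flat P)"
      using DERIV_flat DERIV_isCont by (blast intro: continuous_at_imp_continuous_on)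
  qed simp
  {
    case 0
    then show ?case using cont by (simp add: Ck_on_0[OF S])
  next
    case (Suc k)
    let ?P = "monom 1 2 * (P - pderiv P)"
    show ?case
    proof (rule Ck_on_SucI[where g="\<lambda>i x. flat ?P (f x) * pderiv_at i f x", OF S])
      show "continuous_on S (\<lambda>x. flat P (f x))" using Suc.prems cont by (simp add: Ck_on_Suc[OF S])
      fix i assume i: "i < n"
      show "Ck_on n k S (\<lambda>x. flat ?P (f x) * pderiv_at i f x)"
        using Suc.prems i Ck_on_SucD[OF S] by (intro Ck_on_mult[OF S] Suc.IH) (auto simp: Ck_on_Suc[OF S])
      fix x assume x: "x \<in> S"
      have "((\<lambda>t. f (x(i := t))) has_real_derivative pderiv_at i f x) (at (x i))"
        using Suc.prems i x by (simp add: Ck_on_Suc[OF S])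
      from DERIV_chain2[OF DERIV_flat this]
      show "((\<lambda>t. flat P (f (x(i := t)))) has_real_derivative flat ?P (f x) * pderiv_at i f x) (at (x i))"
        by simp
    qed
  }
qed

lemma openin_Rn: "openin (Euclidean_space n) (Rn n)"
  by (rule openin_topspace)

lemma bump_on_Rn:
  assumes "e > 0" and x0: "x0 \<in> Rn n"
  shows "\<exists>B N. (\<forall>k. Ck_on n k (Rn n) B) \<and> openin (Euclidean_space n) N \<and> x0 \<in> N \<and>
    (\<forall>y\<in>N. B y = 1) \<and> (\<forall>y\<in>Rn n. B y \<noteq> 0 \<longrightarrow> (\<forall>i<n. \<bar>y i - x0 i\<bar> \<le> e))"
proof -
  \<comment> \<open>\<open>q\<close> is positive exactly on the ball of radius \<open>e\<close>, and
    exceeds half of its maximum on a smaller concentric ball. In \<open>B\<close> the numerator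
    vanishes off the large ball, the second summand of the denominator vanishes on the small one,
    and the two summands are never zero together.\<close>
  define q :: "(nat \<Rightarrow> real) \<Rightarrow> real"
    where "q y = e\<^sup>2 + (- 1) * (\<Sum>i<n. (y i + - x0 i) * (y i + - x0 i))" for y
  define B where "B y = flat 1 (q y) * inverse (flat 1 (q y) + flat 1 (e\<^sup>2 / 2 + (- 1) * q y))" for y
  define N where "N = Rn n \<inter> {y. e\<^sup>2 / 2 < q y}"
  have q: "Ck_on n k (Rn n) q" for k
    unfolding q_def
    by (intro Ck_on_add Ck_on_mult Ck_on_sum Ck_on_const Ck_on_coordinate openin_Rn)
  have pos: "flat 1 t > 0 \<longleftrightarrow> t > 0" "flat 1 t \<ge> 0" for t by (auto simp: flat_def)
  have nz: "flat 1 (q y) + flat 1 (e\<^sup>2 / 2 + (- 1) * q y) \<noteq> 0" for y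
  proof (cases "q y > 0")
    case True
    then show ?thesis using pos(1)[of "q y"] pos(2)[of "e\<^sup>2 / 2 + (- 1) * q y"] by linarith
  next
    case False
    then have "e\<^sup>2 / 2 + (- 1) * q y > 0" using zero_less_power[OF \<open>e > 0\<close>, of 2] by linarith
    then show ?thesis using pos(1)[of "e\<^sup>2 / 2 + (- 1) * q y"] pos(2)[of "q y"] by linarith
  qed
  have B: "Ck_on n k (Rn n) B" for k
    unfolding B_def
    by (intro Ck_on_mult Ck_on_inverse Ck_on_flat Ck_on_add Ck_on_const openin_Rn nz q)
  have "continuous_on UNIV q"
    unfolding q_def by (intro continuous_intros continuous_on_product_coordinates)
  then have "open {y. e\<^sup>2 / 2 < q y}" by (intro open_Collect_less continuous_on_const)
  then have "openin (Euclidean_space n) N" unfolding N_def openin_Euclidean_iff by blast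
  moreover have "x0 \<in> N" using x0 \<open>e > 0\<close> by (simp add: N_def q_def)
  moreover have "B y = 1" if "y \<in> N" for y
  proof -
    have "flat 1 (e\<^sup>2 / 2 + (- 1) * q y) = 0" using that by (simp add: N_def flat_def)
    then show ?thesis using nz[of y] by (simp add: B_def)
  qed
  moreover have "\<bar>y i - x0 i\<bar> \<le> e" if "B y \<noteq> 0" "i < n" for y i
  proof -
    have "flat 1 (q y) \<noteq> 0" using that(1) by (auto simp: B_def)
    then have "q y > 0" by (auto simp: flat_def split: if_splits)
    moreover have "(y i - x0 i)\<^sup>2 \<le> (\<Sum>i<n. (y i - x0 i)\<^sup>2)"
      by (rule member_le_sum) (use that(2) in auto)
    ultimately have "(y i - x0 i)\<^sup>2 \<le> e\<^sup>2" by (simp add: q_def power2_eq_square)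
    then show ?thesis using \<open>e > 0\<close> abs_le_square_iff[of "y i - x0 i" e] by simp
  qed
  ultimately show ?thesis using B by blast
qed

section \<open>Smooth functions on a manifold\<close>

locale smooth_mfd =
  fixes M :: "'m manifold"
  assumes smooth_manifold: "smooth_manifold M"
begin

section \<open>Charts as homeomorphisms onto open sets\<close>

lemma chart_openin: "(U, \<phi>) \<in> charts M \<Longrightarrow> openin (mtop M) U"
  using smooth_manifold unfolding smooth_manifold_def by fast

lemma chart_subset: "(U, \<phi>) \<in> charts M \<Longrightarrow> U \<subseteq> pts M"
  using chart_openin openin_subset by blast

lemma chart_homeomorphic:
  "(U, \<phi>) \<in> charts M \<Longrightarrow> homeomorphic_map (subtopology (mtop M) U)
     (subtopology (Euclidean_space (mdim M)) (\<phi> ` U)) \<phi>"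
  using smooth_manifold unfolding smooth_manifold_def by fast

lemma chart_image_openin_self: "(U, \<phi>) \<in> charts M \<Longrightarrow> openin (Euclidean_space (mdim M)) (\<phi> ` U)"
  using smooth_manifold unfolding smooth_manifold_def by fast

lemma transition_smooth:
  assumes "(U, \<phi>) \<in> charts M" "(U', \<phi>') \<in> charts M" "i < mdim M"
  shows "smooth_on (mdim M) (\<phi> ` (U \<inter> U')) (\<lambda>y. \<phi>' (inv_into U \<phi> y) i)"
  using smooth_manifold assms unfolding smooth_manifold_def by fast

lemma chart_around:
  assumes "x \<in> pts M"
  obtains U \<phi> where "(U, \<phi>) \<in> charts M" "x \<in> U"
  using smooth_manifold assms unfolding smooth_manifold_def by fast

lemma chart_inj_on:
  assumes c: "(U, \<phi>) \<in> charts M"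
  shows "inj_on \<phi> U"
  using homeomorphic_imp_injective_map[OF chart_homeomorphic[OF c]] chart_subset[OF c]
  by (simp add: Int_absorb1)

lemma chart_image_openin:
  assumes c: "(U, \<phi>) \<in> charts M" and W: "openin (mtop M) W"
  shows "openin (Euclidean_space (mdim M)) (\<phi> ` (U \<inter> W))"
proof -
  have "openin (subtopology (mtop M) U) (U \<inter> W)" using W by (rule openin_subtopology_Int2)
  then have "openin (subtopology (Euclidean_space (mdim M)) (\<phi> ` U)) (\<phi> ` (U \<inter> W))"
    using homeomorphic_imp_open_map[OF chart_homeomorphic[OF c]] by (simp add: open_map_def)
  then show ?thesis using chart_image_openin_self[OF c] openin_trans_full by blast
qed

lemma chart_in_Rn:
  assumes c: "(U, \<phi>) \<in> charts M" and "x \<in> U"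
  shows "\<phi> x \<in> Rn (mdim M)"
  using openin_subset[OF chart_image_openin_self[OF c]] assms(2) by blast

lemma chart_preimage_openin:
  assumes c: "(U, \<phi>) \<in> charts M" and T: "openin (Euclidean_space (mdim M)) T"
  shows "openin (mtop M) {x \<in> U. \<phi> x \<in> T}"
proof -
  have "continuous_map (subtopology (mtop M) U) (subtopology (Euclidean_space (mdim M)) (\<phi> ` U)) \<phi>"
    using homeomorphic_imp_continuous_map[OF chart_homeomorphic[OF c]] .
  then have "continuous_map (subtopology (mtop M) U) (Euclidean_space (mdim M)) \<phi>"
    by (rule continuous_map_into_fulltopology)
  from openin_continuous_map_preimage[OF this T]
  have "openin (subtopology (mtop M) U) {x \<in> U. \<phi> x \<in> T}"
    using chart_subset[OF c] by (simp add: Int_absorb1)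
  then show ?thesis using chart_openin[OF c] openin_trans_full by blast
qed

text \<open>The openness required in \<open>smooth_on\<close> holds for every chart image of an open
  set, which leaves only the differentiability conditions to check.\<close>

lemma smooth_fun_on_iff:
  "smooth_fun_on M W f \<longleftrightarrow> openin (mtop M) W \<and>
    (\<forall>U \<phi>. (U, \<phi>) \<in> charts M \<longrightarrow> (\<forall>k. Ck_on (mdim M) k (\<phi> ` (U \<inter> W)) (\<lambda>y. f (inv_into U \<phi> y))))"
  unfolding smooth_fun_on_def smooth_on_def comp_def using chart_image_openin by fast

lemma smooth_fun_on_openin: "smooth_fun_on M W f \<Longrightarrow> openin (mtop M) W"
  by (simp add: smooth_fun_on_def)

lemma inv_chart:
  assumes "(U, \<phi>) \<in> charts M" "x \<in> U"
  shows "inv_into U \<phi> (\<phi> x) = x"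
  using inv_into_f_f[OF chart_inj_on[OF assms(1)] assms(2)] .

lemma smooth_fun_on_cong:
  assumes "smooth_fun_on M W f" "\<And>x. x \<in> W \<Longrightarrow> f x = g x"
  shows "smooth_fun_on M W g"
  unfolding smooth_fun_on_iff
proof (intro conjI allI impI)
  show W: "openin (mtop M) W" using assms(1) by (rule smooth_fun_on_openin)
  fix U \<phi> k assume c: "(U, \<phi>) \<in> charts M"
  have "f (inv_into U \<phi> y) = g (inv_into U \<phi> y)" if "y \<in> \<phi> ` (U \<inter> W)" for y
    using that inv_chart[OF c] assms(2) by auto
  moreover have "Ck_on (mdim M) k (\<phi> ` (U \<inter> W)) (\<lambda>y. f (inv_into U \<phi> y))"
    using assms(1) c by (simp add: smooth_fun_on_iff)
  ultimately show "Ck_on (mdim M) k (\<phi> ` (U \<inter> W)) (\<lambda>y. g (inv_into U \<phi> y))"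
    using Ck_on_cong[OF chart_image_openin[OF c W], of "\<lambda>y. f (inv_into U \<phi> y)"] by simp
qed

lemma smooth_fun_on_subset:
  assumes f: "smooth_fun_on M W f" and W': "openin (mtop M) W'" and "W' \<subseteq> W"
  shows "smooth_fun_on M W' f"
  unfolding smooth_fun_on_iff
proof (intro conjI allI impI W')
  fix U \<phi> k assume c: "(U, \<phi>) \<in> charts M"
  have "Ck_on (mdim M) k (\<phi> ` (U \<inter> W)) (\<lambda>y. f (inv_into U \<phi> y))"
    using f c by (simp add: smooth_fun_on_iff)
  then show "Ck_on (mdim M) k (\<phi> ` (U \<inter> W')) (\<lambda>y. f (inv_into U \<phi> y))"
    by (rule Ck_on_subset[OF _ chart_image_openin[OF c smooth_fun_on_openin[OF f]] chart_image_openin[OF c W']])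
      (use assms(3) in auto)
qed

lemma smooth_fun_on_local:
  assumes loc: "\<And>x. x \<in> W \<Longrightarrow> \<exists>W'. x \<in> W' \<and> W' \<subseteq> W \<and> smooth_fun_on M W' f"
  shows "smooth_fun_on M W f"
  unfolding smooth_fun_on_iff
proof (intro conjI allI impI)
  show W: "openin (mtop M) W"
    using loc smooth_fun_on_openin by (subst openin_subopen) blast
  fix U \<phi> k assume c: "(U, \<phi>) \<in> charts M"
  show "Ck_on (mdim M) k (\<phi> ` (U \<inter> W)) (\<lambda>y. f (inv_into U \<phi> y))"
  proof (rule Ck_on_local[OF chart_image_openin[OF c W]])
    fix y assume "y \<in> \<phi> ` (U \<inter> W)"
    then obtain x where x: "x \<in> U" "x \<in> W" "y = \<phi> x" by auto
    then obtain W' where W': "x \<in> W'" "W' \<subseteq> W" "smooth_fun_on M W' f" using loc by blast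
    have "Ck_on (mdim M) k (\<phi> ` (U \<inter> W')) (\<lambda>y. f (inv_into U \<phi> y))"
      using W'(3) c by (simp add: smooth_fun_on_iff)
    then show "\<exists>T. openin (Euclidean_space (mdim M)) T \<and> y \<in> T \<and> T \<subseteq> \<phi> ` (U \<inter> W) \<and>
        Ck_on (mdim M) k T (\<lambda>y. f (inv_into U \<phi> y))"
      using x W' chart_image_openin[OF c smooth_fun_on_openin[OF W'(3)]]
      by (intro exI[of _ "\<phi> ` (U \<inter> W')"]) auto
  qed
qed

lemma smooth_fun_on_const: "openin (mtop M) W \<Longrightarrow> smooth_fun_on M W (\<lambda>x. c)"
  by (simp add: smooth_fun_on_iff Ck_on_const chart_image_openin)

lemma smooth_fun_on_add:
  assumes "smooth_fun_on M W f" "smooth_fun_on M W g"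
  shows "smooth_fun_on M W (\<lambda>x. f x + g x)"
  using assms by (simp add: smooth_fun_on_iff Ck_on_add chart_image_openin)

lemma smooth_fun_on_mult:
  assumes "smooth_fun_on M W f" "smooth_fun_on M W g"
  shows "smooth_fun_on M W (\<lambda>x. f x * g x)"
  using assms by (simp add: smooth_fun_on_iff Ck_on_mult chart_image_openin)

lemma smooth_fun_on_sum:
  assumes "openin (mtop M) W" "\<And>i. i \<in> I \<Longrightarrow> smooth_fun_on M W (f i)"
  shows "smooth_fun_on M W (\<lambda>x. \<Sum>i\<in>I. f i x)"
  using assms by (simp add: smooth_fun_on_iff Ck_on_sum chart_image_openin)

lemma smooth_fun_on_minus:
  assumes "smooth_fun_on M W f" "smooth_fun_on M W g"
  shows "smooth_fun_on M W (\<lambda>x. f x - g x)"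
  using smooth_fun_on_add[OF assms(1) smooth_fun_on_mult[OF
      smooth_fun_on_const[OF smooth_fun_on_openin[OF assms(1)], of "- 1"] assms(2)]]
  by simp

text \<open>Smoothness is tested in all charts, but in a second chart the function is
  \<open>f\<close> composed with a transition map. A construction made in a single chart is
  therefore smooth on the manifold.\<close>

lemma smooth_fun_on_compose_chart:
  assumes c: "(U, \<phi>) \<in> charts M" and T: "openin (Euclidean_space (mdim M)) T"
    and f: "\<And>k. Ck_on (mdim M) k T f"
  shows "smooth_fun_on M {x \<in> U. \<phi> x \<in> T} (\<lambda>x. f (\<phi> x))"
  unfolding smooth_fun_on_iff
proof (intro conjI allI impI)
  let ?W = "{x \<in> U. \<phi> x \<in> T}"
  show W: "openin (mtop M) ?W" by (rule chart_preimage_openin[OF c T])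
  fix U' \<phi>' k assume c': "(U', \<phi>') \<in> charts M"
  show "Ck_on (mdim M) k (\<phi>' ` (U' \<inter> ?W)) (\<lambda>y. f (\<phi> (inv_into U' \<phi>' y)))"
  proof (rule Ck_on_compose[OF T chart_image_openin[OF c' W] f])
    fix j assume j: "j < mdim M"
    have "Ck_on (mdim M) k (\<phi>' ` (U' \<inter> U)) (\<lambda>y. \<phi> (inv_into U' \<phi>' y) j)"
      using transition_smooth[OF c' c j] by (simp add: smooth_on_def)
    then show "Ck_on (mdim M) k (\<phi>' ` (U' \<inter> ?W)) (\<lambda>y. \<phi> (inv_into U' \<phi>' y) j)"
      by (rule Ck_on_subset[OF _ chart_image_openin[OF c' chart_openin[OF c]] chart_image_openin[OF c' W]]) auto
  qed (use inv_chart[OF c'] in auto)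
qed

lemma smooth_fun_on_coordinate:
  assumes c: "(U, \<phi>) \<in> charts M"
  shows "smooth_fun_on M U (\<lambda>x. \<phi> x j)"
proof -
  have "smooth_fun_on M {x \<in> U. \<phi> x \<in> Rn (mdim M)} (\<lambda>x. \<phi> x j)"
    by (rule smooth_fun_on_compose_chart[OF c openin_Rn]) (rule Ck_on_coordinate[OF openin_Rn])
  moreover have "{x \<in> U. \<phi> x \<in> Rn (mdim M)} = U" using chart_in_Rn[OF c] by blast
  ultimately show ?thesis by simp
qed

section \<open>Gluing and bump functions on the manifold\<close>

lemma smooth_fun_on_Un:
  assumes "smooth_fun_on M W f" "smooth_fun_on M W' f"
  shows "smooth_fun_on M (W \<union> W') f"
  by (rule smooth_fun_on_local) (use assms in blast)

text \<open>Inside the full product space the cube is a product of compact intervals and, from index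
  \<open>n\<close> on, of the singleton of 0, so Tychonoff's theorem applies.\<close>

lemma compactin_cube: "compactin (Euclidean_space n) {y \<in> Rn n. \<forall>i<n. \<bar>y i - x i\<bar> \<le> e}"
proof -
  let ?X = "\<lambda>i. if i < n then {x i - e..x i + e} else {0::real}"
  have eq: "{y \<in> Rn n. \<forall>i<n. \<bar>y i - x i\<bar> \<le> e} = Pi\<^sub>E UNIV ?X"
  proof (intro set_eqI iffI)
    fix y assume y: "y \<in> {y \<in> Rn n. \<forall>i<n. \<bar>y i - x i\<bar> \<le> e}"
    have "y i \<in> ?X i" for i
    proof (cases "i < n")
      case True
      then have "\<bar>y i - x i\<bar> \<le> e" using y by simp
      then show ?thesis using True by (simp add: abs_le_iff)
    qed (use y in \<open>simp add: Rn_iff\<close>)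
    then show "y \<in> Pi\<^sub>E UNIV ?X" by (simp only: PiE_UNIV_domain Pi_iff) blast
  next
    fix y assume "y \<in> Pi\<^sub>E UNIV ?X"
    then have "\<forall>i. y i \<in> ?X i" by (simp only: PiE_UNIV_domain Pi_iff ball_UNIV UNIV_I simp_thms)
    then have y: "y i \<in> ?X i" for i by (rule spec)
    have "\<bar>y i - x i\<bar> \<le> e" if "i < n" for i using y[of i] that by (simp add: abs_le_iff)
    moreover have "y i = 0" if "i \<ge> n" for i using y[of i] that by simp
    ultimately show "y \<in> {y \<in> Rn n. \<forall>i<n. \<bar>y i - x i\<bar> \<le> e}" by (simp add: Rn_iff)
  qed
  have "compactin (powertop_real UNIV) (Pi\<^sub>E UNIV ?X)"
    by (simp add: compactin_PiE)
  moreover have "Pi\<^sub>E UNIV ?X \<subseteq> {x. \<forall>i\<ge>n. x i = 0}"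
    unfolding eq[symmetric] by (auto simp: Rn_iff)
  ultimately have "compactin (Euclidean_space n) (Pi\<^sub>E UNIV ?X)"
    unfolding Euclidean_space_def compactin_subtopology by (intro conjI)
  then show ?thesis unfolding eq .
qed

text \<open>The Hausdorff property makes the compact support of the bump function closed in \<open>M\<close>.\<close>

lemma bump_function:
  assumes W: "openin (mtop M) W" and x: "x \<in> W"
  obtains \<theta> N G where "smooth_fun_on M (pts M) \<theta>" "openin (mtop M) N" "x \<in> N" "N \<subseteq> W"
    "\<And>y. y \<in> N \<Longrightarrow> \<theta> y = 1" "openin (mtop M) G" "\<And>y. y \<in> G \<Longrightarrow> \<theta> y = 0" "pts M \<subseteq> W \<union> G"
proof -
  let ?E = "Euclidean_space (mdim M)"
  have xM: "x \<in> pts M" using openin_subset[OF W] x by blast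
  obtain U \<phi> where c: "(U, \<phi>) \<in> charts M" and xU: "x \<in> U" using chart_around[OF xM] .
  have "openin ?E (\<phi> ` (U \<inter> W))" "\<phi> x \<in> \<phi> ` (U \<inter> W)"
    using chart_image_openin[OF c W] x xU by auto
  from openin_Euclidean_contains_cube[OF this] obtain e where e: "e > 0"
    "\<forall>y\<in>Rn (mdim M). (\<forall>i<mdim M. \<bar>y i - \<phi> x i\<bar> \<le> e) \<longrightarrow> y \<in> \<phi> ` (U \<inter> W)" by blast
  define K where "K = {y \<in> Rn (mdim M). \<forall>i<mdim M. \<bar>y i - \<phi> x i\<bar> \<le> e}"
  have KS: "K \<subseteq> \<phi> ` (U \<inter> W)" using e(2) by (auto simp: K_def)
  obtain B N0 where B': "\<forall>k. Ck_on (mdim M) k (Rn (mdim M)) B" "openin ?E N0" "\<phi> x \<in> N0"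
    "\<forall>y\<in>N0. B y = 1" "\<forall>y\<in>Rn (mdim M). B y \<noteq> 0 \<longrightarrow> (\<forall>i<mdim M. \<bar>y i - \<phi> x i\<bar> \<le> e)"
    using bump_on_Rn[OF e(1) chart_in_Rn[OF c xU]] by blast
  have B: "\<And>k. Ck_on (mdim M) k (Rn (mdim M)) B" "openin ?E N0" "\<phi> x \<in> N0"
    "\<And>y. y \<in> N0 \<Longrightarrow> B y = 1" "\<And>y. y \<in> Rn (mdim M) \<Longrightarrow> B y \<noteq> 0 \<Longrightarrow> y \<in> K"
    using B' by (simp_all add: K_def)
  \<comment> \<open>A continuous inverse of the chart is taken in order to carry the compact cube
    into the manifold.\<close>
  obtain g where "homeomorphic_maps (subtopology (mtop M) U) (subtopology ?E (\<phi> ` U)) \<phi> g"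
    using chart_homeomorphic[OF c] unfolding homeomorphic_map_maps by blast
  then have gc: "continuous_map (subtopology ?E (\<phi> ` U)) (subtopology (mtop M) U) g"
    and g: "\<And>y. y \<in> U \<Longrightarrow> g (\<phi> y) = y"
    using chart_subset[OF c] by (auto simp: homeomorphic_maps_def)
  have "compactin (subtopology ?E (\<phi> ` U)) K"
    using compactin_cube KS by (auto simp: compactin_subtopology K_def)
  then have "compactin (subtopology (mtop M) U) (g ` K)" by (rule image_compactin[OF _ gc])
  then have "compactin (mtop M) (g ` K)" by (simp add: compactin_subtopology)
  then have "closedin (mtop M) (g ` K)"
    using smooth_manifold by (intro compactin_imp_closedin) (simp_all add: smooth_manifold_def)
  then have Gopen: "openin (mtop M) (pts M - g ` K)" by (rule openin_diff[OF openin_topspace])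
  have gK: "g ` K \<subseteq> U \<inter> W" using KS g by auto
  define \<theta> where "\<theta> y = (if y \<in> U then B (\<phi> y) else 0)" for y
  have \<theta>0: "\<theta> y = 0" if "y \<in> pts M - g ` K" for y
  proof (rule ccontr)
    assume "\<theta> y \<noteq> 0"
    then have y: "y \<in> U" "B (\<phi> y) \<noteq> 0" by (auto simp: \<theta>_def split: if_splits)
    then have "\<phi> y \<in> K" using B(5) chart_in_Rn[OF c] by blast
    then have "y \<in> g ` K" using g[OF y(1)] by (metis imageI)
    then show False using that by simp
  qed
  have "smooth_fun_on M {y \<in> U. \<phi> y \<in> Rn (mdim M)} (\<lambda>y. B (\<phi> y))"
    by (rule smooth_fun_on_compose_chart[OF c openin_Rn B(1)])
  moreover have "{y \<in> U. \<phi> y \<in> Rn (mdim M)} = U" using chart_in_Rn[OF c] by blast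
  ultimately have "smooth_fun_on M U (\<lambda>y. B (\<phi> y))" by simp
  then have s1: "smooth_fun_on M U \<theta>" by (rule smooth_fun_on_cong) (simp add: \<theta>_def)
  have s2: "smooth_fun_on M (pts M - g ` K) \<theta>"
    by (rule smooth_fun_on_cong[OF smooth_fun_on_const[OF Gopen, of 0]]) (simp add: \<theta>0)
  have "U \<union> (pts M - g ` K) = pts M" using gK chart_subset[OF c] by blast
  with smooth_fun_on_Un[OF s1 s2] have "smooth_fun_on M (pts M) \<theta>" by simp
  moreover have "openin (mtop M) ({y \<in> U. \<phi> y \<in> N0} \<inter> W)"
    using chart_preimage_openin[OF c B(2)] W by (rule openin_Int)
  moreover have "x \<in> {y \<in> U. \<phi> y \<in> N0} \<inter> W" using xU x B(3) by blast
  moreover have "\<theta> y = 1" if "y \<in> {y \<in> U. \<phi> y \<in> N0} \<inter> W" for y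
    using that B(4) by (simp add: \<theta>_def)
  moreover have "pts M \<subseteq> W \<union> (pts M - g ` K)" using gK by blast
  ultimately show thesis using Gopen \<theta>0
    by (intro that[of \<theta> "{y \<in> U. \<phi> y \<in> N0} \<inter> W" "pts M - g ` K"]) blast+
qed

end

section \<open>Tangent vectors and vector fields\<close>

lemma pderiv_at_DERIV:
  assumes "openin (Euclidean_space n) S" "Ck_on n (Suc 0) S f" "x \<in> S" "i < n"
  shows "((\<lambda>t. f (x(i := t))) has_real_derivative pderiv_at i f x) (at (x i))"
  using assms by (simp add: Ck_on_Suc)

lemma pderiv_at_eqI:
  "((\<lambda>t. f (x(i := t))) has_real_derivative D) (at (x i)) \<Longrightarrow> pderiv_at i f x = D"
  unfolding pderiv_at_def by (rule DERIV_imp_deriv)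

lemma pderiv_at_const: "pderiv_at i (\<lambda>x. c) x = 0"
  by (simp add: pderiv_at_def)

lemma pderiv_at_add:
  assumes "openin (Euclidean_space n) S" "Ck_on n (Suc 0) S f" "Ck_on n (Suc 0) S g" "x \<in> S" "i < n"
  shows "pderiv_at i (\<lambda>x. f x + g x) x = pderiv_at i f x + pderiv_at i g x"
  by (rule pderiv_at_eqI) (intro DERIV_add pderiv_at_DERIV[OF assms(1)] assms)

lemma pderiv_at_mult:
  assumes "openin (Euclidean_space n) S" "Ck_on n (Suc 0) S f" "Ck_on n (Suc 0) S g" "x \<in> S" "i < n"
  shows "pderiv_at i (\<lambda>x. f x * g x) x = pderiv_at i f x * g x + pderiv_at i g x * f x"
  using DERIV_mult[OF pderiv_at_DERIV[OF assms(1,2,4,5)] pderiv_at_DERIV[OF assms(1,3,4,5)]]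
  by (intro pderiv_at_eqI) simp

context smooth_mfd
begin

text \<open>Removes the case distinction on \<open>smooth_near\<close>. The chart is the one in
  which the vector happens to be given; independence of this choice comes later from the chain
  rule.\<close>

lemma tangent_vector_in_chart:
  assumes "D \<in> tangent_space M x"
  obtains U \<phi> a where "(U, \<phi>) \<in> charts M" "x \<in> U"
    "\<And>W f. smooth_fun_on M W f \<Longrightarrow> x \<in> W \<Longrightarrow>
       D f = (\<Sum>j<mdim M. a j * pderiv_at j (\<lambda>y. f (inv_into U \<phi> y)) (\<phi> x))"
proof -
  obtain U \<phi> a where c: "(U, \<phi>) \<in> charts M" "x \<in> U" and D: "D = (\<lambda>f. if smooth_near M x f
      then \<Sum>j < mdim M. a j * pderiv_at j (f \<circ> inv_into U \<phi>) (\<phi> x) else 0)"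
    using assms unfolding tangent_space_def by auto
  have "D f = (\<Sum>j<mdim M. a j * pderiv_at j (\<lambda>y. f (inv_into U \<phi> y)) (\<phi> x))"
    if "smooth_fun_on M W f" "x \<in> W" for W f
  proof -
    have "smooth_near M x f" using that unfolding smooth_near_def by blast
    then show ?thesis by (simp add: D comp_def)
  qed
  with c show thesis by (rule that)
qed

lemma smooth_fun_on_Ck:
  assumes "smooth_fun_on M W f" "(U, \<phi>) \<in> charts M"
  shows "Ck_on (mdim M) k (\<phi> ` (U \<inter> W)) (\<lambda>y. f (inv_into U \<phi> y))"
  using assms by (simp add: smooth_fun_on_iff)

text \<open>A tangent vector depends on the germ only. Smoothness of \<open>g\<close> near the point
  is inherited from \<open>f\<close>, so neither function falls under the default value 0.\<close>

lemma tangent_vector_cong: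
  assumes D: "D \<in> tangent_space M x" and f: "smooth_fun_on M W f" and x: "x \<in> W"
    and fg: "\<And>y. y \<in> W \<Longrightarrow> f y = g y"
  shows "D f = D g"
proof -
  obtain U \<phi> a where c: "(U, \<phi>) \<in> charts M" "x \<in> U" and
    D: "\<And>W f. smooth_fun_on M W f \<Longrightarrow> x \<in> W \<Longrightarrow>
       D f = (\<Sum>j<mdim M. a j * pderiv_at j (\<lambda>y. f (inv_into U \<phi> y)) (\<phi> x))"
    using tangent_vector_in_chart[OF D] by blast
  have S: "openin (Euclidean_space (mdim M)) (\<phi> ` (U \<inter> W))"
    using c(1) smooth_fun_on_openin[OF f] by (rule chart_image_openin)
  have "pderiv_at j (\<lambda>y. f (inv_into U \<phi> y)) (\<phi> x) = pderiv_at j (\<lambda>y. g (inv_into U \<phi> y)) (\<phi> x)"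
    if "j < mdim M" for j
    by (rule pderiv_at_cong[OF S _ that]) (use c x inv_chart[OF c(1)] fg in auto)
  then show ?thesis
    using D[OF f x] D[OF smooth_fun_on_cong[OF f fg] x] by simp
qed

lemma tangent_vector_const:
  assumes D: "D \<in> tangent_space M x" and x: "x \<in> pts M"
  shows "D (\<lambda>_. c) = 0"
proof -
  obtain U \<phi> a where c: "(U, \<phi>) \<in> charts M" "x \<in> U" and
    D: "\<And>W f. smooth_fun_on M W f \<Longrightarrow> x \<in> W \<Longrightarrow>
       D f = (\<Sum>j<mdim M. a j * pderiv_at j (\<lambda>y. f (inv_into U \<phi> y)) (\<phi> x))"
    using tangent_vector_in_chart[OF D] by blast
  from D[OF smooth_fun_on_const[OF openin_topspace] x] show ?thesis by (simp add: pderiv_at_const)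
qed

lemma tangent_vector_add:
  assumes D: "D \<in> tangent_space M x" and f: "smooth_fun_on M W f" and g: "smooth_fun_on M W g"
    and x: "x \<in> W"
  shows "D (\<lambda>y. f y + g y) = D f + D g"
proof -
  obtain U \<phi> a where c: "(U, \<phi>) \<in> charts M" "x \<in> U" and
    D: "\<And>W f. smooth_fun_on M W f \<Longrightarrow> x \<in> W \<Longrightarrow>
       D f = (\<Sum>j<mdim M. a j * pderiv_at j (\<lambda>y. f (inv_into U \<phi> y)) (\<phi> x))"
    using tangent_vector_in_chart[OF D] by blast
  have S: "openin (Euclidean_space (mdim M)) (\<phi> ` (U \<inter> W))"
    using c(1) smooth_fun_on_openin[OF f] by (rule chart_image_openin)
  have "\<phi> x \<in> \<phi> ` (U \<inter> W)" using c x by blast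
  note p = pderiv_at_add[OF S smooth_fun_on_Ck[OF f c(1)] smooth_fun_on_Ck[OF g c(1)] this]
  show ?thesis
    unfolding D[OF f x] D[OF g x] D[OF smooth_fun_on_add[OF f g] x] sum.distrib[symmetric]
    by (rule sum.cong) (simp_all add: p algebra_simps)
qed

lemma tangent_vector_mult:
  assumes D: "D \<in> tangent_space M x" and f: "smooth_fun_on M W f" and g: "smooth_fun_on M W g"
    and x: "x \<in> W"
  shows "D (\<lambda>y. f y * g y) = f x * D g + D f * g x"
proof -
  obtain U \<phi> a where c: "(U, \<phi>) \<in> charts M" "x \<in> U" and
    D: "\<And>W f. smooth_fun_on M W f \<Longrightarrow> x \<in> W \<Longrightarrow>
       D f = (\<Sum>j<mdim M. a j * pderiv_at j (\<lambda>y. f (inv_into U \<phi> y)) (\<phi> x))"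
    using tangent_vector_in_chart[OF D] by blast
  have S: "openin (Euclidean_space (mdim M)) (\<phi> ` (U \<inter> W))"
    using c(1) smooth_fun_on_openin[OF f] by (rule chart_image_openin)
  have "\<phi> x \<in> \<phi> ` (U \<inter> W)" using c x by blast
  note p = pderiv_at_mult[OF S smooth_fun_on_Ck[OF f c(1)] smooth_fun_on_Ck[OF g c(1)] this]
  show ?thesis
    unfolding D[OF f x] D[OF g x] D[OF smooth_fun_on_mult[OF f g] x] sum_distrib_left sum_distrib_right
      sum.distrib[symmetric]
    by (rule sum.cong) (simp_all add: p algebra_simps inv_chart[OF c])
qed

text \<open>The vector may have been given in another chart. The chain rule through the transition
  map turns its coefficients there into its values on the coordinate functions of the chosen
  chart.\<close>

lemma tangent_vector_coordinates:
  assumes D: "D \<in> tangent_space M x" and c: "(U, \<phi>) \<in> charts M" and xU: "x \<in> U"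
    and f: "smooth_fun_on M W f" and x: "x \<in> W"
  shows "D f = (\<Sum>k<mdim M. D (\<lambda>y. \<phi> y k) * pderiv_at k (\<lambda>y. f (inv_into U \<phi> y)) (\<phi> x))"
proof -
  obtain U' \<phi>' a where c': "(U', \<phi>') \<in> charts M" "x \<in> U'" and
    D: "\<And>W f. smooth_fun_on M W f \<Longrightarrow> x \<in> W \<Longrightarrow>
       D f = (\<Sum>j<mdim M. a j * pderiv_at j (\<lambda>y. f (inv_into U' \<phi>' y)) (\<phi>' x))"
    using tangent_vector_in_chart[OF D] by blast
  let ?n = "mdim M"
  let ?S = "\<phi>' ` (U' \<inter> (U \<inter> W))" and ?T = "\<phi> ` (U \<inter> W)"
  let ?g = "\<lambda>y. \<phi> (inv_into U' \<phi>' y)"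
  have UW: "openin (mtop M) (U \<inter> W)"
    using chart_openin[OF c] smooth_fun_on_openin[OF f] by (rule openin_Int)
  have S: "openin (Euclidean_space ?n) ?S" by (rule chart_image_openin[OF c'(1) UW])
  have T: "openin (Euclidean_space ?n) ?T" by (rule chart_image_openin[OF c smooth_fun_on_openin[OF f]])
  have xS: "\<phi>' x \<in> ?S" using c' xU x by blast
  have gx: "?g (\<phi>' x) = \<phi> x" by (simp add: inv_chart[OF c'])
  have pd: "pderiv_at j (\<lambda>y. f (inv_into U' \<phi>' y)) (\<phi>' x) =
      (\<Sum>k<?n. pderiv_at k (\<lambda>y. f (inv_into U \<phi> y)) (\<phi> x) * pderiv_at j (\<lambda>y. ?g y k) (\<phi>' x))"
    if j: "j < ?n" for j
  proof -
    have "pderiv_at j (\<lambda>y. f (inv_into U' \<phi>' y)) (\<phi>' x) =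
        pderiv_at j (\<lambda>y. f (inv_into U \<phi> (?g y))) (\<phi>' x)"
      by (rule pderiv_at_cong[OF S xS j]) (auto simp: inv_chart[OF c] inv_chart[OF c'(1)])
    also have "\<dots> = (\<Sum>k<?n. pderiv_at k (\<lambda>y. f (inv_into U \<phi> y)) (?g (\<phi>' x)) * pderiv_at j (\<lambda>y. ?g y k) (\<phi>' x))"
    proof (rule pderiv_at_eqI, rule chain_rule_partial[OF T S smooth_fun_on_Ck[OF f c] _ _ xS j])
      show "Ck_on ?n (Suc 0) ?S (\<lambda>y. ?g y k)" if "k < ?n" for k
      proof -
        have "Ck_on ?n (Suc 0) (\<phi>' ` (U' \<inter> U)) (\<lambda>y. ?g y k)"
          using transition_smooth[OF c'(1) c that] by (simp add: smooth_on_def)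
        then show ?thesis
          by (rule Ck_on_subset[OF _ chart_image_openin[OF c'(1) chart_openin[OF c]] S]) auto
      qed
      show "?g y \<in> ?T" if "y \<in> ?S" for y using that inv_chart[OF c'(1)] by auto
    qed
    finally show ?thesis unfolding gx .
  qed
  have coord: "D (\<lambda>y. \<phi> y k) = (\<Sum>j<?n. a j * pderiv_at j (\<lambda>y. ?g y k) (\<phi>' x))" for k
    by (rule D[OF smooth_fun_on_coordinate[OF c] xU])
  \<comment> \<open>After exchange of the sums, the inner sum over \<open>j\<close> is the value of
    \<open>D\<close> on the coordinate function number \<open>k\<close>.\<close>
  have "D f = (\<Sum>j<?n. \<Sum>k<?n. a j * (pderiv_at k (\<lambda>y. f (inv_into U \<phi> y)) (\<phi> x) * pderiv_at j (\<lambda>y. ?g y k) (\<phi>' x)))"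
    unfolding D[OF f x] by (rule sum.cong) (simp_all add: pd sum_distrib_left)
  also have "\<dots> = (\<Sum>k<?n. D (\<lambda>y. \<phi> y k) * pderiv_at k (\<lambda>y. f (inv_into U \<phi> y)) (\<phi> x))"
    unfolding coord sum_distrib_right by (subst sum.swap) (intro sum.cong refl, simp)
  finally show ?thesis .
qed

end

locale smooth_vector_field = smooth_mfd M for M :: "'m manifold" +
  fixes X :: "'m \<Rightarrow> 'm \<times> 'm derivation"
  assumes tangent: "\<And>x. x \<in> pts M \<Longrightarrow> snd (X x) \<in> tangent_space M x"
    and components_smooth: "\<And>U \<phi> j. (U, \<phi>) \<in> charts M \<Longrightarrow> j < mdim M \<Longrightarrow>
      smooth_fun_on M U (\<lambda>x. snd (X x) (\<lambda>y. \<phi> y j))"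
begin

lemma in_pts: "smooth_fun_on M W f \<Longrightarrow> x \<in> W \<Longrightarrow> x \<in> pts M"
  using smooth_fun_on_openin openin_subset by blast

lemma lie_deriv_fun_cong:
  assumes "smooth_fun_on M W f" "x \<in> W" "\<And>y. y \<in> W \<Longrightarrow> f y = g y"
  shows "lie_deriv_fun X f x = lie_deriv_fun X g x"
  unfolding lie_deriv_fun_def
  by (rule tangent_vector_cong[OF tangent[OF in_pts[OF assms(1,2)]] assms])

lemma lie_deriv_fun_const: "x \<in> pts M \<Longrightarrow> lie_deriv_fun X (\<lambda>_. c) x = 0"
  unfolding lie_deriv_fun_def by (rule tangent_vector_const[OF tangent])

lemma lie_deriv_fun_add:
  assumes "smooth_fun_on M W f" "smooth_fun_on M W g" "x \<in> W"
  shows "lie_deriv_fun X (\<lambda>y. f y + g y) x = lie_deriv_fun X f x + lie_deriv_fun X g x"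
  unfolding lie_deriv_fun_def
  by (rule tangent_vector_add[OF tangent[OF in_pts[OF assms(1,3)]] assms])

lemma lie_deriv_fun_mult:
  assumes "smooth_fun_on M W f" "smooth_fun_on M W g" "x \<in> W"
  shows "lie_deriv_fun X (\<lambda>y. f y * g y) x = f x * lie_deriv_fun X g x + lie_deriv_fun X f x * g x"
  unfolding lie_deriv_fun_def
  by (rule tangent_vector_mult[OF tangent[OF in_pts[OF assms(1,3)]] assms])

lemma lie_deriv_fun_sum:
  assumes W: "openin (mtop M) W" "x \<in> W" and f: "\<And>i. i \<in> I \<Longrightarrow> smooth_fun_on M W (f i)"
  shows "lie_deriv_fun X (\<lambda>y. \<Sum>i\<in>I. f i y) x = (\<Sum>i\<in>I. lie_deriv_fun X (f i) x)"
  using f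
proof (induction I rule: infinite_finite_induct)
  case (insert i I)
  have "lie_deriv_fun X (\<lambda>y. f i y + (\<Sum>i\<in>I. f i y)) x =
      lie_deriv_fun X (f i) x + lie_deriv_fun X (\<lambda>y. \<Sum>i\<in>I. f i y) x"
    using insert.prems W by (intro lie_deriv_fun_add[OF _ smooth_fun_on_sum[OF W(1)]]) auto
  then show ?case using insert by simp
qed (use openin_subset[OF W(1)] W(2) in \<open>auto simp: lie_deriv_fun_const\<close>)

text \<open>In a chart the derivative is the sum of the components of the field times partial
  derivatives of the function; one order is lost, but all orders are available.\<close>

lemma lie_deriv_fun_smooth:
  assumes f: "smooth_fun_on M W f"
  shows "smooth_fun_on M W (lie_deriv_fun X f)"
proof (rule smooth_fun_on_local)
  fix x assume x: "x \<in> W"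
  obtain U \<phi> where c: "(U, \<phi>) \<in> charts M" and xU: "x \<in> U"
    using chart_around[OF in_pts[OF f x]] .
  let ?f = "\<lambda>y. f (inv_into U \<phi> y)"
  let ?T = "\<phi> ` (U \<inter> W)"
  have UW: "openin (mtop M) (U \<inter> W)"
    using chart_openin[OF c] smooth_fun_on_openin[OF f] by (rule openin_Int)
  have T: "openin (Euclidean_space (mdim M)) ?T" by (rule chart_image_openin[OF c smooth_fun_on_openin[OF f]])
  have "{y \<in> U. \<phi> y \<in> ?T} = U \<inter> W" using chart_inj_on[OF c] by (auto dest: inj_onD)
  moreover have "smooth_fun_on M {y \<in> U. \<phi> y \<in> ?T} (\<lambda>y. pderiv_at k ?f (\<phi> y))" if "k < mdim M" for k
  proof (rule smooth_fun_on_compose_chart[OF c T])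
    fix l show "Ck_on (mdim M) l ?T (pderiv_at k ?f)"
      using smooth_fun_on_Ck[OF f c, of "Suc l"] that by (simp add: Ck_on_Suc[OF T])
  qed
  ultimately have s: "smooth_fun_on M (U \<inter> W) (\<lambda>y. pderiv_at k ?f (\<phi> y))" if "k < mdim M" for k
    using that by simp
  have "smooth_fun_on M (U \<inter> W) (\<lambda>y. \<Sum>k<mdim M. snd (X y) (\<lambda>z. \<phi> z k) * pderiv_at k ?f (\<phi> y))"
    using s smooth_fun_on_subset[OF components_smooth[OF c] UW]
    by (intro smooth_fun_on_sum[OF UW] smooth_fun_on_mult) auto
  then have "smooth_fun_on M (U \<inter> W) (lie_deriv_fun X f)"
  proof (rule smooth_fun_on_cong)
    fix y assume y: "y \<in> U \<inter> W"
    then show "(\<Sum>k<mdim M. snd (X y) (\<lambda>z. \<phi> z k) * pderiv_at k ?f (\<phi> y)) = lie_deriv_fun X f y"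
      unfolding lie_deriv_fun_def
      using tangent_vector_coordinates[OF tangent[OF in_pts[OF f]] c _ f] by simp
  qed
  then show "\<exists>W'. x \<in> W' \<and> W' \<subseteq> W \<and> smooth_fun_on M W' (lie_deriv_fun X f)"
    using x xU by blast
qed

end

section \<open>Sections of vector bundles\<close>

text \<open>Extends data given only on \<open>U\<close>. The set \<open>W\<close> is arbitrary
  because components of sections are smooth on domains of trivialisations that may overlap
  \<open>U\<close> only partly.\<close>

lemma (in smooth_mfd) cutoff_function:
  assumes U: "openin (mtop M) U" and x: "x \<in> U"
  obtains \<theta> N where "smooth_fun_on M (pts M) \<theta>" "openin (mtop M) N" "x \<in> N" "N \<subseteq> U"
    "\<And>y. y \<in> N \<Longrightarrow> \<theta> y = 1" "\<And>y. y \<in> pts M \<Longrightarrow> y \<notin> U \<Longrightarrow> \<theta> y = 0"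
    "\<And>W f. openin (mtop M) W \<Longrightarrow> smooth_fun_on M (U \<inter> W) f \<Longrightarrow>
       smooth_fun_on M W (\<lambda>y. if y \<in> U then \<theta> y * f y else 0)"
proof -
  obtain \<theta> N G where b: "smooth_fun_on M (pts M) \<theta>" "openin (mtop M) N" "x \<in> N" "N \<subseteq> U"
    "\<And>y. y \<in> N \<Longrightarrow> \<theta> y = 1" and G: "openin (mtop M) G" "\<And>y. y \<in> G \<Longrightarrow> \<theta> y = 0" "pts M \<subseteq> U \<union> G"
    using bump_function[OF U x] by blast
  have "smooth_fun_on M W (\<lambda>y. if y \<in> U then \<theta> y * f y else 0)"
    if W: "openin (mtop M) W" and f: "smooth_fun_on M (U \<inter> W) f" for W f
  proof -
    let ?h = "\<lambda>y. if y \<in> U then \<theta> y * f y else 0"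
    have UW: "openin (mtop M) (U \<inter> W)" using U W by (rule openin_Int)
    have \<theta>: "smooth_fun_on M (U \<inter> W) \<theta>"
      by (rule smooth_fun_on_subset[OF b(1) UW openin_subset[OF UW]])
    have 1: "smooth_fun_on M (U \<inter> W) ?h"
      by (rule smooth_fun_on_cong[OF smooth_fun_on_mult[OF \<theta> f]]) auto
    have GW: "openin (mtop M) (G \<inter> W)" using G(1) W by (rule openin_Int)
    have 2: "smooth_fun_on M (G \<inter> W) ?h"
      by (rule smooth_fun_on_cong[OF smooth_fun_on_const[OF GW, of 0]]) (auto simp: G(2))
    have "U \<inter> W \<union> G \<inter> W = W" using openin_subset[OF W] G(3) by blast
    with smooth_fun_on_Un[OF 1 2] show ?thesis by simp
  qed
  moreover have "\<theta> y = 0" if "y \<in> pts M" "y \<notin> U" for y using that G by blast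
  ultimately show thesis using b by (intro that[of \<theta> N]) simp_all
qed

lemma (in smooth_mfd) smooth_funs_iff: "f \<in> smooth_funs M \<longleftrightarrow> smooth_fun_on M (pts M) f"
  by (simp add: smooth_funs_def)

locale smooth_vb = smooth_mfd M for M :: "'m manifold" +
  fixes E :: "('e, 'm) vector_bundle"
  assumes smooth_vector_bundle: "smooth_vector_bundle M E"
begin

section \<open>Fibres, trivialisations and frames\<close>

lemma fibre_vector_space:
  "x \<in> pts M \<Longrightarrow> real_vector_space_on (fibre E x) (vadd E) (vscale E) (vzero E x)"
  using smooth_vector_bundle unfolding smooth_vector_bundle_def by (elim conjE) (erule bspec)

lemma
  assumes "x \<in> pts M"
  shows vzero_fibre: "vzero E x \<in> fibre E x"
    and vadd_fibre: "u \<in> fibre E x \<Longrightarrow> v \<in> fibre E x \<Longrightarrow> vadd E u v \<in> fibre E x"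
    and vscale_fibre: "u \<in> fibre E x \<Longrightarrow> vscale E a u \<in> fibre E x"
    and vadd_vzero: "u \<in> fibre E x \<Longrightarrow> vadd E (vzero E x) u = u"
    and vscale_one: "u \<in> fibre E x \<Longrightarrow> vscale E 1 u = u"
proof -
  note v = fibre_vector_space[OF assms, unfolded real_vector_space_on_def]
  show "vzero E x \<in> fibre E x" using v by (elim conjE)
  have "\<forall>u\<in>fibre E x. \<forall>v\<in>fibre E x. vadd E u v \<in> fibre E x" using v by (elim conjE)
  then show "u \<in> fibre E x \<Longrightarrow> v \<in> fibre E x \<Longrightarrow> vadd E u v \<in> fibre E x" by simp
  have "\<forall>a. \<forall>u\<in>fibre E x. vscale E a u \<in> fibre E x" using v by (elim conjE)
  then show "u \<in> fibre E x \<Longrightarrow> vscale E a u \<in> fibre E x" by simp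
  have "\<forall>u\<in>fibre E x. vadd E (vzero E x) u = u" using v by (elim conjE)
  then show "u \<in> fibre E x \<Longrightarrow> vadd E (vzero E x) u = u" by simp
  have "\<forall>u\<in>fibre E x. vscale E 1 u = u" using v by (elim conjE)
  then show "u \<in> fibre E x \<Longrightarrow> vscale E 1 u = u" by simp
qed

lemma triv_around:
  assumes "x \<in> pts M"
  obtains U \<Psi> where "(U, \<Psi>) \<in> trivs E" "x \<in> U"
proof -
  have "pts M \<subseteq> (\<Union>(U, \<Psi>) \<in> trivs E. U)"
    using smooth_vector_bundle unfolding smooth_vector_bundle_def by (elim conjE)
  then show thesis using assms that by fast
qed

lemma triv_openin_fibrewise:
  assumes "(U, \<Psi>) \<in> trivs E"
  shows "openin (mtop M) U \<and> (\<forall>x\<in>U. bij_betw \<Psi> (fibre E x) (Rn (vrank E)) \<and>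
          (\<forall>u \<in> fibre E x. \<forall>v \<in> fibre E x. \<Psi> (vadd E u v) = (\<lambda>k. \<Psi> u k + \<Psi> v k)) \<and>
          (\<forall>a. \<forall>u \<in> fibre E x. \<Psi> (vscale E a u) = (\<lambda>k. a * \<Psi> u k)))"
proof -
  have "\<forall>(U, \<Psi>) \<in> trivs E. openin (mtop M) U \<and>
        (\<forall>x\<in>U. bij_betw \<Psi> (fibre E x) (Rn (vrank E)) \<and>
          (\<forall>u \<in> fibre E x. \<forall>v \<in> fibre E x. \<Psi> (vadd E u v) = (\<lambda>k. \<Psi> u k + \<Psi> v k)) \<and>
          (\<forall>a. \<forall>u \<in> fibre E x. \<Psi> (vscale E a u) = (\<lambda>k. a * \<Psi> u k)))"
    using smooth_vector_bundle unfolding smooth_vector_bundle_def by (elim conjE)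
  from bspec[OF this assms] show ?thesis by simp
qed

lemma triv_openin: "(U, \<Psi>) \<in> trivs E \<Longrightarrow> openin (mtop M) U"
  by (rule conjunct1[OF triv_openin_fibrewise])

lemma triv_pts: "(U, \<Psi>) \<in> trivs E \<Longrightarrow> x \<in> U \<Longrightarrow> x \<in> pts M"
  using triv_openin openin_subset by blast

lemma
  assumes "(U, \<Psi>) \<in> trivs E" "x \<in> U"
  shows triv_bij: "bij_betw \<Psi> (fibre E x) (Rn (vrank E))"
    and triv_vadd: "u \<in> fibre E x \<Longrightarrow> v \<in> fibre E x \<Longrightarrow> \<Psi> (vadd E u v) k = \<Psi> u k + \<Psi> v k"
    and triv_vscale: "u \<in> fibre E x \<Longrightarrow> \<Psi> (vscale E a u) k = a * \<Psi> u k"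
  using triv_openin_fibrewise[OF assms(1)] assms(2) by simp_all

lemma triv_transition_smooth:
  assumes "(U, \<Psi>) \<in> trivs E" "(U', \<Psi>') \<in> trivs E" "i < vrank E" "j < vrank E"
  shows "smooth_fun_on M (U \<inter> U') (\<lambda>x. \<Psi>' (frame E \<Psi> x i) j)"
proof -
  have "\<forall>(U, \<Psi>) \<in> trivs E. \<forall>(U', \<Psi>') \<in> trivs E. \<forall>i < vrank E. \<forall>j < vrank E.
        smooth_fun_on M (U \<inter> U') (\<lambda>x. \<Psi>' (frame E \<Psi> x i) j)"
    using smooth_vector_bundle unfolding smooth_vector_bundle_def by (elim conjE)
  then show ?thesis using assms by fast
qed

lemma triv_zero_beyond:
  assumes "(U, \<Psi>) \<in> trivs E" "x \<in> U" "u \<in> fibre E x" "k \<ge> vrank E"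
  shows "\<Psi> u k = 0"
  using bij_betwE[OF triv_bij[OF assms(1,2)]] assms(3,4) Rn_iff by blast

lemma triv_eqI:
  assumes t: "(U, \<Psi>) \<in> trivs E" "x \<in> U" and "u \<in> fibre E x" "v \<in> fibre E x"
    and "\<And>k. k < vrank E \<Longrightarrow> \<Psi> u k = \<Psi> v k"
  shows "u = v"
proof -
  have "\<Psi> u k = \<Psi> v k" for k
    using assms triv_zero_beyond[OF t] by (cases "k < vrank E") auto
  then have "\<Psi> u = \<Psi> v" by (rule ext)
  then show ?thesis using bij_betw_imp_inj_on[OF triv_bij[OF t]] assms(3,4) by (auto dest: inj_onD)
qed

lemma
  assumes t: "(U, \<Psi>) \<in> trivs E" "x \<in> U" and i: "i < vrank E"
  shows frame_fibre: "frame E \<Psi> x i \<in> fibre E x"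
    and triv_frame: "\<Psi> (frame E \<Psi> x i) k = (if k = i then 1 else 0)"
proof -
  have "(\<lambda>k. if k = i then 1 else 0) \<in> \<Psi> ` fibre E x"
    using bij_betw_imp_surj_on[OF triv_bij[OF t]] i by (simp add: Rn_iff)
  then show "frame E \<Psi> x i \<in> fibre E x" "\<Psi> (frame E \<Psi> x i) k = (if k = i then 1 else 0)"
    unfolding frame_def by (auto intro: inv_into_into simp: f_inv_into_f)
qed

lemma triv_vzero:
  assumes t: "(U, \<Psi>) \<in> trivs E" "x \<in> U"
  shows "\<Psi> (vzero E x) k = 0"
proof -
  have x: "x \<in> pts M" by (rule triv_pts[OF t])
  show ?thesis
    using triv_vadd[OF t vzero_fibre[OF x] vzero_fibre[OF x], of k] vadd_vzero[OF x vzero_fibre[OF x]] by simp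
qed

text \<open>Instead of writing \<open>u\<close> as a finite sum in the fibre, the induction runs
  over a bound for its nonzero components and removes the last one by a single addition.\<close>

lemma linear_frame_expansion:
  assumes t: "(U, \<Psi>) \<in> trivs E" "x \<in> U"
    and add: "\<And>u v. u \<in> fibre E x \<Longrightarrow> v \<in> fibre E x \<Longrightarrow> h (vadd E u v) = h u + h v"
    and scale: "\<And>a u. u \<in> fibre E x \<Longrightarrow> h (vscale E a u) = a * h u"
    and u: "u \<in> fibre E x"
  shows "h u = (\<Sum>k<vrank E. \<Psi> u k * (h (frame E \<Psi> x k) :: real))"
proof -
  have x: "x \<in> pts M" by (rule triv_pts[OF t])
  have "h u = (\<Sum>k<m. \<Psi> u k * h (frame E \<Psi> x k))"
    if "m \<le> vrank E" "u \<in> fibre E x" "\<And>k. k \<ge> m \<Longrightarrow> \<Psi> u k = 0" for m u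
    using that
  proof (induction m arbitrary: u)
    case 0
    \<comment> \<open>All components vanish, so \<open>u\<close> is its own multiple by 0, and
      homogeneity gives \<open>h u = 0\<close>.\<close>
    have "u = vscale E 0 u"
      by (rule triv_eqI[OF t]) (use 0 vscale_fibre[OF x] triv_vscale[OF t] in auto)
    then show ?case using scale[of u 0] 0 by simp
  next
    case (Suc m)
    let ?e = "frame E \<Psi> x m"
    have m: "m < vrank E" using Suc.prems by simp
    have e: "?e \<in> fibre E x" by (rule frame_fibre[OF t m])
    \<comment> \<open>Cancels component \<open>m\<close> and leaves the other components
      unchanged.\<close>
    define u' where "u' = vadd E u (vscale E (- \<Psi> u m) ?e)"
    have u': "u' \<in> fibre E x"
      unfolding u'_def by (intro vadd_fibre[OF x] vscale_fibre[OF x] Suc.prems e)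
    have c: "\<Psi> u' k = (if k = m then 0 else \<Psi> u k)" for k
      unfolding u'_def using triv_vadd[OF t Suc.prems(2) vscale_fibre[OF x e]] triv_vscale[OF t e]
        triv_frame[OF t m] by auto
    have "h u' = (\<Sum>k<m. \<Psi> u' k * h (frame E \<Psi> x k))"
      using Suc.prems c by (intro Suc.IH u') auto
    then have "h u' = (\<Sum>k<m. \<Psi> u k * h (frame E \<Psi> x k))" by (simp add: c)
    moreover have "h u' = h u + - \<Psi> u m * h ?e"
      unfolding u'_def using add[OF Suc.prems(2) vscale_fibre[OF x e]] scale[OF e] by simp
    ultimately show ?case by simp
  qed
  from this[of "vrank E" u] show ?thesis using u triv_zero_beyond[OF t u] by simp
qed

subsection \<open>The module of sections\<close>

lemma section_fibre: "s \<in> smooth_sections M E \<Longrightarrow> x \<in> pts M \<Longrightarrow> s x \<in> fibre E x"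
  unfolding smooth_sections_def by blast

lemma section_components_smooth:
  assumes s: "s \<in> smooth_sections M E" and t: "(U, \<Psi>) \<in> trivs E"
  shows "smooth_fun_on M U (\<lambda>x. \<Psi> (s x) i)"
proof (cases "i < vrank E")
  case True
  then show ?thesis using assms unfolding smooth_sections_def by fast
next
  case False
  have "0 = \<Psi> (s x) i" if "x \<in> U" for x
    using triv_zero_beyond[OF t that section_fibre[OF s triv_pts[OF t that]]] False by simp
  then show ?thesis by (rule smooth_fun_on_cong[OF smooth_fun_on_const[OF triv_openin[OF t]]])
qed

lemma section_eqI:
  assumes "s \<in> smooth_sections M E" "t \<in> smooth_sections M E" "\<And>x. x \<in> pts M \<Longrightarrow> s x = t x"
  shows "s = t"
proof -
  have "s \<in> (\<Pi>\<^sub>E x \<in> pts M. fibre E x)" "t \<in> (\<Pi>\<^sub>E x \<in> pts M. fibre E x)"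
    using assms(1,2) unfolding smooth_sections_def by blast+
  then show ?thesis by (rule PiE_ext) (rule assms(3))
qed

lemma smooth_sectionI:
  assumes "s \<in> extensional (pts M)" "\<And>x. x \<in> pts M \<Longrightarrow> s x \<in> fibre E x"
    and "\<And>U \<Psi> i. (U, \<Psi>) \<in> trivs E \<Longrightarrow> i < vrank E \<Longrightarrow> smooth_fun_on M U (\<lambda>x. \<Psi> (s x) i)"
  shows "s \<in> smooth_sections M E"
  using assms unfolding smooth_sections_def by (auto simp: PiE_iff)

lemma sec_add_section:
  assumes "s \<in> smooth_sections M E" "t \<in> smooth_sections M E"
  shows "sec_add M E s t \<in> smooth_sections M E"
proof (rule smooth_sectionI)
  fix U \<Psi> i assume T: "(U, \<Psi>) \<in> trivs E"
  show "smooth_fun_on M U (\<lambda>x. \<Psi> (sec_add M E s t x) i)"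
  proof (rule smooth_fun_on_cong[OF smooth_fun_on_add[OF section_components_smooth[OF assms(1) T]
          section_components_smooth[OF assms(2) T]]])
    fix x assume x: "x \<in> U"
    then have "x \<in> pts M" by (rule triv_pts[OF T])
    then show "\<Psi> (s x) i + \<Psi> (t x) i = \<Psi> (sec_add M E s t x) i"
      using triv_vadd[OF T x] assms section_fibre by (simp add: sec_add_def)
  qed
qed (use assms section_fibre vadd_fibre in \<open>auto simp: sec_add_def\<close>)

lemma sec_mult_section:
  assumes f: "f \<in> smooth_funs M" and s: "s \<in> smooth_sections M E"
  shows "sec_mult M E f s \<in> smooth_sections M E"
proof (rule smooth_sectionI)
  fix U \<Psi> i assume T: "(U, \<Psi>) \<in> trivs E"
  have "smooth_fun_on M U f"
    using smooth_fun_on_subset[OF _ triv_openin[OF T] openin_subset[OF triv_openin[OF T]]] f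
    by (simp add: smooth_funs_iff)
  from smooth_fun_on_mult[OF this section_components_smooth[OF s T]]
  show "smooth_fun_on M U (\<lambda>x. \<Psi> (sec_mult M E f s x) i)"
  proof (rule smooth_fun_on_cong)
    fix x assume x: "x \<in> U"
    then have "x \<in> pts M" by (rule triv_pts[OF T])
    then show "f x * \<Psi> (s x) i = \<Psi> (sec_mult M E f s x) i"
      using triv_vscale[OF T x] s section_fibre by (simp add: sec_mult_def)
  qed
qed (use s section_fibre vscale_fibre in \<open>auto simp: sec_mult_def\<close>)

text \<open>The cutoff function is returned together with the sections, because the component
  functions of a section have to be cut off by the same function when it is decomposed.\<close>

lemma extended_frame:
  assumes t: "(U, \<Psi>) \<in> trivs E" and x: "x \<in> U"
  obtains \<theta> N e where "\<theta> \<in> smooth_funs M" "openin (mtop M) N" "x \<in> N" "N \<subseteq> U"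
    "\<And>y. y \<in> N \<Longrightarrow> \<theta> y = 1" "\<And>y. y \<in> pts M \<Longrightarrow> y \<notin> U \<Longrightarrow> \<theta> y = 0"
    "\<And>f. smooth_fun_on M U f \<Longrightarrow> (\<lambda>y. if y \<in> U then \<theta> y * f y else 0) \<in> smooth_funs M"
    "\<And>i. i < vrank E \<Longrightarrow> e i \<in> smooth_sections M E"
    "\<And>i y. i < vrank E \<Longrightarrow> y \<in> U \<Longrightarrow> e i y = vscale E (\<theta> y) (frame E \<Psi> y i)"
    "\<And>i y. i < vrank E \<Longrightarrow> y \<in> N \<Longrightarrow> e i y = frame E \<Psi> y i"
proof -
  obtain \<theta> N where \<theta>: "smooth_fun_on M (pts M) \<theta>" and N: "openin (mtop M) N" "x \<in> N" "N \<subseteq> U"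
    "\<And>y. y \<in> N \<Longrightarrow> \<theta> y = 1" and \<theta>0: "\<And>y. y \<in> pts M \<Longrightarrow> y \<notin> U \<Longrightarrow> \<theta> y = 0" and
    cut: "\<And>W f. openin (mtop M) W \<Longrightarrow> smooth_fun_on M (U \<inter> W) f \<Longrightarrow>
       smooth_fun_on M W (\<lambda>y. if y \<in> U then \<theta> y * f y else 0)"
    using cutoff_function[OF triv_openin[OF t] x] by blast
  have U: "U \<subseteq> pts M" using triv_openin[OF t] by (rule openin_subset)
  define e where "e i = (\<lambda>y\<in>pts M. if y \<in> U then vscale E (\<theta> y) (frame E \<Psi> y i) else vzero E y)" for i
  have eU: "e i y = vscale E (\<theta> y) (frame E \<Psi> y i)" if "y \<in> U" for i y
    using that U by (auto simp: e_def)
  have ef: "e i y \<in> fibre E y" if "i < vrank E" "y \<in> pts M" for i y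
    using that vzero_fibre vscale_fibre frame_fibre[OF t _ that(1)] by (auto simp: e_def)
  have "e i \<in> smooth_sections M E" if i: "i < vrank E" for i
  proof (rule smooth_sectionI)
    show "e i \<in> extensional (pts M)" by (simp add: e_def)
    show "e i y \<in> fibre E y" if "y \<in> pts M" for y by (rule ef[OF i that])
    fix U' \<Psi>' j assume t': "(U', \<Psi>') \<in> trivs E" and j: "j < vrank E"
    \<comment> \<open>In another trivialisation the components are an entry of the transition matrix
      times the cutoff function, extended by zero.\<close>
    from cut[OF triv_openin[OF t'] triv_transition_smooth[OF t t' i j]]
    show "smooth_fun_on M U' (\<lambda>y. \<Psi>' (e i y) j)"
    proof (rule smooth_fun_on_cong)
      fix y assume y: "y \<in> U'"
      show "(if y \<in> U then \<theta> y * \<Psi>' (frame E \<Psi> y i) j else 0) = \<Psi>' (e i y) j"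
        using eU triv_vscale[OF t' y frame_fibre[OF t _ i]] triv_vzero[OF t' y] triv_pts[OF t' y]
        by (auto simp: e_def)
    qed
  qed
  moreover have "e i y = frame E \<Psi> y i" if "i < vrank E" "y \<in> N" for i y
  proof -
    have y: "y \<in> U" using that N(3) by blast
    have "vscale E 1 (frame E \<Psi> y i) = frame E \<Psi> y i"
      using y U frame_fibre[OF t y that(1)] by (blast intro: vscale_one)
    then show ?thesis using eU[OF y] N(4)[OF that(2)] by simp
  qed
  moreover have "(\<lambda>y. if y \<in> U then \<theta> y * f y else 0) \<in> smooth_funs M" if "smooth_fun_on M U f" for f
    using cut[OF openin_topspace, of f] that U by (simp add: smooth_funs_iff Int_absorb2)
  ultimately show thesis using \<theta> N \<theta>0 eU
    by (intro that[of \<theta> N e]) (simp_all add: smooth_funs_iff)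
qed

lemma local_frame:
  assumes t: "(U, \<Psi>) \<in> trivs E" "x \<in> U"
  shows "\<exists>N e. openin (mtop M) N \<and> x \<in> N \<and> N \<subseteq> U \<and> (\<forall>i<vrank E. e i \<in> smooth_sections M E) \<and>
    (\<forall>i<vrank E. \<forall>y\<in>N. e i y = frame E \<Psi> y i)"
proof -
  obtain \<theta> N e where \<theta>: "\<theta> \<in> smooth_funs M" and N: "openin (mtop M) N" "x \<in> N" "N \<subseteq> U"
    "\<And>y. y \<in> N \<Longrightarrow> \<theta> y = 1" and \<theta>0: "\<And>y. y \<in> pts M \<Longrightarrow> y \<notin> U \<Longrightarrow> \<theta> y = 0"
    and cut: "\<And>f. smooth_fun_on M U f \<Longrightarrow> (\<lambda>y. if y \<in> U then \<theta> y * f y else 0) \<in> smooth_funs M"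
    and e: "\<And>i. i < vrank E \<Longrightarrow> e i \<in> smooth_sections M E"
    and eU: "\<And>i y. i < vrank E \<Longrightarrow> y \<in> U \<Longrightarrow> e i y = vscale E (\<theta> y) (frame E \<Psi> y i)"
    and eN: "\<And>i y. i < vrank E \<Longrightarrow> y \<in> N \<Longrightarrow> e i y = frame E \<Psi> y i"
    using extended_frame[OF t] by blast
  show ?thesis using N(1-3) e eN by (intro exI[of _ N] exI[of _ e]) simp
qed

text \<open>
  Multiplying a section by the square of a cutoff function makes both its components and the
  local frame global, so the section becomes a combination of global sections.
\<close>

lemma tensorial_pointwise:
  assumes x: "x \<in> pts M"
    and add: "\<And>s t. s \<in> smooth_sections M E \<Longrightarrow> t \<in> smooth_sections M E \<Longrightarrow> \<Phi> (sec_add M E s t) = \<Phi> s + (\<Phi> t :: real)"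
    and mult: "\<And>f s. f \<in> smooth_funs M \<Longrightarrow> s \<in> smooth_sections M E \<Longrightarrow> \<Phi> (sec_mult M E f s) = f x * \<Phi> s"
    and st: "s \<in> smooth_sections M E" "t \<in> smooth_sections M E" "s x = t x"
  shows "\<Phi> s = \<Phi> t"
proof -
  obtain U \<Psi> where t: "(U, \<Psi>) \<in> trivs E" "x \<in> U" using triv_around[OF x] .
  obtain \<theta> N e where \<theta>: "\<theta> \<in> smooth_funs M" and N: "openin (mtop M) N" "x \<in> N" "N \<subseteq> U"
    "\<And>y. y \<in> N \<Longrightarrow> \<theta> y = 1" and \<theta>0: "\<And>y. y \<in> pts M \<Longrightarrow> y \<notin> U \<Longrightarrow> \<theta> y = 0"
    and cut: "\<And>f. smooth_fun_on M U f \<Longrightarrow> (\<lambda>y. if y \<in> U then \<theta> y * f y else 0) \<in> smooth_funs M"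
    and e: "\<And>i. i < vrank E \<Longrightarrow> e i \<in> smooth_sections M E"
    and eU: "\<And>i y. i < vrank E \<Longrightarrow> y \<in> U \<Longrightarrow> e i y = vscale E (\<theta> y) (frame E \<Psi> y i)"
    and eN: "\<And>i y. i < vrank E \<Longrightarrow> y \<in> N \<Longrightarrow> e i y = frame E \<Psi> y i"
    using extended_frame[OF t] by blast
  \<comment> \<open>The right-hand side involves \<open>s\<close> only through its value at
    \<open>x\<close>, which is the assertion.\<close>
  have *: "\<Phi> s = (\<Sum>k<vrank E. \<Psi> (s x) k * \<Phi> (e k))"
    if s: "s \<in> smooth_sections M E" for s
  proof -
    define f where "f k y = (if y \<in> U then \<theta> y * \<Psi> (s y) k else 0)" for k y
    have f: "f k \<in> smooth_funs M" for k
      using cut[OF section_components_smooth[OF s t(1)]] by (simp add: f_def[abs_def])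
    have zero: "(\<lambda>_. 0) \<in> smooth_funs M"
      by (simp add: smooth_funs_iff smooth_fun_on_const)
    \<comment> \<open>Partial sums of the cut-off components times the cut-off frame. The start is
      the zero section in the form of a multiple of \<open>s\<close>, so that \<open>mult\<close>
      evaluates it.\<close>
    define T where "T = rec_nat (sec_mult M E (\<lambda>_. 0) s) (\<lambda>k T. sec_add M E T (sec_mult M E (f k) (e k)))"
    have T0: "T 0 = sec_mult M E (\<lambda>_. 0) s" and
      TSuc: "T (Suc k) = sec_add M E (T k) (sec_mult M E (f k) (e k))" for k by (simp_all add: T_def)
    have Ts: "T m \<in> smooth_sections M E" if "m \<le> vrank E" for m
      using that by (induction m) (auto simp: T0 TSuc intro!: sec_add_section sec_mult_section f e s zero)
    have \<Phi>T: "\<Phi> (T m) = (\<Sum>k<m. f k x * \<Phi> (e k))" if "m \<le> vrank E" for m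
      using that
    proof (induction m)
      case 0
      then show ?case using mult zero s by (simp add: T0)
    next
      case (Suc m)
      then have "\<Phi> (T (Suc m)) = \<Phi> (T m) + \<Phi> (sec_mult M E (f m) (e m))"
        unfolding TSuc using add Ts sec_mult_section[OF f e] by simp
      then show ?case using Suc mult f e by simp
    qed
    have \<Psi>T: "\<Psi>' (T m y) j = (\<Sum>k<m. f k y * \<Psi>' (e k y) j)"
      if t': "(U', \<Psi>') \<in> trivs E" "y \<in> U'" and "m \<le> vrank E" for m y j U' \<Psi>'
      using that(3)
    proof (induction m)
      case 0
      then show ?case
        using triv_vscale[OF t' section_fibre[OF s triv_pts[OF t']]] triv_pts[OF t']
        by (simp add: T0 sec_mult_def)
    next
      case (Suc m)
      have y: "y \<in> pts M" by (rule triv_pts[OF t'])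
      have "\<Psi>' (T (Suc m) y) j = \<Psi>' (T m y) j + \<Psi>' (vscale E (f m y) (e m y)) j"
        using triv_vadd[OF t' section_fibre[OF Ts y] vscale_fibre[OF y section_fibre[OF e y]]] Suc.prems y
        by (simp add: TSuc sec_add_def sec_mult_def)
      then show ?case using Suc triv_vscale[OF t' section_fibre[OF e y]] by simp
    qed
    have \<theta>2: "(\<lambda>y. \<theta> y * \<theta> y) \<in> smooth_funs M"
      using \<theta> smooth_fun_on_mult by (simp add: smooth_funs_iff)
    have "T (vrank E) = sec_mult M E (\<lambda>y. \<theta> y * \<theta> y) s"
    proof (rule section_eqI[OF Ts sec_mult_section[OF \<theta>2 s]])
      fix y assume y: "y \<in> pts M"
      have sy: "s y \<in> fibre E y" by (rule section_fibre[OF s y])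
      have m: "sec_mult M E (\<lambda>y. \<theta> y * \<theta> y) s y = vscale E (\<theta> y * \<theta> y) (s y)"
        using y by (simp add: sec_mult_def)
      show "T (vrank E) y = sec_mult M E (\<lambda>y. \<theta> y * \<theta> y) s y"
      proof (cases "y \<in> U")
        case True
        show ?thesis
        proof (rule triv_eqI[OF t(1) True])
          show "T (vrank E) y \<in> fibre E y" by (rule section_fibre[OF Ts y]) simp
          show "sec_mult M E (\<lambda>y. \<theta> y * \<theta> y) s y \<in> fibre E y"
            by (rule section_fibre[OF sec_mult_section[OF \<theta>2 s] y])
          fix j assume j: "j < vrank E"
          have "\<Psi> (T (vrank E) y) j = (\<Sum>k<vrank E. f k y * \<Psi> (e k y) j)"
            by (rule \<Psi>T[OF t(1) True]) simp
          also have "\<dots> = (\<Sum>k<vrank E. if k = j then \<theta> y * \<theta> y * \<Psi> (s y) j else 0)"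
            by (rule sum.cong)
              (auto simp: f_def True eU triv_vscale[OF t(1) True frame_fibre[OF t(1) True]]
                triv_frame[OF t(1) True])
          also have "\<dots> = \<theta> y * \<theta> y * \<Psi> (s y) j" using j by simp
          also have "\<dots> = \<Psi> (sec_mult M E (\<lambda>y. \<theta> y * \<theta> y) s y) j"
            unfolding m using triv_vscale[OF t(1) True sy] by simp
          finally show "\<Psi> (T (vrank E) y) j = \<Psi> (sec_mult M E (\<lambda>y. \<theta> y * \<theta> y) s y) j" .
        qed
      next
        case False
        obtain U' \<Psi>' where t': "(U', \<Psi>') \<in> trivs E" "y \<in> U'" using triv_around[OF y] .
        show ?thesis
        proof (rule triv_eqI[OF t'])
          show "T (vrank E) y \<in> fibre E y" by (rule section_fibre[OF Ts y]) simp
          show "sec_mult M E (\<lambda>y. \<theta> y * \<theta> y) s y \<in> fibre E y"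
            by (rule section_fibre[OF sec_mult_section[OF \<theta>2 s] y])
          fix j
          have "\<Psi>' (T (vrank E) y) j = 0"
            unfolding \<Psi>T[OF t' order_refl] using False by (simp add: f_def)
          then show "\<Psi>' (T (vrank E) y) j = \<Psi>' (sec_mult M E (\<lambda>y. \<theta> y * \<theta> y) s y) j"
            unfolding m using triv_vscale[OF t' sy] \<theta>0[OF y False] by simp
        qed
      qed
    qed simp
    then have "\<Phi> (T (vrank E)) = \<theta> x * \<theta> x * \<Phi> s" using mult \<theta>2 s by simp
    then have "\<Phi> s = \<Phi> (T (vrank E))" using N by simp
    also have "\<dots> = (\<Sum>k<vrank E. \<Psi> (s x) k * \<Phi> (e k))"
      using \<Phi>T[OF order_refl] N t(2) by (simp add: f_def)
    finally show ?thesis .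
  qed
  show ?thesis using *[OF st(1)] *[OF st(2)] st(3) by simp
qed

text \<open>The section is a combination of the extended frame with constant coefficients, the
  components of \<open>v\<close>; the induction matches one more component at each step.\<close>

lemma section_through:
  assumes x: "x \<in> pts M" and v: "v \<in> fibre E x"
  shows "\<exists>s\<in>smooth_sections M E. s x = v"
proof -
  obtain U \<Psi> where t: "(U, \<Psi>) \<in> trivs E" "x \<in> U" using triv_around[OF x] .
  obtain \<theta> N e where \<theta>: "\<theta> \<in> smooth_funs M" and N: "openin (mtop M) N" "x \<in> N" "N \<subseteq> U"
    "\<And>y. y \<in> N \<Longrightarrow> \<theta> y = 1" and \<theta>0: "\<And>y. y \<in> pts M \<Longrightarrow> y \<notin> U \<Longrightarrow> \<theta> y = 0"
    and cut: "\<And>f. smooth_fun_on M U f \<Longrightarrow> (\<lambda>y. if y \<in> U then \<theta> y * f y else 0) \<in> smooth_funs M"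
    and e: "\<And>i. i < vrank E \<Longrightarrow> e i \<in> smooth_sections M E"
    and eU: "\<And>i y. i < vrank E \<Longrightarrow> y \<in> U \<Longrightarrow> e i y = vscale E (\<theta> y) (frame E \<Psi> y i)"
    and eN: "\<And>i y. i < vrank E \<Longrightarrow> y \<in> N \<Longrightarrow> e i y = frame E \<Psi> y i"
    using extended_frame[OF t] by blast
  have "\<exists>s\<in>smooth_sections M E. \<forall>k. \<Psi> (s x) k = (if k < m then \<Psi> v k else 0)" if "m \<le> vrank E" for m
    using that
  proof (induction m)
    case 0
    have "sec_zero M E \<in> smooth_sections M E"
    proof (rule smooth_sectionI)
      fix U' \<Psi>' i assume t': "(U', \<Psi>') \<in> trivs E"
      show "smooth_fun_on M U' (\<lambda>x. \<Psi>' (sec_zero M E x) i)"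
        by (rule smooth_fun_on_cong[OF smooth_fun_on_const[OF triv_openin[OF t'], of 0]])
          (simp add: sec_zero_def triv_pts[OF t'] triv_vzero[OF t'])
    qed (auto simp: sec_zero_def vzero_fibre)
    then show ?case using x triv_vzero[OF t] by (intro bexI[of _ "sec_zero M E"]) (auto simp: sec_zero_def)
  next
    case (Suc m)
    then obtain s where s: "s \<in> smooth_sections M E" "\<And>k. \<Psi> (s x) k = (if k < m then \<Psi> v k else 0)" by auto
    have m: "m < vrank E" using Suc.prems by simp
    have c: "(\<lambda>_. \<Psi> v m) \<in> smooth_funs M" by (simp add: smooth_funs_iff smooth_fun_on_const)
    have em: "e m x = frame E \<Psi> x m" "e m x \<in> fibre E x"
      using eN[OF m N(2)] frame_fibre[OF t m] by simp_all
    have "\<Psi> (sec_add M E s (sec_mult M E (\<lambda>_. \<Psi> v m) (e m)) x) k = (if k < Suc m then \<Psi> v k else 0)" for k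
      using triv_vadd[OF t section_fibre[OF s(1) x] vscale_fibre[OF x em(2)]] triv_vscale[OF t em(2)]
        triv_frame[OF t m] x em(1) s(2)
      by (auto simp: sec_add_def sec_mult_def less_Suc_eq)
    then show ?case using sec_add_section[OF s(1) sec_mult_section[OF c e[OF m]]] by blast
  qed
  then obtain s where s: "s \<in> smooth_sections M E" "\<And>k. \<Psi> (s x) k = (if k < vrank E then \<Psi> v k else 0)" by blast
  have "s x = v" by (rule triv_eqI[OF t section_fibre[OF s(1) x] v]) (simp add: s(2))
  with s(1) show ?thesis by blast
qed

end

section \<open>Alternating functions of multi-indices\<close>

text \<open>Exchange of neighbours is all that insertion sort performs. Over the reals it already
  forces the value 0 on equal neighbours.\<close>

definition alternating :: "(nat list \<Rightarrow> real) \<Rightarrow> bool" where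
  "alternating h \<longleftrightarrow> (\<forall>as a b bs. h (as @ a # b # bs) = - h (as @ b # a # bs))"

lemma alternating_swap: "alternating h \<Longrightarrow> h (as @ a # b # bs) = - h (as @ b # a # bs)"
  unfolding alternating_def by blast

text \<open>The insertion step of the sort, with \<open>c\<close> one of 0, 1, -1. The prefix
  \<open>as\<close> lets the recursion work behind entries already in place, and \<open>c\<close>
  and \<open>K\<close> are chosen before \<open>h\<close>.\<close>

lemma alternating_insert:
  "sorted_wrt (<) J \<Longrightarrow> \<exists>c K. (c = 0 \<or> sorted_wrt (<) K \<and> length K = Suc (length J) \<and> set K = insert a (set J)) \<and>
    (\<forall>h as. alternating h \<longrightarrow> h (as @ a # J) = c * h (as @ K))"
proof (induction J)
  case Nil
  show ?case by (intro exI[of _ 1] exI[of _ "[a]"]) simp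
next
  case (Cons b J)
  consider "a < b" | "a = b" | "b < a" by linarith
  then show ?case
  proof cases
    case 1
    then show ?thesis using Cons.prems
      by (intro exI[of _ 1] exI[of _ "a # b # J"]) auto
  next
    case 2
    \<comment> \<open>Exchanging two equal neighbours shows that the value is its own
      negative.\<close>
    have "h (as @ a # b # J) = 0 * h (as @ J)" if "alternating h" for h as
      using alternating_swap[OF that, of as a a J] 2 by simp
    then show ?thesis by (intro exI[of _ 0] exI[of _ J]) simp
  next
    case 3
    obtain c K where K: "c = 0 \<or> sorted_wrt (<) K \<and> length K = Suc (length J) \<and> set K = insert a (set J)"
      and h: "\<forall>h as. alternating h \<longrightarrow> h (as @ a # J) = c * h (as @ K)"
      using Cons by auto
    have "h (as @ a # b # J) = - c * h (as @ b # K)" if "alternating h" for h as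
      using alternating_swap[OF that, of as a b J] h[rule_format, OF that, of "as @ [b]"] by simp
    moreover have "- c = 0 \<or> sorted_wrt (<) (b # K) \<and> length (b # K) = Suc (length (b # J)) \<and>
        set (b # K) = insert a (set (b # J))"
      using K 3 Cons.prems by auto
    ultimately show ?thesis by blast
  qed
qed

text \<open>Insertion sort. The coefficient 0 stands for a repeated index; in that case nothing is
  claimed about \<open>K\<close>.\<close>

lemma alternating_sort:
  "\<exists>c K. (c = 0 \<or> sorted_wrt (<) K \<and> length K = length I \<and> set K = set I) \<and>
    (\<forall>h as. alternating h \<longrightarrow> h (as @ I) = c * h (as @ K))"
proof (induction I)
  case Nil
  show ?case by (intro exI[of _ 1] exI[of _ "[]"]) simp
next
  case (Cons a I)
  then obtain c K where K: "c = 0 \<or> sorted_wrt (<) K \<and> length K = length I \<and> set K = set I"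
    and h: "\<forall>h as. alternating h \<longrightarrow> h (as @ I) = c * h (as @ K)" by blast
  have h': "h (as @ a # I) = c * h (as @ a # K)" if "alternating h" for h as
    using h[rule_format, OF that, of "as @ [a]"] by simp
  show ?case
  proof (cases "c = 0")
    case True
    then show ?thesis using h' by (intro exI[of _ 0] exI[of _ "[]"]) simp
  next
    case False
    then have "sorted_wrt (<) K" using K by blast
    from alternating_insert[OF this, of a] obtain c' K' where
      K': "c' = 0 \<or> sorted_wrt (<) K' \<and> length K' = Suc (length K) \<and> set K' = insert a (set K)"
      and h2: "\<forall>h as. alternating h \<longrightarrow> h (as @ a # K) = c' * h (as @ K')" by blast
    have "h (as @ a # I) = (c * c') * h (as @ K')" if "alternating h" for h as
      using h'[OF that, of as] h2 that by simp
    moreover have "c * c' = 0 \<or> sorted_wrt (<) K' \<and> length K' = length (a # I) \<and> set K' = set (a # I)"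
      using K K' False by auto
    ultimately show ?thesis by blast
  qed
qed

lemma finite_multi_indices: "finite (multi_indices r p)"
  by (rule finite_subset[OF _ finite_lists_length_eq[of "{..<r}" p]]) (auto simp: multi_indices_def)

text \<open>The point is the order of the quantifiers: \<sigma> serves all \<open>h\<close>. Applied
  to a form at varying points it gives constant coefficients, and these preserve smoothness.\<close>

lemma alternating_expansion:
  "\<exists>\<sigma>. \<forall>I. set I \<subseteq> {..<r} \<longrightarrow> length I = p \<longrightarrow>
    (\<forall>h. alternating h \<longrightarrow> h I = (\<Sum>J\<in>multi_indices r p. \<sigma> I J * h J))"
proof -
  obtain c K where cK: "\<And>I. (c I = 0 \<or> sorted_wrt (<) (K I) \<and> length (K I) = length I \<and> set (K I) = set I)"
    "\<And>I. \<forall>h as. alternating h \<longrightarrow> h (as @ I) = c I * h (as @ K I)"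
    using alternating_sort by metis
  have "h I = (\<Sum>J\<in>multi_indices r p. (if J = K I then c I else 0) * h J)"
    if I: "set I \<subseteq> {..<r}" "length I = p" and h: "alternating h" for I h
  proof -
    have hI: "h I = c I * h (K I)" using cK(2)[of I, rule_format, OF h, of "[]"] by simp
    show ?thesis
    proof (cases "c I = 0")
      case True
      have "(\<Sum>J\<in>multi_indices r p. (if J = K I then c I else 0) * h J) = 0"
        by (rule sum.neutral) (simp add: True)
      then show ?thesis using hI True by simp
    next
      case False
      then have "K I \<in> multi_indices r p" using cK(1)[of I] I by (simp add: multi_indices_def)
      then have "(\<Sum>J\<in>multi_indices r p. if J = K I then c I * h J else 0) = c I * h (K I)"
        using finite_multi_indices by simp
      moreover have "(\<Sum>J\<in>multi_indices r p. if J = K I then c I * h J else 0) =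
          (\<Sum>J\<in>multi_indices r p. (if J = K I then c I else 0) * h J)"
        by (rule sum.cong) auto
      ultimately show ?thesis using hI by simp
    qed
  qed
  then show ?thesis by (intro exI[of _ "\<lambda>I J. if J = K I then c I else 0"]) simp
qed

section \<open>Alternating forms on the fibres\<close>

lemma alt_forms_eq_0: "\<eta> \<in> alt_forms E x p \<Longrightarrow> \<not> (length vs = p \<and> set vs \<subseteq> fibre E x) \<Longrightarrow> \<eta> vs = 0"
  unfolding alt_forms_def by blast

lemma
  assumes \<eta>: "\<eta> \<in> alt_forms E x p" and "length vs = p" "set vs \<subseteq> fibre E x" "i < p"
  shows alt_forms_vadd: "u \<in> fibre E x \<Longrightarrow> v \<in> fibre E x \<Longrightarrow>
      \<eta> (vs[i := vadd E u v]) = \<eta> (vs[i := u]) + \<eta> (vs[i := v])"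
    and alt_forms_vscale: "u \<in> fibre E x \<Longrightarrow> \<eta> (vs[i := vscale E a u]) = a * \<eta> (vs[i := u])"
    and alt_forms_equal: "i < j \<Longrightarrow> j < p \<Longrightarrow> vs ! i = vs ! j \<Longrightarrow> \<eta> vs = 0"
proof -
  have *: "\<eta> (vs[i := vadd E u v]) = \<eta> (vs[i := u]) + \<eta> (vs[i := v]) \<and> \<eta> (vs[i := vscale E a u]) = a * \<eta> (vs[i := u])"
    if "u \<in> fibre E x" "v \<in> fibre E x" for u v a
    using assms that unfolding alt_forms_def by simp
  show "u \<in> fibre E x \<Longrightarrow> v \<in> fibre E x \<Longrightarrow> \<eta> (vs[i := vadd E u v]) = \<eta> (vs[i := u]) + \<eta> (vs[i := v])"
    using * by simp
  show "u \<in> fibre E x \<Longrightarrow> \<eta> (vs[i := vscale E a u]) = a * \<eta> (vs[i := u])"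
    using * by simp
  show "i < j \<Longrightarrow> j < p \<Longrightarrow> vs ! i = vs ! j \<Longrightarrow> \<eta> vs = 0"
    using assms unfolding alt_forms_def by blast
qed

lemma set_list_update_fibre: "set vs \<subseteq> F \<Longrightarrow> u \<in> F \<Longrightarrow> set (vs[i := u]) \<subseteq> F"
  using set_update_subset_insert[of vs i u] by blast

context smooth_vb
begin

text \<open>Polarisation: expand the vanishing value on the list with \<open>u + v\<close> in both
  places; the two terms with equal entries drop out.\<close>

lemma alt_forms_swap:
  assumes \<eta>: "\<eta> \<in> alt_forms E x p" and x: "x \<in> pts M" and vs: "length vs = p" "set vs \<subseteq> fibre E x"
    and ij: "i < j" "j < p" and uv: "u \<in> fibre E x" "v \<in> fibre E x"
  shows "\<eta> (vs[i := u, j := v]) = - \<eta> (vs[i := v, j := u])"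
proof -
  let ?w = "vadd E u v"
  have w: "?w \<in> fibre E x" by (rule vadd_fibre[OF x uv])
  have i: "i < p" using ij by simp
  have eq0: "\<eta> (vs[i := a, j := a]) = 0" if "a \<in> fibre E x" for a
    using ij vs(1)
    by (intro alt_forms_equal[OF \<eta> _ _ i ij] set_list_update_fibre vs(2) that) auto
  have ai: "\<eta> (vs[i := ?w, j := a]) = \<eta> (vs[i := u, j := a]) + \<eta> (vs[i := v, j := a])"
    if "a \<in> fibre E x" for a
    using alt_forms_vadd[OF \<eta> _ _ i uv, of "vs[j := a]"] vs that ij
    by (simp add: set_list_update_fibre list_update_swap[of i j])
  have "\<eta> (vs[i := ?w, j := ?w]) = \<eta> (vs[i := ?w, j := u]) + \<eta> (vs[i := ?w, j := v])"
    using alt_forms_vadd[OF \<eta> _ _ ij(2) uv, of "vs[i := ?w]"] vs w by (simp add: set_list_update_fibre)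
  then show ?thesis using ai[OF uv(1)] ai[OF uv(2)] eq0[OF w] eq0[OF uv(1)] eq0[OF uv(2)] by simp
qed

lemma alt_forms_expand:
  assumes t: "(U, \<Psi>) \<in> trivs E" "x \<in> U" and \<eta>: "\<eta> \<in> alt_forms E x p"
    and "length vs = p" "set vs \<subseteq> fibre E x" "i < p" "u \<in> fibre E x"
  shows "\<eta> (vs[i := u]) = (\<Sum>k<vrank E. \<Psi> u k * \<eta> (vs[i := frame E \<Psi> x k]))"
proof (rule linear_frame_expansion[OF t])
  fix a b assume "a \<in> fibre E x" "b \<in> fibre E x"
  then show "\<eta> (vs[i := vadd E a b]) = \<eta> (vs[i := a]) + \<eta> (vs[i := b])"
    by (rule alt_forms_vadd[OF \<eta> assms(4-6)])
next
  fix c a assume "a \<in> fibre E x"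
  then show "\<eta> (vs[i := vscale E c a]) = c * \<eta> (vs[i := a])"
    by (rule alt_forms_vscale[OF \<eta> assms(4-6)])
qed fact

text \<open>The form of the expansion suited to inductions in which the entry between two lists is
  replaced by frame vectors.\<close>

lemma alt_forms_expand_append:
  assumes t: "(U, \<Psi>) \<in> trivs E" "x \<in> U" and \<eta>: "\<eta> \<in> alt_forms E x p"
    and "length as + Suc (length bs) = p" "set as \<subseteq> fibre E x" "set bs \<subseteq> fibre E x" "u \<in> fibre E x"
  shows "\<eta> (as @ u # bs) = (\<Sum>k<vrank E. \<Psi> u k * \<eta> (as @ frame E \<Psi> x k # bs))"
  using alt_forms_expand[OF t \<eta>, of "as @ u # bs" "length as" u] assms(4-7) by (simp add: list_update_append)

text \<open>\<open>alternating\<close> speaks of all index lists. The condition in the conditional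
  is unchanged by an exchange, so the value 0 on inadmissible lists does no harm.\<close>

lemma alternating_on_fibre:
  assumes x: "x \<in> pts M" and \<eta>: "\<eta> \<in> alt_forms E x p" and g: "\<And>i. i < r \<Longrightarrow> g i \<in> fibre E x"
  shows "alternating (\<lambda>I. if set I \<subseteq> {..<r} \<and> length I = p then \<eta> (map g I) else 0)"
  unfolding alternating_def
proof (intro allI)
  fix as a b bs
  show "(if set (as @ a # b # bs) \<subseteq> {..<r} \<and> length (as @ a # b # bs) = p then \<eta> (map g (as @ a # b # bs)) else 0) =
      - (if set (as @ b # a # bs) \<subseteq> {..<r} \<and> length (as @ b # a # bs) = p then \<eta> (map g (as @ b # a # bs)) else 0)"
  proof (cases "set (as @ a # b # bs) \<subseteq> {..<r} \<and> length (as @ a # b # bs) = p")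
    case True
    let ?vs = "map g (as @ a # b # bs)" and ?i = "length as"
    have "set ?vs \<subseteq> fibre E x" using True g by auto
    then have "\<eta> (?vs[?i := g a, Suc ?i := g b]) = - \<eta> (?vs[?i := g b, Suc ?i := g a])"
      using True g by (intro alt_forms_swap[OF \<eta> x]) auto
    then have "\<eta> (map g (as @ a # b # bs)) = - \<eta> (map g (as @ b # a # bs))"
      by (simp add: list_update_append)
    then show ?thesis using True by auto
  qed auto
qed

subsection \<open>Smooth forms\<close>

lemma form_alt: "\<eta> \<in> forms M E p \<Longrightarrow> x \<in> pts M \<Longrightarrow> \<eta> x \<in> alt_forms E x p"
  unfolding forms_def by blast

text \<open>The definition of a form covers increasing indices only. Any other list is reduced to
  these with coefficients that are constant on \<open>U\<close>.\<close>

lemma form_on_frame_smooth: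
  assumes \<eta>: "\<eta> \<in> forms M E p" and t: "(U, \<Psi>) \<in> trivs E" and I: "set I \<subseteq> {..<vrank E}" "length I = p"
  shows "smooth_fun_on M U (\<lambda>x. \<eta> x (map (frame E \<Psi> x) I))"
proof -
  let ?m = "multi_indices (vrank E) p"
  obtain \<sigma> where \<sigma>: "\<forall>I. set I \<subseteq> {..<vrank E} \<longrightarrow> length I = p \<longrightarrow>
    (\<forall>h. alternating h \<longrightarrow> h I = (\<Sum>J\<in>?m. \<sigma> I J * h J))"
    using alternating_expansion by blast
  have "smooth_fun_on M U (\<lambda>x. \<Sum>J\<in>?m. \<sigma> I J * \<eta> x (map (frame E \<Psi> x) J))"
  proof (rule smooth_fun_on_sum[OF triv_openin[OF t]])
    fix J assume J: "J \<in> ?m"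
    have "\<forall>(U, \<Psi>) \<in> trivs E. \<forall>I \<in> ?m. smooth_fun_on M U (\<lambda>x. \<eta> x (map (frame E \<Psi> x) I))"
      using \<eta> unfolding forms_def by blast
    then have "smooth_fun_on M U (\<lambda>x. \<eta> x (map (frame E \<Psi> x) J))" using t J by fast
    then show "smooth_fun_on M U (\<lambda>x. \<sigma> I J * \<eta> x (map (frame E \<Psi> x) J))"
      by (rule smooth_fun_on_mult[OF smooth_fun_on_const[OF triv_openin[OF t]]])
  qed
  then show ?thesis
  proof (rule smooth_fun_on_cong)
    fix x assume x: "x \<in> U"
    let ?h = "\<lambda>I. if set I \<subseteq> {..<vrank E} \<and> length I = p then \<eta> x (map (frame E \<Psi> x) I) else 0"
    have "alternating ?h"
      by (rule alternating_on_fibre[OF triv_pts[OF t x] form_alt[OF \<eta> triv_pts[OF t x]] frame_fibre[OF t x]])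
    then have "?h I = (\<Sum>J\<in>?m. \<sigma> I J * ?h J)" using \<sigma> I by blast
    also have "\<dots> = (\<Sum>J\<in>?m. \<sigma> I J * \<eta> x (map (frame E \<Psi> x) J))"
      by (rule sum.cong) (auto simp: multi_indices_def)
    finally show "(\<Sum>J\<in>?m. \<sigma> I J * \<eta> x (map (frame E \<Psi> x) J)) = \<eta> x (map (frame E \<Psi> x) I)"
      using I by simp
  qed
qed

lemma frames_fibre: "(U, \<Psi>) \<in> trivs E \<Longrightarrow> x \<in> U \<Longrightarrow> set I \<subseteq> {..<vrank E} \<Longrightarrow> set (map (frame E \<Psi> x) I) \<subseteq> fibre E x"
  using frame_fibre by fastforce

lemma sections_fibre: "x \<in> pts M \<Longrightarrow> set Vs \<subseteq> smooth_sections M E \<Longrightarrow> set (map (\<lambda>s. s x) Vs) \<subseteq> fibre E x"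
  using section_fibre by fastforce

text \<open>The last section is expanded in the frame and becomes one more frame index. Mixed
  argument lists keep the statement closed under this step, hence \<open>I\<close> is arbitrary in
  the induction.\<close>

lemma form_on_mixed_smooth:
  assumes \<eta>: "\<eta> \<in> forms M E p" and t: "(U, \<Psi>) \<in> trivs E"
  shows "set Vs \<subseteq> smooth_sections M E \<Longrightarrow> set I \<subseteq> {..<vrank E} \<Longrightarrow> length Vs + length I = p \<Longrightarrow>
    smooth_fun_on M U (\<lambda>x. \<eta> x (map (\<lambda>s. s x) Vs @ map (frame E \<Psi> x) I))"
proof (induction Vs arbitrary: I rule: rev_induct)
  case Nil
  then show ?case using form_on_frame_smooth[OF \<eta> t] by simp
next
  case (snoc s Vs)
  have s: "s \<in> smooth_sections M E" and Vs: "set Vs \<subseteq> smooth_sections M E" using snoc.prems by auto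
  have "smooth_fun_on M U (\<lambda>x. \<Sum>k<vrank E. \<Psi> (s x) k * \<eta> x (map (\<lambda>s. s x) Vs @ map (frame E \<Psi> x) (k # I)))"
  proof (rule smooth_fun_on_sum[OF triv_openin[OF t]])
    fix k assume "k \<in> {..<vrank E}"
    then have "smooth_fun_on M U (\<lambda>x. \<eta> x (map (\<lambda>s. s x) Vs @ map (frame E \<Psi> x) (k # I)))"
      using snoc.prems by (intro snoc.IH) auto
    then show "smooth_fun_on M U (\<lambda>x. \<Psi> (s x) k * \<eta> x (map (\<lambda>s. s x) Vs @ map (frame E \<Psi> x) (k # I)))"
      by (rule smooth_fun_on_mult[OF section_components_smooth[OF s t]])
  qed
  then show ?case
  proof (rule smooth_fun_on_cong)
    fix x assume x: "x \<in> U"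
    have xM: "x \<in> pts M" by (rule triv_pts[OF t x])
    show "(\<Sum>k<vrank E. \<Psi> (s x) k * \<eta> x (map (\<lambda>s. s x) Vs @ map (frame E \<Psi> x) (k # I))) =
        \<eta> x (map (\<lambda>s. s x) (Vs @ [s]) @ map (frame E \<Psi> x) I)"
      using alt_forms_expand_append[OF t x form_alt[OF \<eta> xM] _ sections_fibre[OF xM Vs]
          frames_fibre[OF t x snoc.prems(2)] section_fibre[OF s xM]] snoc.prems(3) by simp
  qed
qed

lemma form_on_sections_smooth:
  assumes \<eta>: "\<eta> \<in> forms M E p" and Vs: "set Vs \<subseteq> smooth_sections M E" "length Vs = p"
  shows "smooth_fun_on M (pts M) (\<lambda>x. \<eta> x (map (\<lambda>s. s x) Vs))"
proof (rule smooth_fun_on_local)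
  fix x assume x: "x \<in> pts M"
  obtain U \<Psi> where t: "(U, \<Psi>) \<in> trivs E" "x \<in> U" using triv_around[OF x] .
  have "smooth_fun_on M U (\<lambda>x. \<eta> x (map (\<lambda>s. s x) Vs))"
    using form_on_mixed_smooth[OF \<eta> t(1) Vs(1), of "[]"] Vs(2) by simp
  then show "\<exists>W'. x \<in> W' \<and> W' \<subseteq> pts M \<and> smooth_fun_on M W' (\<lambda>x. \<eta> x (map (\<lambda>s. s x) Vs))"
    using t openin_subset[OF triv_openin[OF t(1)]] by blast
qed

text \<open>Near each point a frame agrees with global sections, so smoothness on global sections
  implies the condition on frames. Constructions can then avoid indices.\<close>

lemma formI:
  assumes alt: "\<And>x. x \<in> pts M \<Longrightarrow> \<eta> x \<in> alt_forms E x p" and out: "\<And>x. x \<notin> pts M \<Longrightarrow> \<eta> x = (\<lambda>_. 0)"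
    and smooth: "\<And>Vs. set Vs \<subseteq> smooth_sections M E \<Longrightarrow> length Vs = p \<Longrightarrow>
      smooth_fun_on M (pts M) (\<lambda>x. \<eta> x (map (\<lambda>s. s x) Vs))"
  shows "\<eta> \<in> forms M E p"
proof -
  have "smooth_fun_on M U (\<lambda>x. \<eta> x (map (frame E \<Psi> x) I))"
    if t: "(U, \<Psi>) \<in> trivs E" and I: "I \<in> multi_indices (vrank E) p" for U \<Psi> I
  proof (rule smooth_fun_on_local)
    fix x assume x: "x \<in> U"
    obtain N e where N: "openin (mtop M) N" "x \<in> N" "N \<subseteq> U"
      and e: "\<forall>i<vrank E. e i \<in> smooth_sections M E"
      and eN: "\<forall>i<vrank E. \<forall>y\<in>N. e i y = frame E \<Psi> y i"
      using local_frame[OF t x] by (elim exE conjE)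
    have I': "set I \<subseteq> {..<vrank E}" "length I = p" using I by (auto simp: multi_indices_def)
    have "smooth_fun_on M (pts M) (\<lambda>x. \<eta> x (map (\<lambda>s. s x) (map e I)))"
      using I' e by (intro smooth) auto
    from smooth_fun_on_subset[OF this N(1) openin_subset[OF N(1)]]
    have "smooth_fun_on M N (\<lambda>x. \<eta> x (map (frame E \<Psi> x) I))"
    proof (rule smooth_fun_on_cong)
      fix y assume y: "y \<in> N"
      have "map (\<lambda>s. s y) (map e I) = map (frame E \<Psi> y) I" using I' eN y by auto
      then show "\<eta> y (map (\<lambda>s. s y) (map e I)) = \<eta> y (map (frame E \<Psi> y) I)" by (simp only:)
    qed
    then show "\<exists>W'. x \<in> W' \<and> W' \<subseteq> U \<and> smooth_fun_on M W' (\<lambda>x. \<eta> x (map (frame E \<Psi> x) I))"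
      using N by blast
  qed
  then show ?thesis using alt out unfolding forms_def by auto
qed

text \<open>The extension is constant in a local trivialisation, multiplied by a cutoff function.\<close>

lemma form_through:
  assumes x: "x \<in> pts M" and \<eta>: "\<eta> \<in> alt_forms E x p"
  shows "\<exists>\<omega>\<in>forms M E p. \<omega> x = \<eta>"
proof -
  obtain U \<Psi> where t: "(U, \<Psi>) \<in> trivs E" "x \<in> U" using triv_around[OF x] .
  obtain \<theta> N e where \<theta>: "\<theta> \<in> smooth_funs M" and N: "openin (mtop M) N" "x \<in> N" "N \<subseteq> U"
    "\<And>y. y \<in> N \<Longrightarrow> \<theta> y = 1" and \<theta>0: "\<And>y. y \<in> pts M \<Longrightarrow> y \<notin> U \<Longrightarrow> \<theta> y = 0"
    and cut: "\<And>f. smooth_fun_on M U f \<Longrightarrow> (\<lambda>y. if y \<in> U then \<theta> y * f y else 0) \<in> smooth_funs M"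
    and e: "\<And>i. i < vrank E \<Longrightarrow> e i \<in> smooth_sections M E"
    and eU: "\<And>i y. i < vrank E \<Longrightarrow> y \<in> U \<Longrightarrow> e i y = vscale E (\<theta> y) (frame E \<Psi> y i)"
    and eN: "\<And>i y. i < vrank E \<Longrightarrow> y \<in> N \<Longrightarrow> e i y = frame E \<Psi> y i"
    using extended_frame[OF t] by blast
  \<comment> \<open>Carries a vector over \<open>y\<close> to the vector over \<open>x\<close> with
    the same coordinates in the trivialisation; on the fibre over \<open>x\<close> it is the
    identity.\<close>
  define T where "T v = inv_into (fibre E x) \<Psi> (\<Psi> v)" for v
  have T: "T v \<in> fibre E x" "\<Psi> (T v) = \<Psi> v" if "y \<in> U" "v \<in> fibre E y" for y v
  proof -
    have "\<Psi> v \<in> \<Psi> ` fibre E x"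
      using bij_betw_imp_surj_on[OF triv_bij[OF t]] bij_betwE[OF triv_bij[OF t(1) that(1)]] that(2) by blast
    then show "T v \<in> fibre E x" "\<Psi> (T v) = \<Psi> v"
      unfolding T_def by (rule inv_into_into, rule f_inv_into_f)
  qed
  have Tadd: "T (vadd E u v) = vadd E (T u) (T v)" if "y \<in> U" "u \<in> fibre E y" "v \<in> fibre E y" for y u v
  proof (rule triv_eqI[OF t])
    have y: "y \<in> pts M" by (rule triv_pts[OF t(1) that(1)])
    note w = T[OF that(1) vadd_fibre[OF y that(2,3)]]
    show "T (vadd E u v) \<in> fibre E x" "vadd E (T u) (T v) \<in> fibre E x"
      using w(1) vadd_fibre[OF x T(1)[OF that(1,2)] T(1)[OF that(1,3)]] by auto
    show "\<Psi> (T (vadd E u v)) k = \<Psi> (vadd E (T u) (T v)) k" for k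
      using w(2) triv_vadd[OF t T(1)[OF that(1,2)] T(1)[OF that(1,3)]] T(2)[OF that(1,2)] T(2)[OF that(1,3)]
        triv_vadd[OF t(1) that] by simp
  qed
  have Tscale: "T (vscale E a u) = vscale E a (T u)" if "y \<in> U" "u \<in> fibre E y" for y u a
  proof (rule triv_eqI[OF t])
    have y: "y \<in> pts M" by (rule triv_pts[OF t(1) that(1)])
    note w = T[OF that(1) vscale_fibre[OF y that(2)]]
    show "T (vscale E a u) \<in> fibre E x" "vscale E a (T u) \<in> fibre E x"
      using w(1) vscale_fibre[OF x T(1)[OF that]] by auto
    show "\<Psi> (T (vscale E a u)) k = \<Psi> (vscale E a (T u)) k" for k
      using w(2) triv_vscale[OF t T(1)[OF that]] T(2)[OF that] triv_vscale[OF t(1) that] by simp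
  qed
  have Tx: "T v = v" if "v \<in> fibre E x" for v
    unfolding T_def by (rule inv_into_f_f[OF bij_betw_imp_inj_on[OF triv_bij[OF t]] that])
  have Tset: "set (map T vs) \<subseteq> fibre E x" if "y \<in> U" "set vs \<subseteq> fibre E y" for y vs
    using T(1)[OF that(1)] that(2) by auto
  define \<omega> where "\<omega> y vs = (if y \<in> U \<and> length vs = p \<and> set vs \<subseteq> fibre E y then \<theta> y * \<eta> (map T vs) else 0)" for y vs
  have \<omega>v: "\<omega> y vs = \<theta> y * \<eta> (map T vs)" if "y \<in> U" "length vs = p" "set vs \<subseteq> fibre E y" for y vs
    using that by (simp add: \<omega>_def)
  have "\<omega> x = \<eta>"
  proof
    fix vs
    have "map T vs = vs" if "set vs \<subseteq> fibre E x" using that Tx by (auto intro: map_idI)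
    then show "\<omega> x vs = \<eta> vs" using t N(2,4) alt_forms_eq_0[OF \<eta>, of vs] by (auto simp: \<omega>_def)
  qed
  moreover have "\<omega> \<in> forms M E p"
  proof (rule formI)
    fix y assume y: "y \<in> pts M"
    show "\<omega> y \<in> alt_forms E y p"
    proof (cases "y \<in> U")
      case True
      show ?thesis unfolding alt_forms_def
      proof (intro CollectI conjI allI impI, goal_cases)
        case (1 vs)
        then show ?case by (auto simp: \<omega>_def)
      next
        case (2 vs i u v a)
        then have *: "length vs = p" "set vs \<subseteq> fibre E y" "i < p" "u \<in> fibre E y" "v \<in> fibre E y" by auto
        note mT = _ Tset[OF True *(2)] *(3)
        have "\<eta> ((map T vs)[i := vadd E (T u) (T v)]) = \<eta> ((map T vs)[i := T u]) + \<eta> ((map T vs)[i := T v])"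
          using *(1) T(1)[OF True *(4)] T(1)[OF True *(5)] by (intro alt_forms_vadd[OF \<eta> mT]) auto
        then show ?case
          using * vadd_fibre[OF y *(4,5)] Tadd[OF True *(4,5)]
          by (simp add: \<omega>v[OF True] set_list_update_fibre map_update algebra_simps)
      next
        case (3 vs i u v a)
        then have *: "length vs = p" "set vs \<subseteq> fibre E y" "i < p" "u \<in> fibre E y" by auto
        note mT = _ Tset[OF True *(2)] *(3)
        have "\<eta> ((map T vs)[i := vscale E a (T u)]) = a * \<eta> ((map T vs)[i := T u])"
          using *(1) T(1)[OF True *(4)] by (intro alt_forms_vscale[OF \<eta> mT]) auto
        then show ?case
          using * vscale_fibre[OF y *(4)] Tscale[OF True *(4)]
          by (simp add: \<omega>v[OF True] set_list_update_fibre map_update)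
      next
        case (4 vs i j)
        then have *: "length vs = p" "set vs \<subseteq> fibre E y" "i < p" "i < j" "j < p" "vs ! i = vs ! j" by auto
        have "\<eta> (map T vs) = 0"
          using * by (intro alt_forms_equal[OF \<eta> _ Tset[OF True *(2)] *(3-5)]) auto
        then show ?case using * by (simp add: \<omega>v[OF True])
      qed
    next
      case False
      then have "\<omega> y = (\<lambda>_. 0)" by (auto simp: \<omega>_def)
      then show ?thesis by (simp add: alt_forms_def)
    qed
  next
    fix y assume "y \<notin> pts M"
    then have "y \<notin> U" using triv_pts[OF t(1)] by blast
    then show "\<omega> y = (\<lambda>_. 0)" by (auto simp: \<omega>_def)
  next
    fix Vs assume Vs: "set Vs \<subseteq> smooth_sections M E" "length Vs = p"
    \<comment> \<open>The sections are expanded from the right. The fixed list \<open>ws\<close>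
      collects frame vectors over \<open>x\<close>, where \<eta> lives, so that only the components
      of the sections vary with \<open>y\<close>.\<close>
    have "smooth_fun_on M U (\<lambda>y. \<eta> (map (\<lambda>s. T (s y)) Vs @ ws))"
      if "set Vs \<subseteq> smooth_sections M E" "set ws \<subseteq> fibre E x" "length Vs + length ws = p" for Vs ws
      using that
    proof (induction Vs arbitrary: ws rule: rev_induct)
      case Nil
      then show ?case using smooth_fun_on_const[OF triv_openin[OF t(1)]] by simp
    next
      case (snoc s Vs)
      have s: "s \<in> smooth_sections M E" and Vs: "set Vs \<subseteq> smooth_sections M E" using snoc.prems by auto
      have "smooth_fun_on M U (\<lambda>y. \<Sum>k<vrank E. \<Psi> (s y) k * \<eta> (map (\<lambda>s. T (s y)) Vs @ frame E \<Psi> x k # ws))"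
      proof (rule smooth_fun_on_sum[OF triv_openin[OF t(1)]])
        fix k assume "k \<in> {..<vrank E}"
        then have "smooth_fun_on M U (\<lambda>y. \<eta> (map (\<lambda>s. T (s y)) Vs @ frame E \<Psi> x k # ws))"
          using snoc.prems frame_fibre[OF t] by (intro snoc.IH) auto
        then show "smooth_fun_on M U (\<lambda>y. \<Psi> (s y) k * \<eta> (map (\<lambda>s. T (s y)) Vs @ frame E \<Psi> x k # ws))"
          by (rule smooth_fun_on_mult[OF section_components_smooth[OF s t(1)]])
      qed
      then show ?case
      proof (rule smooth_fun_on_cong)
        fix y assume y: "y \<in> U"
        have yM: "y \<in> pts M" by (rule triv_pts[OF t(1) y])
        have "set (map (\<lambda>s. T (s y)) Vs) \<subseteq> fibre E x" using Vs section_fibre[OF _ yM] T(1)[OF y] by auto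
        then show "(\<Sum>k<vrank E. \<Psi> (s y) k * \<eta> (map (\<lambda>s. T (s y)) Vs @ frame E \<Psi> x k # ws)) =
            \<eta> (map (\<lambda>s. T (s y)) (Vs @ [s]) @ ws)"
          using alt_forms_expand_append[OF t \<eta> _ _ snoc.prems(2) T(1)[OF y section_fibre[OF s yM]],
              of "map (\<lambda>s. T (s y)) Vs"] snoc.prems(3) T(2)[OF y section_fibre[OF s yM]] by simp
      qed
    qed
    from this[OF Vs(1), of "[]"] have "smooth_fun_on M U (\<lambda>y. \<eta> (map (\<lambda>s. T (s y)) Vs))"
      using Vs(2) by simp
    from cut[OF this] have "smooth_fun_on M (pts M) (\<lambda>y. if y \<in> U then \<theta> y * \<eta> (map (\<lambda>s. T (s y)) Vs) else 0)"
      by (simp add: smooth_funs_iff)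
    then show "smooth_fun_on M (pts M) (\<lambda>y. \<omega> y (map (\<lambda>s. s y) Vs))"
    proof (rule smooth_fun_on_cong)
      fix y assume y: "y \<in> pts M"
      show "(if y \<in> U then \<theta> y * \<eta> (map (\<lambda>s. T (s y)) Vs) else 0) = \<omega> y (map (\<lambda>s. s y) Vs)"
        using Vs(2) sections_fibre[OF y Vs(1)] by (simp add: \<omega>_def comp_def)
    qed
  qed
  ultimately show ?thesis by blast
qed

end

section \<open>Lie derivatives of forms on a Lie algebroid\<close>

locale lie_algebroid_section =
  fixes M :: "'m manifold" and E :: "('e, 'm) vector_bundle"
    and \<rho> :: "'e \<Rightarrow> 'm \<times> 'm derivation" and br :: "('m \<Rightarrow> 'e) \<Rightarrow> ('m \<Rightarrow> 'e) \<Rightarrow> 'm \<Rightarrow> 'e"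
    and V :: "'m \<Rightarrow> 'e"
  assumes lie_algebroid: "lie_algebroid M E \<rho> br"
    and V_section: "V \<in> smooth_sections M E"

sublocale lie_algebroid_section \<subseteq> smooth_vb M E
proof
  show "smooth_manifold M" using lie_algebroid unfolding lie_algebroid_def by (elim conjE)
  show "smooth_vector_bundle M E" using lie_algebroid unfolding lie_algebroid_def by (elim conjE)
qed

context lie_algebroid_section
begin

section \<open>The vector field obtained from \<open>V\<close> through the anchor\<close>

lemma anchor_bundle_map: "smooth_bundle_map M E (tangent_bundle M) \<rho>"
  using lie_algebroid unfolding lie_algebroid_def by (elim conjE)

lemma anchor_fibrewise:
  assumes "x \<in> pts M" "u \<in> fibre E x"
  shows "\<rho> u \<in> fibre (tangent_bundle M) x \<and>
        (\<forall>v \<in> fibre E x. \<rho> (vadd E u v) = vadd (tangent_bundle M) (\<rho> u) (\<rho> v)) \<and>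
        (\<forall>a. \<rho> (vscale E a u) = vscale (tangent_bundle M) a (\<rho> u))"
proof -
  have "\<forall>x \<in> pts M. \<forall>u \<in> fibre E x. \<rho> u \<in> fibre (tangent_bundle M) x \<and>
        (\<forall>v \<in> fibre E x. \<rho> (vadd E u v) = vadd (tangent_bundle M) (\<rho> u) (\<rho> v)) \<and>
        (\<forall>a. \<rho> (vscale E a u) = vscale (tangent_bundle M) a (\<rho> u))"
    using anchor_bundle_map unfolding smooth_bundle_map_def by (elim conjE)
  from bspec[OF bspec[OF this assms(1)] assms(2)] show ?thesis .
qed

lemma
  assumes "x \<in> pts M" "u \<in> fibre E x"
  shows anchor_tangent: "snd (\<rho> u) \<in> tangent_space M x"
    and anchor_vadd: "v \<in> fibre E x \<Longrightarrow> snd (\<rho> (vadd E u v)) f = snd (\<rho> u) f + snd (\<rho> v) f"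
    and anchor_vscale: "snd (\<rho> (vscale E a u)) f = a * snd (\<rho> u) f"
  using anchor_fibrewise[OF assms] by (auto simp: tangent_bundle_def fibre_def)

lemma anchor_frame_smooth:
  assumes t: "(U, \<Psi>) \<in> trivs E" and c: "(W, \<phi>) \<in> charts M" and ij: "i < vrank E" "j < mdim M"
  shows "smooth_fun_on M (U \<inter> W) (\<lambda>x. snd (\<rho> (frame E \<Psi> x i)) (\<lambda>y. \<phi> y j))"
proof -
  have *: "\<forall>(U, \<Psi>) \<in> trivs E. \<forall>(W, \<Theta>) \<in> trivs (tangent_bundle M). \<forall>i < vrank E. \<forall>j < vrank (tangent_bundle M).
        smooth_fun_on M (U \<inter> W) (\<lambda>x. \<Theta> (\<rho> (frame E \<Psi> x i)) j)"
    using anchor_bundle_map unfolding smooth_bundle_map_def by (elim conjE)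
  have "(W, \<lambda>u j. snd u (\<lambda>y. \<phi> y j)) \<in> trivs (tangent_bundle M)"
    using c by (force simp: tangent_bundle_def)
  moreover have "vrank (tangent_bundle M) = mdim M" by (simp add: tangent_bundle_def)
  ultimately show ?thesis using bspec[OF *, OF t] ij by auto
qed

text \<open>The anchor is known to be smooth on frames; fibrewise linearity transfers this to
  \<open>V\<close> by expanding it in a frame.\<close>

lemma anchor_components_smooth:
  assumes c: "(W, \<phi>) \<in> charts M" and j: "j < mdim M"
  shows "smooth_fun_on M W (\<lambda>x. snd (\<rho> (V x)) (\<lambda>y. \<phi> y j))"
proof (rule smooth_fun_on_local)
  fix x assume x: "x \<in> W"
  obtain U \<Psi> where t: "(U, \<Psi>) \<in> trivs E" and xU: "x \<in> U"
    using triv_around chart_subset[OF c] x by blast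
  have UW: "openin (mtop M) (U \<inter> W)" using triv_openin[OF t] chart_openin[OF c] by (rule openin_Int)
  have "smooth_fun_on M (U \<inter> W) (\<lambda>x. \<Sum>i<vrank E. \<Psi> (V x) i * snd (\<rho> (frame E \<Psi> x i)) (\<lambda>y. \<phi> y j))"
    using smooth_fun_on_subset[OF section_components_smooth[OF V_section t] UW] anchor_frame_smooth[OF t c _ j]
    by (intro smooth_fun_on_sum[OF UW] smooth_fun_on_mult) auto
  then have "smooth_fun_on M (U \<inter> W) (\<lambda>x. snd (\<rho> (V x)) (\<lambda>y. \<phi> y j))"
  proof (rule smooth_fun_on_cong)
    fix y assume y: "y \<in> U \<inter> W"
    then have yU: "y \<in> U" by simp
    have yM: "y \<in> pts M" by (rule triv_pts[OF t yU])
    show "(\<Sum>i<vrank E. \<Psi> (V y) i * snd (\<rho> (frame E \<Psi> y i)) (\<lambda>y. \<phi> y j)) = snd (\<rho> (V y)) (\<lambda>y. \<phi> y j)"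
      using linear_frame_expansion[OF t yU, of "\<lambda>u. snd (\<rho> u) (\<lambda>y. \<phi> y j)"] anchor_vadd[OF yM]
        anchor_vscale[OF yM] section_fibre[OF V_section yM] by simp
  qed
  then show "\<exists>W'. x \<in> W' \<and> W' \<subseteq> W \<and> smooth_fun_on M W' (\<lambda>x. snd (\<rho> (V x)) (\<lambda>y. \<phi> y j))"
    using x xU by blast
qed

end

sublocale lie_algebroid_section \<subseteq> smooth_vector_field M "\<rho> \<circ> V"
proof
  show "snd ((\<rho> \<circ> V) x) \<in> tangent_space M x" if "x \<in> pts M" for x
    using anchor_tangent[OF that section_fibre[OF V_section that]] by simp
  show "smooth_fun_on M U (\<lambda>x. snd ((\<rho> \<circ> V) x) (\<lambda>y. \<phi> y j))"
    if "(U, \<phi>) \<in> charts M" "j < mdim M" for U \<phi> j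
    using anchor_components_smooth[OF that] by simp
qed

context lie_algebroid_section
begin

section \<open>The bracket with \<open>V\<close> on sections and its locality\<close>

abbreviation X :: "'m \<Rightarrow> 'm \<times> 'm derivation" where "X \<equiv> \<rho> \<circ> V"

lemma bracket_section: "s \<in> smooth_sections M E \<Longrightarrow> br V s \<in> smooth_sections M E"
proof -
  have "\<forall>s \<in> smooth_sections M E. \<forall>t \<in> smooth_sections M E. br s t \<in> smooth_sections M E"
    using lie_algebroid unfolding lie_algebroid_def by (elim conjE)
  then show "s \<in> smooth_sections M E \<Longrightarrow> br V s \<in> smooth_sections M E" using V_section by simp
qed

lemma bracket_add:
  assumes "s \<in> smooth_sections M E" "t \<in> smooth_sections M E"
  shows "br V (sec_add M E s t) = sec_add M E (br V s) (br V t)"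
proof -
  have "\<forall>s \<in> smooth_sections M E. \<forall>t \<in> smooth_sections M E. \<forall>u \<in> smooth_sections M E.
        br (sec_add M E s t) u = sec_add M E (br s u) (br t u) \<and>
        br u (sec_add M E s t) = sec_add M E (br u s) (br u t)"
    using lie_algebroid unfolding lie_algebroid_def by (elim conjE)
  from bspec[OF bspec[OF bspec[OF this assms(1)] assms(2)] V_section] show ?thesis by (rule conjunct2)
qed

lemma bracket_mult:
  assumes "f \<in> smooth_funs M" "s \<in> smooth_sections M E"
  shows "br V (sec_mult M E f s) =
    sec_add M E (sec_mult M E f (br V s)) (sec_mult M E (lie_deriv_fun X f) s)"
proof -
  have "\<forall>s \<in> smooth_sections M E. \<forall>t \<in> smooth_sections M E. \<forall>f \<in> smooth_funs M.
        br s (sec_mult M E f t) =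
          sec_add M E (sec_mult M E f (br s t)) (sec_mult M E (lie_deriv_fun (\<rho> \<circ> s) f) t)"
    using lie_algebroid unfolding lie_algebroid_def by (elim conjE)
  from bspec[OF bspec[OF bspec[OF this V_section] assms(2)] assms(1)] show ?thesis .
qed

lemma lie_deriv_fun_in_smooth_funs: "f \<in> smooth_funs M \<Longrightarrow> lie_deriv_fun X f \<in> smooth_funs M"
  by (simp add: smooth_funs_iff lie_deriv_fun_smooth)

text \<open>If \<theta> vanishes off \<open>N\<close>, then the products of \<theta> with
  \<open>s\<close> and with \<open>t\<close> are the same global section. The Leibniz rule at
  \<open>x\<close>, where \<theta> is 1, recovers the two brackets.\<close>

lemma bracket_local:
  assumes s: "s \<in> smooth_sections M E" and t: "t \<in> smooth_sections M E"
    and N: "openin (mtop M) N" "x \<in> N" and st: "\<And>y. y \<in> N \<Longrightarrow> s y = t y"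
  shows "br V s x = br V t x"
proof -
  obtain \<theta> N' where \<theta>: "smooth_fun_on M (pts M) \<theta>" and N': "openin (mtop M) N'" "x \<in> N'" "N' \<subseteq> N"
    "\<And>y. y \<in> N' \<Longrightarrow> \<theta> y = 1" and \<theta>0: "\<And>y. y \<in> pts M \<Longrightarrow> y \<notin> N \<Longrightarrow> \<theta> y = 0" and
    "\<And>W f. openin (mtop M) W \<Longrightarrow> smooth_fun_on M (N \<inter> W) f \<Longrightarrow>
       smooth_fun_on M W (\<lambda>y. if y \<in> N then \<theta> y * f y else 0)"
    using cutoff_function[OF N] by blast
  have x: "x \<in> pts M" using openin_subset[OF N(1)] N(2) by blast
  obtain U \<Psi> where T: "(U, \<Psi>) \<in> trivs E" "x \<in> U" using triv_around[OF x] .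
  have \<theta>f: "\<theta> \<in> smooth_funs M" using \<theta> by (simp add: smooth_funs_iff)
  have "sec_mult M E \<theta> s = sec_mult M E \<theta> t"
  proof (rule section_eqI[OF sec_mult_section[OF \<theta>f s] sec_mult_section[OF \<theta>f t]])
    fix y assume y: "y \<in> pts M"
    show "sec_mult M E \<theta> s y = sec_mult M E \<theta> t y"
    proof (cases "y \<in> N")
      case True
      then show ?thesis using y by (simp add: sec_mult_def st)
    next
      case False
      obtain U' \<Psi>' where T': "(U', \<Psi>') \<in> trivs E" "y \<in> U'" using triv_around[OF y] .
      show ?thesis
        by (rule triv_eqI[OF T' section_fibre[OF sec_mult_section[OF \<theta>f s] y] section_fibre[OF sec_mult_section[OF \<theta>f t] y]])
          (simp add: sec_mult_def y \<theta>0[OF y False] triv_vscale[OF T' section_fibre[OF s y]] triv_vscale[OF T' section_fibre[OF t y]])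
    qed
  qed
  then have eq: "br V (sec_mult M E \<theta> s) x = br V (sec_mult M E \<theta> t) x" by simp
  \<comment> \<open>The term with the derivative of \<theta> is the same for \<open>s\<close> and
    \<open>t\<close>, since they agree at \<open>x\<close>; it cancels in the comparison.\<close>
  have comp: "\<Psi> (br V (sec_mult M E \<theta> u) x) k = \<Psi> (br V u x) k + lie_deriv_fun X \<theta> x * \<Psi> (u x) k"
    if u: "u \<in> smooth_sections M E" for u k
  proof -
    have "br V (sec_mult M E \<theta> u) x =
        vadd E (vscale E (\<theta> x) (br V u x)) (vscale E (lie_deriv_fun X \<theta> x) (u x))"
      unfolding bracket_mult[OF \<theta>f u] using x by (simp add: sec_add_def sec_mult_def)
    then show ?thesis
      using N'(2,4) triv_vadd[OF T vscale_fibre[OF x section_fibre[OF bracket_section[OF u] x]]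
          vscale_fibre[OF x section_fibre[OF u x]]]
        triv_vscale[OF T section_fibre[OF bracket_section[OF u] x]] triv_vscale[OF T section_fibre[OF u x]]
      by simp
  qed
  show ?thesis
  proof (rule triv_eqI[OF T section_fibre[OF bracket_section[OF s] x] section_fibre[OF bracket_section[OF t] x]])
    fix k
    show "\<Psi> (br V s x) k = \<Psi> (br V t x) k"
      using comp[OF s, of k] comp[OF t, of k] eq st[OF N(2)] by simp
  qed
qed

text \<open>The prescribed values as a function of global sections. That they come from a form, as
  the description operator in \<open>lie_deriv_form\<close> requires, is proved from their
  tensoriality.\<close>

definition lie_form_value :: "nat \<Rightarrow> ('e, 'm) form \<Rightarrow> ('m \<Rightarrow> 'e) list \<Rightarrow> 'm \<Rightarrow> real" where
  "lie_form_value p \<eta> Vs x =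
     lie_deriv_fun X (\<lambda>y. \<eta> y (map (\<lambda>s. s y) Vs)) x -
     (\<Sum>i<p. \<eta> x (map (\<lambda>s. s x) (Vs[i := br V (Vs ! i)])))"

lemma set_list_update_sections:
  "set Vs \<subseteq> smooth_sections M E \<Longrightarrow> s \<in> smooth_sections M E \<Longrightarrow> set (Vs[i := s]) \<subseteq> smooth_sections M E"
  by (rule set_list_update_fibre)

lemma bracket_nth_section:
  "set Vs \<subseteq> smooth_sections M E \<Longrightarrow> i < length Vs \<Longrightarrow> br V (Vs ! i) \<in> smooth_sections M E"
  by (rule bracket_section) (use nth_mem in blast)

lemma lie_form_value_smooth:
  assumes \<eta>: "\<eta> \<in> forms M E p" and Vs: "set Vs \<subseteq> smooth_sections M E" "length Vs = p"
  shows "smooth_fun_on M (pts M) (lie_form_value p \<eta> Vs)"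
  unfolding lie_form_value_def[abs_def]
proof (rule smooth_fun_on_minus)
  show "smooth_fun_on M (pts M) (lie_deriv_fun X (\<lambda>y. \<eta> y (map (\<lambda>s. s y) Vs)))"
    by (rule lie_deriv_fun_smooth[OF form_on_sections_smooth[OF \<eta> Vs]])
  show "smooth_fun_on M (pts M) (\<lambda>x. \<Sum>i<p. \<eta> x (map (\<lambda>s. s x) (Vs[i := br V (Vs ! i)])))"
    using Vs by (intro smooth_fun_on_sum openin_topspace form_on_sections_smooth[OF \<eta>]
        set_list_update_sections bracket_nth_section) auto
qed

lemma form_sec_add:
  assumes \<eta>: "\<eta> \<in> forms M E p" and Vs: "set Vs \<subseteq> smooth_sections M E" "length Vs = p" "j < p"
    and st: "s \<in> smooth_sections M E" "t \<in> smooth_sections M E" and x: "x \<in> pts M"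
  shows "\<eta> x (map (\<lambda>s. s x) (Vs[j := sec_add M E s t])) =
    \<eta> x (map (\<lambda>s. s x) (Vs[j := s])) + \<eta> x (map (\<lambda>s. s x) (Vs[j := t]))"
  using alt_forms_vadd[OF form_alt[OF \<eta> x] _ sections_fibre[OF x Vs(1)] Vs(3) section_fibre[OF st(1) x] section_fibre[OF st(2) x]]
    Vs(2) x by (simp add: map_update sec_add_def)

lemma form_sec_mult:
  assumes \<eta>: "\<eta> \<in> forms M E p" and Vs: "set Vs \<subseteq> smooth_sections M E" "length Vs = p" "j < p"
    and s: "s \<in> smooth_sections M E" and x: "x \<in> pts M"
  shows "\<eta> x (map (\<lambda>s. s x) (Vs[j := sec_mult M E f s])) = f x * \<eta> x (map (\<lambda>s. s x) (Vs[j := s]))"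
  using alt_forms_vscale[OF form_alt[OF \<eta> x] _ sections_fibre[OF x Vs(1)] Vs(3) section_fibre[OF s x]]
    Vs(2) x by (simp add: map_update sec_mult_def)

lemma lie_form_value_add:
  assumes \<eta>: "\<eta> \<in> forms M E p" and Vs: "set Vs \<subseteq> smooth_sections M E" "length Vs = p" "j < p"
    and st: "s \<in> smooth_sections M E" "t \<in> smooth_sections M E" and x: "x \<in> pts M"
  shows "lie_form_value p \<eta> (Vs[j := sec_add M E s t]) x =
    lie_form_value p \<eta> (Vs[j := s]) x + lie_form_value p \<eta> (Vs[j := t]) x"
proof -
  have sm: "smooth_fun_on M (pts M) (\<lambda>y. \<eta> y (map (\<lambda>s. s y) (Vs[j := w])))" if "w \<in> smooth_sections M E" for w
    using Vs that by (intro form_on_sections_smooth[OF \<eta>] set_list_update_sections) auto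
  have "lie_deriv_fun X (\<lambda>y. \<eta> y (map (\<lambda>s. s y) (Vs[j := sec_add M E s t]))) x =
      lie_deriv_fun X (\<lambda>y. \<eta> y (map (\<lambda>s. s y) (Vs[j := s])) + \<eta> y (map (\<lambda>s. s y) (Vs[j := t]))) x"
    by (rule lie_deriv_fun_cong[OF sm[OF sec_add_section[OF st]] x]) (rule form_sec_add[OF \<eta> Vs st])
  also have "\<dots> = lie_deriv_fun X (\<lambda>y. \<eta> y (map (\<lambda>s. s y) (Vs[j := s]))) x +
      lie_deriv_fun X (\<lambda>y. \<eta> y (map (\<lambda>s. s y) (Vs[j := t]))) x"
    by (rule lie_deriv_fun_add[OF sm[OF st(1)] sm[OF st(2)] x])
  finally have 1: "lie_deriv_fun X (\<lambda>y. \<eta> y (map (\<lambda>s. s y) (Vs[j := sec_add M E s t]))) x =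
      lie_deriv_fun X (\<lambda>y. \<eta> y (map (\<lambda>s. s y) (Vs[j := s]))) x +
      lie_deriv_fun X (\<lambda>y. \<eta> y (map (\<lambda>s. s y) (Vs[j := t]))) x" .
  let ?b = "\<lambda>w i. \<eta> x (map (\<lambda>s. s x) ((Vs[j := w])[i := br V (Vs[j := w] ! i)]))"
  \<comment> \<open>In position \<open>j\<close> additivity of the bracket enters; in any other
    position the two updates commute and only the form is involved.\<close>
  have 2: "?b (sec_add M E s t) i = ?b s i + ?b t i" if i: "i < p" for i
  proof (cases "i = j")
    case True
    then show ?thesis
      using form_sec_add[OF \<eta> Vs bracket_section[OF st(1)] bracket_section[OF st(2)] x] Vs
      by (simp add: bracket_add[OF st])
  next
    case False
    have c: "set (Vs[i := br V (Vs ! i)]) \<subseteq> smooth_sections M E" "length (Vs[i := br V (Vs ! i)]) = p"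
      using Vs i by (simp_all add: set_list_update_sections bracket_nth_section)
    show ?thesis
      using form_sec_add[OF \<eta> c Vs(3) st x] False by (simp add: list_update_swap[of i j])
  qed
  have "(\<Sum>i<p. ?b (sec_add M E s t) i) = (\<Sum>i<p. ?b s i) + (\<Sum>i<p. ?b t i)"
    unfolding sum.distrib[symmetric] by (rule sum.cong) (simp_all add: 2)
  with 1 show ?thesis unfolding lie_form_value_def by simp
qed

text \<open>The two terms with the derivative of \<open>f\<close> cancel; this makes the Lie derivative tensorial.\<close>

lemma lie_form_value_mult:
  assumes \<eta>: "\<eta> \<in> forms M E p" and Vs: "set Vs \<subseteq> smooth_sections M E" "length Vs = p" "j < p"
    and f: "f \<in> smooth_funs M" and s: "s \<in> smooth_sections M E" and x: "x \<in> pts M"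
  shows "lie_form_value p \<eta> (Vs[j := sec_mult M E f s]) x = f x * lie_form_value p \<eta> (Vs[j := s]) x"
proof -
  let ?g = "\<lambda>y. \<eta> y (map (\<lambda>s. s y) (Vs[j := s]))"
  have sm: "smooth_fun_on M (pts M) (\<lambda>y. \<eta> y (map (\<lambda>s. s y) (Vs[j := w])))" if "w \<in> smooth_sections M E" for w
    using Vs that by (intro form_on_sections_smooth[OF \<eta>] set_list_update_sections) auto
  have f': "smooth_fun_on M (pts M) f" using f by (simp add: smooth_funs_iff)
  have "lie_deriv_fun X (\<lambda>y. \<eta> y (map (\<lambda>s. s y) (Vs[j := sec_mult M E f s]))) x =
      lie_deriv_fun X (\<lambda>y. f y * ?g y) x"
    by (rule lie_deriv_fun_cong[OF sm[OF sec_mult_section[OF f s]] x]) (rule form_sec_mult[OF \<eta> Vs s])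
  also have "\<dots> = f x * lie_deriv_fun X ?g x + lie_deriv_fun X f x * ?g x"
    by (rule lie_deriv_fun_mult[OF f' sm[OF s] x])
  finally have 1: "lie_deriv_fun X (\<lambda>y. \<eta> y (map (\<lambda>s. s y) (Vs[j := sec_mult M E f s]))) x =
      f x * lie_deriv_fun X ?g x + lie_deriv_fun X f x * ?g x" .
  let ?b = "\<lambda>w i. \<eta> x (map (\<lambda>s. s x) ((Vs[j := w])[i := br V (Vs[j := w] ! i)]))"
  have 2: "?b (sec_mult M E f s) i = f x * ?b s i + (if i = j then lie_deriv_fun X f x * ?g x else 0)"
    if i: "i < p" for i
  proof (cases "i = j")
    case True
    have "\<eta> x (map (\<lambda>s. s x) (Vs[j := br V (sec_mult M E f s)])) =
        \<eta> x (map (\<lambda>s. s x) (Vs[j := sec_mult M E f (br V s)])) +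
        \<eta> x (map (\<lambda>s. s x) (Vs[j := sec_mult M E (lie_deriv_fun X f) s]))"
      unfolding bracket_mult[OF f s]
      by (rule form_sec_add[OF \<eta> Vs sec_mult_section[OF f bracket_section[OF s]]
            sec_mult_section[OF lie_deriv_fun_in_smooth_funs[OF f] s] x])
    also have "\<dots> = f x * \<eta> x (map (\<lambda>s. s x) (Vs[j := br V s])) + lie_deriv_fun X f x * ?g x"
      by (simp only: form_sec_mult[OF \<eta> Vs bracket_section[OF s] x] form_sec_mult[OF \<eta> Vs s x])
    finally show ?thesis using True Vs by simp
  next
    case False
    have c: "set (Vs[i := br V (Vs ! i)]) \<subseteq> smooth_sections M E" "length (Vs[i := br V (Vs ! i)]) = p"
      using Vs i by (simp_all add: set_list_update_sections bracket_nth_section)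
    show ?thesis
      using form_sec_mult[OF \<eta> c Vs(3) s x] False by (simp add: list_update_swap[of i j])
  qed
  have "(\<Sum>i<p. ?b (sec_mult M E f s) i) =
      (\<Sum>i<p. f x * ?b s i + (if i = j then lie_deriv_fun X f x * ?g x else 0))"
    by (rule sum.cong) (simp_all add: 2)
  also have "\<dots> = f x * (\<Sum>i<p. ?b s i) + lie_deriv_fun X f x * ?g x"
    using Vs(3) by (simp add: sum.distrib sum_distrib_left)
  finally show ?thesis using 1 unfolding lie_form_value_def by (simp add: algebra_simps)
qed

text \<open>The first term differentiates the zero function. In the sum, a bracket in a third
  position leaves the equal pair intact, and the brackets in positions \<open>i\<close> and
  \<open>j\<close> give opposite values.\<close>

lemma lie_form_value_alternating:
  assumes \<eta>: "\<eta> \<in> forms M E p" and Vs: "set Vs \<subseteq> smooth_sections M E" "length Vs = p"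
    and ij: "i < j" "j < p" "Vs ! i = Vs ! j" and x: "x \<in> pts M"
  shows "lie_form_value p \<eta> Vs x = 0"
proof -
  have ip: "i < p" using ij by simp
  have 0: "\<eta> y (map (\<lambda>s. s y) Vs) = 0" if "y \<in> pts M" for y
    using Vs(2) ij
    by (intro alt_forms_equal[OF form_alt[OF \<eta> that] _ sections_fibre[OF that Vs(1)] ip ij(1,2)]) simp_all
  have "lie_deriv_fun X (\<lambda>y. \<eta> y (map (\<lambda>s. s y) Vs)) x = lie_deriv_fun X (\<lambda>_. 0) x"
    by (rule lie_deriv_fun_cong[OF form_on_sections_smooth[OF \<eta> Vs] x 0])
  then have d: "lie_deriv_fun X (\<lambda>y. \<eta> y (map (\<lambda>s. s y) Vs)) x = 0" by (simp add: lie_deriv_fun_const[OF x])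
  let ?s = "Vs ! i" and ?b = "br V (Vs ! i)"
  let ?vs = "map (\<lambda>s. s x) Vs"
  have s: "?s \<in> smooth_sections M E" using Vs ip nth_mem by blast
  have "\<eta> x (?vs[i := ?b x, j := ?s x]) = - \<eta> x (?vs[i := ?s x, j := ?b x])"
    using Vs(2) by (intro alt_forms_swap[OF form_alt[OF \<eta> x] x _ sections_fibre[OF x Vs(1)] ij(1,2)]
        section_fibre[OF _ x] bracket_section s) simp
  moreover have "?vs[i := ?s x] = ?vs" "?vs[j := ?s x] = ?vs"
    using ij ip Vs(2) by (simp_all add: list_update_same_conv)
  moreover have "?vs[i := ?b x, j := ?s x] = ?vs[j := ?s x, i := ?b x]"
    using ij(1) by (intro list_update_swap) simp
  moreover have "?vs[i := ?b x] = map (\<lambda>s. s x) (Vs[i := ?b])" "?vs[j := ?b x] = map (\<lambda>s. s x) (Vs[j := br V (Vs ! j)])"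
    using ij(3) by (simp_all add: map_update)
  ultimately have sw: "\<eta> x (map (\<lambda>s. s x) (Vs[i := ?b])) = - \<eta> x (map (\<lambda>s. s x) (Vs[j := br V (Vs ! j)]))" by simp
  have "\<eta> x (map (\<lambda>s. s x) (Vs[k := br V (Vs ! k)])) =
      (if k = i then \<eta> x (map (\<lambda>s. s x) (Vs[i := ?b])) else 0) +
      (if k = j then \<eta> x (map (\<lambda>s. s x) (Vs[j := br V (Vs ! j)])) else 0)" if k: "k < p" for k
  proof (cases "k = i \<or> k = j")
    case True
    then show ?thesis using ij by auto
  next
    case False
    have "set (Vs[k := br V (Vs ! k)]) \<subseteq> smooth_sections M E"
      using Vs k by (intro set_list_update_sections bracket_nth_section) auto
    then have "\<eta> x (map (\<lambda>s. s x) (Vs[k := br V (Vs ! k)])) = 0"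
      using Vs(2) ij ip False
      by (intro alt_forms_equal[OF form_alt[OF \<eta> x] _ sections_fibre[OF x] ip ij(1,2)]) auto
    then show ?thesis using False by simp
  qed
  then have "(\<Sum>k<p. \<eta> x (map (\<lambda>s. s x) (Vs[k := br V (Vs ! k)]))) =
      (\<Sum>k<p. (if k = i then \<eta> x (map (\<lambda>s. s x) (Vs[i := ?b])) else 0) +
      (if k = j then \<eta> x (map (\<lambda>s. s x) (Vs[j := br V (Vs ! j)])) else 0))"
    by (intro sum.cong) auto
  also have "\<dots> = 0" using ip ij(2) sw by (simp add: sum.distrib)
  finally show ?thesis using d unfolding lie_form_value_def by simp
qed

text \<open>Tensoriality concerns one argument at a time, so the sections of one list are exchanged
  for those of the other successively.\<close>

lemma lie_form_value_pointwise:
  assumes \<eta>: "\<eta> \<in> forms M E p" and Vs: "set Vs \<subseteq> smooth_sections M E" "length Vs = p"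
    and Ws: "set Ws \<subseteq> smooth_sections M E" "length Ws = p"
    and x: "x \<in> pts M" and eq: "map (\<lambda>s. s x) Vs = map (\<lambda>s. s x) Ws"
  shows "lie_form_value p \<eta> Vs x = lie_form_value p \<eta> Ws x"
proof -
  \<comment> \<open>The intermediate lists: the first \<open>m\<close> entries are already
    replaced.\<close>
  have "lie_form_value p \<eta> (take m Ws @ drop m Vs) x = lie_form_value p \<eta> Vs x" if "m \<le> p" for m
    using that
  proof (induction m)
    case (Suc m)
    let ?L = "take m Ws @ drop m Vs"
    have m: "m < p" using Suc.prems by simp
    have L: "set ?L \<subseteq> smooth_sections M E" "length ?L = p"
      using Vs Ws m set_take_subset[of m Ws] set_drop_subset[of m Vs] by auto
    have V: "Vs ! m \<in> smooth_sections M E" and W: "Ws ! m \<in> smooth_sections M E"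
      using subsetD[OF Vs(1) nth_mem] subsetD[OF Ws(1) nth_mem] Vs(2) Ws(2) m by simp_all
    have "(Vs ! m) x = (Ws ! m) x" using arg_cong[OF eq, of "\<lambda>l. l ! m"] Vs(2) Ws(2) m by simp
    then have "lie_form_value p \<eta> (?L[m := Vs ! m]) x = lie_form_value p \<eta> (?L[m := Ws ! m]) x"
      by (intro tensorial_pointwise[OF x, of "\<lambda>s. lie_form_value p \<eta> (?L[m := s]) x"] V W
          lie_form_value_add[OF \<eta> L m _ _ x] lie_form_value_mult[OF \<eta> L m _ _ x])
    moreover have "?L[m := Vs ! m] = ?L"
      using Vs(2) Ws(2) m by (simp only: list_update_same_conv[OF _] L) (simp add: nth_append)
    moreover have "?L[m := Ws ! m] = take (Suc m) Ws @ drop (Suc m) Vs"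
      using Vs(2) Ws(2) m
      by (intro nth_equalityI) (auto simp: nth_append nth_list_update less_Suc_eq)
    ultimately show ?case using Suc by simp
  qed simp
  from this[of p] show ?thesis using Vs(2) Ws(2) by simp
qed

text \<open>Through each vector some global section is chosen, and the values on sections define the
  form. The choice is harmless by \<open>lie_form_value_pointwise\<close>.\<close>

lemma lie_form_exists:
  assumes \<eta>: "\<eta> \<in> forms M E p"
  shows "\<exists>\<zeta>\<in>forms M E p. \<forall>Vs. length Vs = p \<and> set Vs \<subseteq> smooth_sections M E \<longrightarrow>
    (\<forall>x\<in>pts M. \<zeta> x (map (\<lambda>s. s x) Vs) = lie_form_value p \<eta> Vs x)"
proof -
  define ext where "ext x v = (SOME s. s \<in> smooth_sections M E \<and> s x = v)" for x v
  have ext: "ext x v \<in> smooth_sections M E" "ext x v x = v" if "x \<in> pts M" "v \<in> fibre E x" for x v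
    using someI_ex[of "\<lambda>s. s \<in> smooth_sections M E \<and> s x = v"] section_through[OF that]
    unfolding ext_def by blast+
  define \<zeta> where "\<zeta> x vs = (if x \<in> pts M \<and> length vs = p \<and> set vs \<subseteq> fibre E x
    then lie_form_value p \<eta> (map (ext x) vs) x else 0)" for x vs
  have exts: "set (map (ext x) vs) \<subseteq> smooth_sections M E" if "x \<in> pts M" "set vs \<subseteq> fibre E x" for x vs
    using ext(1)[OF that(1)] that(2) by auto
  have mapext: "map (\<lambda>s. s x) (map (ext x) vs) = vs" if "x \<in> pts M" "set vs \<subseteq> fibre E x" for x vs
    using ext(2)[OF that(1)] that(2) by (induction vs) auto
  have val: "\<zeta> x (map (\<lambda>s. s x) Vs) = lie_form_value p \<eta> Vs x"
    if Vs: "length Vs = p" "set Vs \<subseteq> smooth_sections M E" and x: "x \<in> pts M" for Vs x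
  proof -
    have f: "set (map (\<lambda>s. s x) Vs) \<subseteq> fibre E x" by (rule sections_fibre[OF x Vs(2)])
    have "lie_form_value p \<eta> (map (ext x) (map (\<lambda>s. s x) Vs)) x = lie_form_value p \<eta> Vs x"
      using Vs by (intro lie_form_value_pointwise[OF \<eta> exts[OF x f] _ Vs(2,1) x mapext[OF x f]]) simp
    then show ?thesis using f Vs(1) x by (simp add: \<zeta>_def)
  qed
  have \<zeta>v: "\<zeta> x vs = lie_form_value p \<eta> Vs x"
    if "x \<in> pts M" "length Vs = p" "set Vs \<subseteq> smooth_sections M E" "vs = map (\<lambda>s. s x) Vs" for x vs Vs
    using val that by simp
  have "\<zeta> \<in> forms M E p"
  proof (rule formI)
    fix x assume x: "x \<in> pts M"
    show "\<zeta> x \<in> alt_forms E x p" unfolding alt_forms_def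
    proof (intro CollectI conjI allI impI, goal_cases)
      case (1 vs)
      then show ?case by (auto simp: \<zeta>_def)
    next
      case (2 vs i u v a)
      then have *: "length vs = p" "set vs \<subseteq> fibre E x" "i < p" "u \<in> fibre E x" "v \<in> fibre E x" by auto
      let ?Vs = "map (ext x) vs"
      have Vs: "set ?Vs \<subseteq> smooth_sections M E" "length ?Vs = p" using exts[OF x *(2)] *(1) by auto
      note u = ext[OF x *(4)] and v = ext[OF x *(5)]
      have upd: "vs[i := w x] = map (\<lambda>s. s x) (?Vs[i := w])" for w
        using mapext[OF x *(2)] by (simp only: map_update)
      have z: "\<zeta> x (vs[i := w x]) = lie_form_value p \<eta> (?Vs[i := w]) x" if "w \<in> smooth_sections M E" for w
        by (rule \<zeta>v[OF x _ set_list_update_sections[OF Vs(1) that] upd]) (simp add: *(1))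
      \<comment> \<open>The sum of the chosen sections need not be the section chosen for the sum,
        but it has the right value at \<open>x\<close>, and \<open>z\<close> applies to every
        section.\<close>
      have "\<zeta> x (vs[i := sec_add M E (ext x u) (ext x v) x]) = \<zeta> x (vs[i := ext x u x]) + \<zeta> x (vs[i := ext x v x])"
        unfolding z[OF u(1)] z[OF v(1)] z[OF sec_add_section[OF u(1) v(1)]]
        by (rule lie_form_value_add[OF \<eta> Vs *(3) u(1) v(1) x])
      then show ?case using x u v by (simp add: sec_add_def)
    next
      case (3 vs i u v a)
      then have *: "length vs = p" "set vs \<subseteq> fibre E x" "i < p" "u \<in> fibre E x" by auto
      let ?Vs = "map (ext x) vs"
      have Vs: "set ?Vs \<subseteq> smooth_sections M E" "length ?Vs = p" using exts[OF x *(2)] *(1) by auto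
      note u = ext[OF x *(4)]
      have c: "(\<lambda>_. a) \<in> smooth_funs M" by (simp add: smooth_funs_iff smooth_fun_on_const)
      have upd: "vs[i := w x] = map (\<lambda>s. s x) (?Vs[i := w])" for w
        using mapext[OF x *(2)] by (simp only: map_update)
      have z: "\<zeta> x (vs[i := w x]) = lie_form_value p \<eta> (?Vs[i := w]) x" if "w \<in> smooth_sections M E" for w
        by (rule \<zeta>v[OF x _ set_list_update_sections[OF Vs(1) that] upd]) (simp add: *(1))
      have "\<zeta> x (vs[i := sec_mult M E (\<lambda>_. a) (ext x u) x]) = a * \<zeta> x (vs[i := ext x u x])"
        unfolding z[OF u(1)] z[OF sec_mult_section[OF c u(1)]]
        by (rule lie_form_value_mult[OF \<eta> Vs *(3) c u(1) x])
      then show ?case using x u by (simp add: sec_mult_def)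
    next
      case (4 vs i j)
      then have *: "length vs = p" "set vs \<subseteq> fibre E x" "i < j" "j < p" "vs ! i = vs ! j" by auto
      have "lie_form_value p \<eta> (map (ext x) vs) x = 0"
        using * by (intro lie_form_value_alternating[OF \<eta> exts[OF x *(2)] _ *(3,4) _ x]) auto
      then show ?case by (simp add: \<zeta>_def)
    qed
  next
    fix Vs assume Vs: "set Vs \<subseteq> smooth_sections M E" "length Vs = p"
    show "smooth_fun_on M (pts M) (\<lambda>x. \<zeta> x (map (\<lambda>s. s x) Vs))"
      by (rule smooth_fun_on_cong[OF lie_form_value_smooth[OF \<eta> Vs]]) (rule val[OF Vs(2,1), symmetric])
  qed (auto simp: \<zeta>_def)
  then show ?thesis using val by blast
qed

text \<open>Every list of vectors over a point is the list of values of global sections; on all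
  other lists both sides are 0 by convention.\<close>

lemma forms_eqI:
  assumes "\<zeta> \<in> forms M E p" "\<xi> \<in> forms M E p"
    and eq: "\<And>Vs x. length Vs = p \<Longrightarrow> set Vs \<subseteq> smooth_sections M E \<Longrightarrow> x \<in> pts M \<Longrightarrow>
      \<zeta> x (map (\<lambda>s. s x) Vs) = \<xi> x (map (\<lambda>s. s x) Vs)"
  shows "\<zeta> = \<xi>"
proof (intro ext)
  fix x vs
  show "\<zeta> x vs = \<xi> x vs"
  proof (cases "x \<in> pts M \<and> length vs = p \<and> set vs \<subseteq> fibre E x")
    case True
    then have "\<forall>v\<in>set vs. \<exists>s\<in>smooth_sections M E. s x = v" using section_through by blast
    then obtain S where S: "\<And>v. v \<in> set vs \<Longrightarrow> S v \<in> smooth_sections M E \<and> S v x = v" by metis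
    then have "map (\<lambda>s. s x) (map S vs) = vs" by (induction vs) auto
    moreover have "set (map S vs) \<subseteq> smooth_sections M E" using S by auto
    ultimately show ?thesis using eq[of "map S vs" x] True by simp
  next
    case False
    then show ?thesis
    proof (cases "x \<in> pts M")
      case True
      then show ?thesis
        using alt_forms_eq_0[OF form_alt[OF assms(1) True]] alt_forms_eq_0[OF form_alt[OF assms(2) True]] False
        by auto
    next
      case False
      then show ?thesis using assms(1,2) unfolding forms_def by simp
    qed
  qed
qed

text \<open>Existence and uniqueness resolve the description operator in the definition.\<close>

lemma lie_deriv_form:
  assumes \<eta>: "\<eta> \<in> forms M E p"
  shows "lie_deriv_form M E \<rho> br V p \<eta> \<in> forms M E p"
    and "length Vs = p \<Longrightarrow> set Vs \<subseteq> smooth_sections M E \<Longrightarrow> x \<in> pts M \<Longrightarrow>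
      lie_deriv_form M E \<rho> br V p \<eta> x (map (\<lambda>s. s x) Vs) = lie_form_value p \<eta> Vs x"
proof -
  obtain \<zeta> where \<zeta>: "\<zeta> \<in> forms M E p" "\<forall>Vs. length Vs = p \<and> set Vs \<subseteq> smooth_sections M E \<longrightarrow>
    (\<forall>x\<in>pts M. \<zeta> x (map (\<lambda>s. s x) Vs) = lie_form_value p \<eta> Vs x)"
    using lie_form_exists[OF \<eta>] by blast
  have *: "lie_deriv_form M E \<rho> br V p \<eta> = \<zeta>"
    unfolding lie_deriv_form_def lie_form_value_def[symmetric]
  proof (rule the_equality)
    fix \<xi> assume \<xi>: "\<xi> \<in> forms M E p \<and> (\<forall>Vs. length Vs = p \<and> set Vs \<subseteq> smooth_sections M E \<longrightarrow>
      (\<forall>x\<in>pts M. \<xi> x (map (\<lambda>s. s x) Vs) = lie_form_value p \<eta> Vs x))"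
    show "\<xi> = \<zeta>" by (rule forms_eqI) (use \<xi> \<zeta> in auto)
  qed (use \<zeta> in blast)
  show "lie_deriv_form M E \<rho> br V p \<eta> \<in> forms M E p" using * \<zeta> by simp
  show "lie_deriv_form M E \<rho> br V p \<eta> x (map (\<lambda>s. s x) Vs) = lie_form_value p \<eta> Vs x"
    if "length Vs = p" "set Vs \<subseteq> smooth_sections M E" "x \<in> pts M"
    using * \<zeta>(2) that by simp
qed

end

section \<open>Multivectors\<close>

lemma ext_power_eq_0:
  assumes "T \<in> ext_power E x p" "\<eta> \<notin> alt_forms E x p"
  shows "T \<eta> = 0"
proof -
  obtain m :: nat and c w where w: "\<forall>k<m. length (w k) = p \<and> set (w k) \<subseteq> fibre E x"
    and T: "T = (\<lambda>\<eta>. \<Sum>k<m. c k * wedge E x (w k) \<eta>)"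
    using assms(1) unfolding ext_power_def by blast
  have "wedge E x (w k) \<eta> = 0" if "k < m" for k using w that assms(2) by (simp add: wedge_def)
  then show ?thesis by (simp add: T)
qed

text \<open>Sums over multi-indices are reindexed by an initial segment of the naturals, the shape
  demanded by \<open>ext_power\<close>.\<close>

lemma ext_power_sum:
  assumes "finite K" and w: "\<And>I. I \<in> K \<Longrightarrow> length (w I) = p \<and> set (w I) \<subseteq> fibre E x"
  shows "(\<lambda>\<eta>. \<Sum>I\<in>K. c I * wedge E x (w I) \<eta>) \<in> ext_power E x p"
proof -
  obtain h where h: "bij_betw h {0..<card K} K" using ex_bij_betw_nat_finite[OF assms(1)] by blast
  have "(\<Sum>I\<in>K. c I * wedge E x (w I) \<eta>) = (\<Sum>k<card K. c (h k) * wedge E x (w (h k)) \<eta>)" for \<eta>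
    using sum.reindex_bij_betw[OF h, of "\<lambda>I. c I * wedge E x (w I) \<eta>"] by (simp add: atLeast0LessThan)
  moreover have "\<forall>k<card K. length (w (h k)) = p \<and> set (w (h k)) \<subseteq> fibre E x"
    using bij_betwE[OF h] w by auto
  ultimately show ?thesis unfolding ext_power_def
    by (intro CollectI exI[of _ "card K"] exI[of _ "\<lambda>k. c (h k)"] exI[of _ "\<lambda>k. w (h k)"]) simp
qed

lemma pairing_add: "pairing \<eta> (\<lambda>x \<eta>. P x \<eta> + Q x \<eta>) = (\<lambda>x. pairing \<eta> P x + pairing \<eta> Q x)"
  and pairing_scale: "pairing \<eta> (\<lambda>x \<eta>. c * P x \<eta>) = (\<lambda>x. c * pairing \<eta> P x)"
  by (simp_all add: pairing_def fun_eq_iff)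

context smooth_vb
begin

text \<open>Membership in the exterior power of each fibre follows from the local representations,
  because the trivialisations cover the manifold.\<close>

lemma multivectorI:
  assumes out: "\<And>x. x \<notin> pts M \<Longrightarrow> P x = (\<lambda>_. 0)"
    and repr: "\<And>U \<Psi>. (U, \<Psi>) \<in> trivs E \<Longrightarrow> \<exists>c.
      (\<forall>I \<in> multi_indices (vrank E) p. smooth_fun_on M U (c I)) \<and>
      (\<forall>x \<in> U. P x = (\<lambda>\<eta>. \<Sum>I \<in> multi_indices (vrank E) p. c I x * wedge E x (map (frame E \<Psi> x) I) \<eta>))"
  shows "P \<in> multivectors M E p"
proof -
  have "P x \<in> ext_power E x p" if x: "x \<in> pts M" for x
  proof -
    obtain U \<Psi> where t: "(U, \<Psi>) \<in> trivs E" "x \<in> U" using triv_around[OF x] .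
    from repr[OF t(1)] obtain c where
      "P x = (\<lambda>\<eta>. \<Sum>I \<in> multi_indices (vrank E) p. c I x * wedge E x (map (frame E \<Psi> x) I) \<eta>)"
      using t(2) by blast
    moreover have "(\<lambda>\<eta>. \<Sum>I \<in> multi_indices (vrank E) p. c I x * wedge E x (map (frame E \<Psi> x) I) \<eta>)
        \<in> ext_power E x p"
    proof (rule ext_power_sum[OF finite_multi_indices])
      fix I assume "I \<in> multi_indices (vrank E) p"
      then show "length (map (frame E \<Psi> x) I) = p \<and> set (map (frame E \<Psi> x) I) \<subseteq> fibre E x"
        using frames_fibre[OF t, of I] by (simp add: multi_indices_def)
    qed
    ultimately show ?thesis by simp
  qed
  then show ?thesis using out repr unfolding multivectors_def by auto
qed

lemma multivector_repr:
  assumes "P \<in> multivectors M E p" "(U, \<Psi>) \<in> trivs E"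
  shows "\<exists>c. (\<forall>I \<in> multi_indices (vrank E) p. smooth_fun_on M U (c I)) \<and>
      (\<forall>x \<in> U. P x = (\<lambda>\<eta>. \<Sum>I \<in> multi_indices (vrank E) p. c I x * wedge E x (map (frame E \<Psi> x) I) \<eta>))"
  using assms unfolding multivectors_def by fast

lemma multivector_outside: "P \<in> multivectors M E p \<Longrightarrow> x \<notin> pts M \<Longrightarrow> P x = (\<lambda>_. 0)"
  unfolding multivectors_def by blast

lemma multivector_ext_power: "P \<in> multivectors M E p \<Longrightarrow> x \<in> pts M \<Longrightarrow> P x \<in> ext_power E x p"
  unfolding multivectors_def by blast

lemma multivector_zero: "(\<lambda>x \<eta>. 0) \<in> multivectors M E p"
proof (rule multivectorI)
  fix U \<Psi> assume "(U, \<Psi>) \<in> trivs E"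
  then show "\<exists>c. (\<forall>I \<in> multi_indices (vrank E) p. smooth_fun_on M U (c I)) \<and>
    (\<forall>x \<in> U. (\<lambda>\<eta>. 0) = (\<lambda>\<eta>. \<Sum>I \<in> multi_indices (vrank E) p. c I x * wedge E x (map (frame E \<Psi> x) I) \<eta>))"
    using triv_openin by (intro exI[of _ "\<lambda>I x. 0"]) (simp add: smooth_fun_on_const)
qed simp

lemma multivector_add:
  assumes "P \<in> multivectors M E p" "Q \<in> multivectors M E p"
  shows "(\<lambda>x \<eta>. P x \<eta> + Q x \<eta>) \<in> multivectors M E p"
proof (rule multivectorI)
  fix U \<Psi> assume t: "(U, \<Psi>) \<in> trivs E"
  obtain c where c: "\<forall>I \<in> multi_indices (vrank E) p. smooth_fun_on M U (c I)"
    "\<forall>x \<in> U. P x = (\<lambda>\<eta>. \<Sum>I \<in> multi_indices (vrank E) p. c I x * wedge E x (map (frame E \<Psi> x) I) \<eta>)"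
    using multivector_repr[OF assms(1) t] by (elim exE conjE)
  obtain d where d: "\<forall>I \<in> multi_indices (vrank E) p. smooth_fun_on M U (d I)"
    "\<forall>x \<in> U. Q x = (\<lambda>\<eta>. \<Sum>I \<in> multi_indices (vrank E) p. d I x * wedge E x (map (frame E \<Psi> x) I) \<eta>)"
    using multivector_repr[OF assms(2) t] by (elim exE conjE)
  show "\<exists>c. (\<forall>I \<in> multi_indices (vrank E) p. smooth_fun_on M U (c I)) \<and>
    (\<forall>x \<in> U. (\<lambda>\<eta>. P x \<eta> + Q x \<eta>) = (\<lambda>\<eta>. \<Sum>I \<in> multi_indices (vrank E) p. c I x * wedge E x (map (frame E \<Psi> x) I) \<eta>))"
    using c d by (intro exI[of _ "\<lambda>I x. c I x + d I x"])
      (simp add: smooth_fun_on_add sum.distrib[symmetric] distrib_right)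
qed (use assms multivector_outside in simp)

lemma multivector_scale:
  assumes "P \<in> multivectors M E p"
  shows "(\<lambda>x \<eta>. a * P x \<eta>) \<in> multivectors M E p"
proof (rule multivectorI)
  fix U \<Psi> assume t: "(U, \<Psi>) \<in> trivs E"
  obtain c where c: "\<forall>I \<in> multi_indices (vrank E) p. smooth_fun_on M U (c I)"
    "\<forall>x \<in> U. P x = (\<lambda>\<eta>. \<Sum>I \<in> multi_indices (vrank E) p. c I x * wedge E x (map (frame E \<Psi> x) I) \<eta>)"
    using multivector_repr[OF assms t] by (elim exE conjE)
  show "\<exists>c. (\<forall>I \<in> multi_indices (vrank E) p. smooth_fun_on M U (c I)) \<and>
    (\<forall>x \<in> U. (\<lambda>\<eta>. a * P x \<eta>) = (\<lambda>\<eta>. \<Sum>I \<in> multi_indices (vrank E) p. c I x * wedge E x (map (frame E \<Psi> x) I) \<eta>))"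
    using c smooth_fun_on_const[OF triv_openin[OF t]] by (intro exI[of _ "\<lambda>I x. a * c I x"])
      (simp add: smooth_fun_on_mult sum_distrib_left mult.assoc)
qed (use assms multivector_outside in simp)

lemma pairing_repr:
  assumes t: "(U, \<Psi>) \<in> trivs E" "x \<in> U"
    and P: "P x = (\<lambda>\<eta>. \<Sum>I \<in> multi_indices (vrank E) p. c I * wedge E x (map (frame E \<Psi> x) I) \<eta>)"
    and \<eta>: "\<eta> \<in> forms M E p"
  shows "pairing \<eta> P x = (\<Sum>I \<in> multi_indices (vrank E) p. c I * \<eta> x (map (frame E \<Psi> x) I))"
  unfolding pairing_def P using form_alt[OF \<eta> triv_pts[OF t]]
  by (intro sum.cong) (simp_all add: wedge_def multi_indices_def)

lemma frame_coefficients_smooth: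
  assumes "\<eta> \<in> forms M E p" "(U, \<Psi>) \<in> trivs E" "I \<in> multi_indices (vrank E) p"
  shows "smooth_fun_on M U (\<lambda>x. \<eta> x (map (frame E \<Psi> x) I))"
  using assms(3) by (intro form_on_frame_smooth[OF assms(1,2)]) (simp_all add: multi_indices_def)

lemma pairing_smooth:
  assumes \<eta>: "\<eta> \<in> forms M E p" and P: "P \<in> multivectors M E p"
  shows "smooth_fun_on M (pts M) (pairing \<eta> P)"
proof (rule smooth_fun_on_local)
  fix x assume x: "x \<in> pts M"
  obtain U \<Psi> where t: "(U, \<Psi>) \<in> trivs E" "x \<in> U" using triv_around[OF x] .
  obtain c where c: "\<forall>I \<in> multi_indices (vrank E) p. smooth_fun_on M U (c I)"
    "\<forall>x \<in> U. P x = (\<lambda>\<eta>. \<Sum>I \<in> multi_indices (vrank E) p. c I x * wedge E x (map (frame E \<Psi> x) I) \<eta>)"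
    using multivector_repr[OF P t(1)] by (elim exE conjE)
  have "smooth_fun_on M U (\<lambda>x. \<Sum>I \<in> multi_indices (vrank E) p. c I x * \<eta> x (map (frame E \<Psi> x) I))"
    using c(1) by (intro smooth_fun_on_sum[OF triv_openin[OF t(1)]] smooth_fun_on_mult
        frame_coefficients_smooth[OF \<eta> t(1)]) simp_all
  then have "smooth_fun_on M U (pairing \<eta> P)"
    by (rule smooth_fun_on_cong) (rule pairing_repr[OF t(1) _ c(2)[rule_format] \<eta>, symmetric])
  then show "\<exists>W'. x \<in> W' \<and> W' \<subseteq> pts M \<and> smooth_fun_on M W' (pairing \<eta> P)"
    using t triv_pts by blast
qed

text \<open>The values of a multivector are functionals on alternating forms, and each such form
  extends to a global one by \<open>form_through\<close>. Off the alternating forms both functionals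
  vanish.\<close>

lemma multivector_eqI:
  assumes P: "P \<in> multivectors M E p" and Q: "Q \<in> multivectors M E p"
    and eq: "\<And>\<eta> x. \<eta> \<in> forms M E p \<Longrightarrow> x \<in> pts M \<Longrightarrow> pairing \<eta> P x = pairing \<eta> Q x"
  shows "P = Q"
proof (intro ext)
  fix x \<eta>
  show "P x \<eta> = Q x \<eta>"
  proof (cases "x \<in> pts M")
    case x: True
    show ?thesis
    proof (cases "\<eta> \<in> alt_forms E x p")
      case True
      then obtain \<omega> where "\<omega> \<in> forms M E p" "\<omega> x = \<eta>" using form_through[OF x] by blast
      then show ?thesis using eq[OF _ x, of \<omega>] by (simp add: pairing_def)
    next
      case False
      then show ?thesis
        using ext_power_eq_0[OF multivector_ext_power[OF P x]] ext_power_eq_0[OF multivector_ext_power[OF Q x]] by simp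
    qed
  next
    case False
    then show ?thesis using multivector_outside[OF P] multivector_outside[OF Q] by simp
  qed
qed

section \<open>Degree zero: multivectors as functions\<close>

lemma multi_indices_0: "multi_indices r 0 = {[]}"
  by (auto simp: multi_indices_def)

lemma fun_mv_multivector:
  assumes f: "f \<in> smooth_funs M"
  shows "fun_mv M E f \<in> multivectors M E 0"
proof (rule multivectorI)
  fix U \<Psi> assume t: "(U, \<Psi>) \<in> trivs E"
  have "smooth_fun_on M U f"
    using f smooth_fun_on_subset[OF _ triv_openin[OF t] openin_subset[OF triv_openin[OF t]]]
    by (simp add: smooth_funs_iff)
  then show "\<exists>c. (\<forall>I \<in> multi_indices (vrank E) 0. smooth_fun_on M U (c I)) \<and>
    (\<forall>x \<in> U. fun_mv M E f x = (\<lambda>\<eta>. \<Sum>I \<in> multi_indices (vrank E) 0. c I x * wedge E x (map (frame E \<Psi> x) I) \<eta>))"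
    using triv_pts[OF t] by (intro exI[of _ "\<lambda>I. f"]) (simp add: multi_indices_0 fun_mv_def)
qed (simp add: fun_mv_def)

text \<open>Ensures that the clause on functions determines an endomorphism in the whole of degree
  0.\<close>

lemma multivector_0_fun:
  assumes P: "P \<in> multivectors M E 0"
  shows "\<exists>f\<in>smooth_funs M. P = fun_mv M E f"
proof -
  \<comment> \<open>The unit 0-form. Evaluation at it reads off the coefficient of the empty
    product, in every trivialisation alike.\<close>
  define u :: "'e list \<Rightarrow> real" where "u = (\<lambda>vs. if vs = [] then 1 else 0)"
  have u: "wedge E x [] u = 1" for x by (simp add: wedge_def alt_forms_def u_def)
  let ?f = "\<lambda>x. P x u"
  have repr: "\<exists>c. smooth_fun_on M U c \<and> (\<forall>x\<in>U. P x = (\<lambda>\<eta>. c x * wedge E x [] \<eta>))"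
    if t: "(U, \<Psi>) \<in> trivs E" for U \<Psi>
    using multivector_repr[OF P t] by (auto simp: multi_indices_0)
  have "smooth_fun_on M (pts M) ?f"
  proof (rule smooth_fun_on_local)
    fix x assume x: "x \<in> pts M"
    obtain U \<Psi> where t: "(U, \<Psi>) \<in> trivs E" "x \<in> U" using triv_around[OF x] .
    obtain c where "smooth_fun_on M U c" "\<forall>x\<in>U. P x = (\<lambda>\<eta>. c x * wedge E x [] \<eta>)" using repr[OF t(1)] by blast
    then have "smooth_fun_on M U ?f" using u smooth_fun_on_cong[of U c ?f] by simp
    then show "\<exists>W'. x \<in> W' \<and> W' \<subseteq> pts M \<and> smooth_fun_on M W' ?f" using t triv_pts by blast
  qed
  moreover have "P = fun_mv M E ?f"
  proof (intro ext)
    fix x \<eta>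
    show "P x \<eta> = fun_mv M E ?f x \<eta>"
    proof (cases "x \<in> pts M")
      case True
      obtain U \<Psi> where t: "(U, \<Psi>) \<in> trivs E" "x \<in> U" using triv_around[OF True] .
      obtain c where "\<forall>x\<in>U. P x = (\<lambda>\<eta>. c x * wedge E x [] \<eta>)" using repr[OF t(1)] by blast
      then have "P x = (\<lambda>\<eta>. c x * wedge E x [] \<eta>)" using t(2) by blast
      then show ?thesis using True u by (simp add: fun_mv_def)
    next
      case False
      then show ?thesis by (simp add: multivector_outside[OF P] fun_mv_def)
    qed
  qed
  ultimately show ?thesis by (intro bexI[of _ ?f]) (simp_all add: smooth_funs_iff)
qed

end

section \<open>The Lie derivative of multivectors\<close>

text \<open>A linear combination of combinations of the same \<open>h J\<close> is collected into
  one. Applied repeatedly it pulls the values of the form out of nested sums.\<close>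

lemma sum_swap_linear:
  fixes a :: "'i \<Rightarrow> real"
  shows "(\<Sum>i\<in>S. a i * (\<Sum>J\<in>T. f i J * h J)) = (\<Sum>J\<in>T. (\<Sum>i\<in>S. a i * f i J) * h J)"
  unfolding sum_distrib_left sum_distrib_right mult.assoc by (rule sum.swap)

context lie_algebroid_section
begin

text \<open>The brackets of \<open>V\<close> with a local frame make sense because the bracket is local.\<close>

lemma bracket_of_frame:
  assumes t: "(U, \<Psi>) \<in> trivs E"
  shows "\<exists>B. (\<forall>i<vrank E. \<forall>j. smooth_fun_on M U (\<lambda>x. \<Psi> (B i x) j)) \<and>
    (\<forall>i<vrank E. \<forall>s\<in>smooth_sections M E. \<forall>N. openin (mtop M) N \<longrightarrow> N \<subseteq> U \<longrightarrow>
      (\<forall>y\<in>N. s y = frame E \<Psi> y i) \<longrightarrow> (\<forall>x\<in>N. br V s x = B i x))"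
proof -
  define Q where "Q i x s \<longleftrightarrow> s \<in> smooth_sections M E \<and>
    (\<exists>N. openin (mtop M) N \<and> x \<in> N \<and> (\<forall>y\<in>N. s y = frame E \<Psi> y i))" for i x s
  \<comment> \<open>The choice is made anew at each point; two sections that agree with the frame
    near the point have the same bracket there.\<close>
  define B where "B i x = br V (SOME s. Q i x s) x" for i x
  have B: "br V s x = B i x" if "s \<in> smooth_sections M E" "openin (mtop M) N" "x \<in> N"
    "\<forall>y\<in>N. s y = frame E \<Psi> y i" for s N i x
  proof -
    have "Q i x s" unfolding Q_def using that by blast
    then have "Q i x (SOME s. Q i x s)" by (rule someI[of "Q i x"])
    then obtain N' where s': "(SOME s. Q i x s) \<in> smooth_sections M E" and N': "openin (mtop M) N'" "x \<in> N'"
      "\<forall>y\<in>N'. (SOME s. Q i x s) y = frame E \<Psi> y i" unfolding Q_def by blast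
    have "openin (mtop M) (N \<inter> N')" using that(2) N'(1) by (rule openin_Int)
    then show ?thesis unfolding B_def
      by (rule bracket_local[OF that(1) s']) (use that N' in auto)
  qed
  have "smooth_fun_on M U (\<lambda>x. \<Psi> (B i x) j)" if i: "i < vrank E" for i j
  proof (rule smooth_fun_on_local)
    fix x assume x: "x \<in> U"
    obtain N e where N: "openin (mtop M) N" "x \<in> N" "N \<subseteq> U"
      and e: "\<forall>i<vrank E. e i \<in> smooth_sections M E"
      and eN: "\<forall>i<vrank E. \<forall>y\<in>N. e i y = frame E \<Psi> y i"
      using local_frame[OF t x] by (elim exE conjE)
    have ei: "e i \<in> smooth_sections M E" "\<forall>y\<in>N. e i y = frame E \<Psi> y i" using e eN i by auto
    from smooth_fun_on_subset[OF section_components_smooth[OF bracket_section[OF ei(1)] t] N(1,3)]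
    have "smooth_fun_on M N (\<lambda>x. \<Psi> (B i x) j)"
      by (rule smooth_fun_on_cong) (simp add: B[OF ei(1) N(1) _ ei(2)])
    then show "\<exists>W'. x \<in> W' \<and> W' \<subseteq> U \<and> smooth_fun_on M W' (\<lambda>x. \<Psi> (B i x) j)" using N by blast
  qed
  then show ?thesis using B by (intro exI[of _ B] conjI allI impI ballI) blast+
qed

text \<open>
  The derivatives along \<open>V\<close> of the coefficients \<open>\<eta>(e\<^sub>I)\<close> cancel, so that the right-hand side of
  the defining formula depends only on the value of \<open>\<eta>\<close> at the point.
\<close>

lemma lie_multivector_local:
  assumes P: "P \<in> multivectors M E p" and t: "(U, \<Psi>) \<in> trivs E"
  shows "\<exists>d. (\<forall>J\<in>multi_indices (vrank E) p. smooth_fun_on M U (d J)) \<and>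
    (\<forall>\<eta>\<in>forms M E p. \<forall>x\<in>U.
      lie_deriv_fun X (pairing \<eta> P) x - pairing (lie_deriv_form M E \<rho> br V p \<eta>) P x =
      (\<Sum>J\<in>multi_indices (vrank E) p. d J x * \<eta> x (map (frame E \<Psi> x) J)))"
proof -
  let ?m = "multi_indices (vrank E) p"
  have U: "openin (mtop M) U" by (rule triv_openin[OF t])
  obtain c where c: "\<forall>I \<in> ?m. smooth_fun_on M U (c I)"
    "\<forall>x \<in> U. P x = (\<lambda>\<eta>. \<Sum>I \<in> ?m. c I x * wedge E x (map (frame E \<Psi> x) I) \<eta>)"
    using multivector_repr[OF P t] by (elim exE conjE)
  obtain B where Bs: "\<forall>i<vrank E. \<forall>j. smooth_fun_on M U (\<lambda>x. \<Psi> (B i x) j)"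
    and B: "\<forall>i<vrank E. \<forall>s\<in>smooth_sections M E. \<forall>N. openin (mtop M) N \<longrightarrow> N \<subseteq> U \<longrightarrow>
      (\<forall>y\<in>N. s y = frame E \<Psi> y i) \<longrightarrow> (\<forall>x\<in>N. br V s x = B i x)"
    using bracket_of_frame[OF t] by (elim exE conjE)
  obtain \<sigma> where \<sigma>: "\<forall>I. set I \<subseteq> {..<vrank E} \<longrightarrow> length I = p \<longrightarrow>
    (\<forall>h. alternating h \<longrightarrow> h I = (\<Sum>J\<in>?m. \<sigma> I J * h J))"
    using alternating_expansion by blast
  \<comment> \<open>The numbers \<sigma> sort the index list in which position \<open>k\<close> of
    \<open>I\<close> is replaced by \<open>j\<close>. The factor 1 gives the sum over
    \<open>k\<close> the shape of \<open>sum_swap_linear\<close>.\<close>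
  define d where "d J x = lie_deriv_fun X (c J) x +
    (\<Sum>I\<in>?m. c I x * (\<Sum>k<p. 1 * (\<Sum>j<vrank E. \<Psi> (B (I ! k) x) j * \<sigma> (I[k := j]) J)))" for J x
  have m: "set I \<subseteq> {..<vrank E}" "length I = p" if "I \<in> ?m" for I
    using that by (auto simp: multi_indices_def)
  have mk: "I ! k < vrank E" if "I \<in> ?m" "k < p" for I k
  proof -
    have "I ! k \<in> set I" using m(2)[OF that(1)] that(2) by simp
    then show ?thesis using m(1)[OF that(1)] by blast
  qed
  have "smooth_fun_on M U (d J)" if J: "J \<in> ?m" for J
    unfolding d_def[abs_def]
    using c(1) J Bs mk
    by (intro smooth_fun_on_add lie_deriv_fun_smooth smooth_fun_on_sum[OF U] smooth_fun_on_mult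
        smooth_fun_on_const[OF U]) simp_all
  moreover have "lie_deriv_fun X (pairing \<eta> P) x - pairing (lie_deriv_form M E \<rho> br V p \<eta>) P x =
      (\<Sum>J\<in>?m. d J x * \<eta> x (map (frame E \<Psi> x) J))" if \<eta>: "\<eta> \<in> forms M E p" and x: "x \<in> U" for \<eta> x
  proof -
    let ?g = "\<lambda>I y. \<eta> y (map (frame E \<Psi> y) I)"
    let ?L = "lie_deriv_form M E \<rho> br V p \<eta>"
    have xM: "x \<in> pts M" by (rule triv_pts[OF t x])
    obtain N e where N: "openin (mtop M) N" "x \<in> N" "N \<subseteq> U"
      and e: "\<forall>i<vrank E. e i \<in> smooth_sections M E"
      and eN: "\<forall>i<vrank E. \<forall>y\<in>N. e i y = frame E \<Psi> y i"
      using local_frame[OF t x] by (elim exE conjE)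
    have eI: "map (\<lambda>s. s y) (map e I) = map (frame E \<Psi> y) I" if "set I \<subseteq> {..<vrank E}" "y \<in> N" for I y
      using that eN by auto
    have g: "smooth_fun_on M U (?g I)" if "I \<in> ?m" for I
      by (rule frame_coefficients_smooth[OF \<eta> t that])
    have "lie_deriv_fun X (pairing \<eta> P) x = lie_deriv_fun X (\<lambda>y. \<Sum>I\<in>?m. c I y * ?g I y) x"
      by (rule lie_deriv_fun_cong[OF smooth_fun_on_subset[OF pairing_smooth[OF \<eta> P] U openin_subset[OF U]] x])
        (rule pairing_repr[OF t _ c(2)[rule_format] \<eta>])
    also have "\<dots> = (\<Sum>I\<in>?m. lie_deriv_fun X (\<lambda>y. c I y * ?g I y) x)"
      using c(1) g by (intro lie_deriv_fun_sum[OF U x] smooth_fun_on_mult) simp_all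
    also have "\<dots> = (\<Sum>I\<in>?m. c I x * lie_deriv_fun X (?g I) x + lie_deriv_fun X (c I) x * ?g I x)"
      using c(1) g x by (intro sum.cong refl lie_deriv_fun_mult) simp_all
    finally have 1: "lie_deriv_fun X (pairing \<eta> P) x =
      (\<Sum>I\<in>?m. c I x * lie_deriv_fun X (?g I) x + lie_deriv_fun X (c I) x * ?g I x)" .
    \<comment> \<open>The values of the Lie derivative are known on global sections. The sections
      \<open>e\<close> agree with the frame near \<open>x\<close>, which suffices for the derivative
      and for the brackets.\<close>
    have L: "?L x (map (frame E \<Psi> x) I) = lie_deriv_fun X (?g I) x -
        (\<Sum>k<p. \<eta> x ((map (frame E \<Psi> x) I)[k := B (I ! k) x]))" if I: "I \<in> ?m" for I
    proof -
      have es: "set (map e I) \<subseteq> smooth_sections M E" "length (map e I) = p" using e m[OF I] by auto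
      have "?L x (map (frame E \<Psi> x) I) = lie_form_value p \<eta> (map e I) x"
        using lie_deriv_form(2)[OF \<eta> es(2,1) xM] by (simp only: eI[OF m(1)[OF I] N(2)])
      moreover have "lie_deriv_fun X (\<lambda>y. \<eta> y (map (\<lambda>s. s y) (map e I))) x = lie_deriv_fun X (?g I) x"
        by (rule lie_deriv_fun_cong[OF smooth_fun_on_subset[OF form_on_sections_smooth[OF \<eta> es] N(1) openin_subset[OF N(1)]] N(2)])
          (simp only: eI[OF m(1)[OF I]])
      moreover have "map (\<lambda>s. s x) ((map e I)[k := br V (map e I ! k)]) = (map (frame E \<Psi> x) I)[k := B (I ! k) x]"
        if k: "k < p" for k
      proof -
        have "br V (e (I ! k)) x = B (I ! k) x"
          using B mk[OF I k] e eN N by blast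
        then show ?thesis
          using k m(2)[OF I] by (simp only: map_update eI[OF m(1)[OF I] N(2)] nth_map)
      qed
      ultimately show ?thesis unfolding lie_form_value_def by simp
    qed
    have expand: "\<eta> x ((map (frame E \<Psi> x) I)[k := B (I ! k) x]) =
        (\<Sum>J\<in>?m. (\<Sum>j<vrank E. \<Psi> (B (I ! k) x) j * \<sigma> (I[k := j]) J) * ?g J x)" if I: "I \<in> ?m" and k: "k < p" for I k
    proof -
      have Bf: "B (I ! k) x \<in> fibre E x"
      proof -
        have "br V (e (I ! k)) x = B (I ! k) x" using B mk[OF I k] e eN N by blast
        then show ?thesis using section_fibre[OF bracket_section xM, of "e (I ! k)"] e mk[OF I k] by simp
      qed
      have "\<eta> x ((map (frame E \<Psi> x) I)[k := B (I ! k) x]) =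
          (\<Sum>j<vrank E. \<Psi> (B (I ! k) x) j * \<eta> x ((map (frame E \<Psi> x) I)[k := frame E \<Psi> x j]))"
        using m[OF I] by (intro alt_forms_expand[OF t x form_alt[OF \<eta> xM] _ frames_fibre[OF t x] k Bf]) simp_all
      also have "\<dots> = (\<Sum>j<vrank E. \<Psi> (B (I ! k) x) j * (\<Sum>J\<in>?m. \<sigma> (I[k := j]) J * ?g J x))"
      proof (rule sum.cong[OF refl])
        fix j assume j: "j \<in> {..<vrank E}"
        \<comment> \<open>The expansion by \<sigma> requires a function on all index lists, hence
          the value 0 on inadmissible ones.\<close>
        let ?h = "\<lambda>I. if set I \<subseteq> {..<vrank E} \<and> length I = p then \<eta> x (map (frame E \<Psi> x) I) else 0"
        have Ij: "set (I[k := j]) \<subseteq> {..<vrank E}" "length (I[k := j]) = p"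
          using m[OF I] j by (simp_all add: set_list_update_fibre)
        have "alternating ?h"
          by (rule alternating_on_fibre[OF xM form_alt[OF \<eta> xM] frame_fibre[OF t x]])
        then have "?h (I[k := j]) = (\<Sum>J\<in>?m. \<sigma> (I[k := j]) J * ?h J)" using \<sigma> Ij by blast
        also have "\<dots> = (\<Sum>J\<in>?m. \<sigma> (I[k := j]) J * ?g J x)"
          by (rule sum.cong) (use m in auto)
        finally show "\<Psi> (B (I ! k) x) j * \<eta> x ((map (frame E \<Psi> x) I)[k := frame E \<Psi> x j]) =
            \<Psi> (B (I ! k) x) j * (\<Sum>J\<in>?m. \<sigma> (I[k := j]) J * ?g J x)"
          using Ij by (simp add: map_update)
      qed
      also have "\<dots> = (\<Sum>J\<in>?m. (\<Sum>j<vrank E. \<Psi> (B (I ! k) x) j * \<sigma> (I[k := j]) J) * ?g J x)"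
        by (rule sum_swap_linear)
      finally show ?thesis .
    qed
    have "pairing ?L P x = (\<Sum>I\<in>?m. c I x * ?L x (map (frame E \<Psi> x) I))"
      by (rule pairing_repr[OF t x _ lie_deriv_form(1)[OF \<eta>]]) (use c(2) x in blast)
    also have "\<dots> = (\<Sum>I\<in>?m. c I x * lie_deriv_fun X (?g I) x) -
        (\<Sum>I\<in>?m. c I x * (\<Sum>k<p. \<eta> x ((map (frame E \<Psi> x) I)[k := B (I ! k) x])))"
      unfolding sum_subtractf[symmetric] by (rule sum.cong) (simp_all add: L right_diff_distrib)
    finally have "lie_deriv_fun X (pairing \<eta> P) x - pairing ?L P x =
        (\<Sum>I\<in>?m. lie_deriv_fun X (c I) x * ?g I x) +
        (\<Sum>I\<in>?m. c I x * (\<Sum>k<p. \<eta> x ((map (frame E \<Psi> x) I)[k := B (I ! k) x])))"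
      using 1 by (simp add: sum.distrib)
    also have "(\<Sum>I\<in>?m. c I x * (\<Sum>k<p. \<eta> x ((map (frame E \<Psi> x) I)[k := B (I ! k) x]))) =
        (\<Sum>I\<in>?m. c I x * (\<Sum>k<p. 1 * (\<Sum>J\<in>?m. (\<Sum>j<vrank E. \<Psi> (B (I ! k) x) j * \<sigma> (I[k := j]) J) * ?g J x)))"
      by (intro sum.cong refl) (simp add: expand)
    also have "\<dots> = (\<Sum>J\<in>?m. (\<Sum>I\<in>?m. c I x * (\<Sum>k<p. 1 * (\<Sum>j<vrank E. \<Psi> (B (I ! k) x) j * \<sigma> (I[k := j]) J))) * ?g J x)"
      unfolding sum_swap_linear ..
    finally show ?thesis by (simp only: d_def distrib_right sum.distrib)
  qed
  ultimately show ?thesis by (intro exI[of _ d]) blast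
qed

text \<open>The defining formula read as a functional on alternating forms. The chosen global
  extension enters only through its value at \<open>x\<close>, as the expression in a frame
  shows.\<close>

definition lie_multivector :: "nat \<Rightarrow> ('e, 'm) multivector \<Rightarrow> ('e, 'm) multivector" where
  "lie_multivector p P x \<eta>\<^sub>0 =
     (if x \<in> pts M \<and> \<eta>\<^sub>0 \<in> alt_forms E x p then
        let \<eta> = (SOME \<eta>. \<eta> \<in> forms M E p \<and> \<eta> x = \<eta>\<^sub>0)
        in lie_deriv_fun X (pairing \<eta> P) x - pairing (lie_deriv_form M E \<rho> br V p \<eta>) P x
      else 0)"

text \<open>Whatever extension is chosen, the local formula returns only its value at
  \<open>x\<close>; this settles independence of the choice and gives smooth coefficients when
  \<open>d\<close> is smooth.\<close>

lemma lie_multivector_in_frame: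
  assumes t: "(U, \<Psi>) \<in> trivs E" "x \<in> U"
    and d: "\<forall>\<eta>\<in>forms M E p. \<forall>x\<in>U.
      lie_deriv_fun X (pairing \<eta> P) x - pairing (lie_deriv_form M E \<rho> br V p \<eta>) P x =
      (\<Sum>J\<in>multi_indices (vrank E) p. d J x * \<eta> x (map (frame E \<Psi> x) J))"
  shows "lie_multivector p P x =
    (\<lambda>\<eta>. \<Sum>J\<in>multi_indices (vrank E) p. d J x * wedge E x (map (frame E \<Psi> x) J) \<eta>)"
proof
  fix \<eta>\<^sub>0
  have xM: "x \<in> pts M" by (rule triv_pts[OF t])
  show "lie_multivector p P x \<eta>\<^sub>0 =
    (\<Sum>J\<in>multi_indices (vrank E) p. d J x * wedge E x (map (frame E \<Psi> x) J) \<eta>\<^sub>0)"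
  proof (cases "\<eta>\<^sub>0 \<in> alt_forms E x p")
    case True
    define \<eta> where "\<eta> = (SOME \<eta>. \<eta> \<in> forms M E p \<and> \<eta> x = \<eta>\<^sub>0)"
    have "\<exists>\<eta>. \<eta> \<in> forms M E p \<and> \<eta> x = \<eta>\<^sub>0" using form_through[OF xM True] by blast
    from someI_ex[OF this] have \<eta>: "\<eta> \<in> forms M E p \<and> \<eta> x = \<eta>\<^sub>0" unfolding \<eta>_def .
    have "lie_multivector p P x \<eta>\<^sub>0 = (\<Sum>J\<in>multi_indices (vrank E) p. d J x * \<eta> x (map (frame E \<Psi> x) J))"
      using d \<eta> t(2) xM True by (simp add: lie_multivector_def \<eta>_def[symmetric])
    also have "\<dots> = (\<Sum>J\<in>multi_indices (vrank E) p. d J x * wedge E x (map (frame E \<Psi> x) J) \<eta>\<^sub>0)"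
      using \<eta> True by (intro sum.cong) (simp_all add: wedge_def multi_indices_def)
    finally show ?thesis .
  next
    case False
    then have "wedge E x (map (frame E \<Psi> x) J) \<eta>\<^sub>0 = 0" if "J \<in> multi_indices (vrank E) p" for J
      using that by (simp add: wedge_def multi_indices_def)
    then show ?thesis using False by (simp add: lie_multivector_def)
  qed
qed

lemma lie_multivector_multivector:
  assumes P: "P \<in> multivectors M E p"
  shows "lie_multivector p P \<in> multivectors M E p"
proof (rule multivectorI)
  fix U \<Psi> assume t: "(U, \<Psi>) \<in> trivs E"
  obtain d where d: "\<forall>J\<in>multi_indices (vrank E) p. smooth_fun_on M U (d J)"
    "\<forall>\<eta>\<in>forms M E p. \<forall>x\<in>U.
      lie_deriv_fun X (pairing \<eta> P) x - pairing (lie_deriv_form M E \<rho> br V p \<eta>) P x =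
      (\<Sum>J\<in>multi_indices (vrank E) p. d J x * \<eta> x (map (frame E \<Psi> x) J))"
    using lie_multivector_local[OF P t] by (elim exE conjE)
  show "\<exists>c. (\<forall>I \<in> multi_indices (vrank E) p. smooth_fun_on M U (c I)) \<and>
    (\<forall>x \<in> U. lie_multivector p P x = (\<lambda>\<eta>. \<Sum>I \<in> multi_indices (vrank E) p. c I x * wedge E x (map (frame E \<Psi> x) I) \<eta>))"
    using d(1) lie_multivector_in_frame[OF t _ d(2)] by (intro exI[of _ d]) simp
qed (simp add: lie_multivector_def fun_eq_iff)

lemma pairing_lie_multivector:
  assumes P: "P \<in> multivectors M E p" and \<eta>: "\<eta> \<in> forms M E p" and x: "x \<in> pts M"
  shows "pairing \<eta> (lie_multivector p P) x =
    lie_deriv_fun X (pairing \<eta> P) x - pairing (lie_deriv_form M E \<rho> br V p \<eta>) P x"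
proof -
  obtain U \<Psi> where t: "(U, \<Psi>) \<in> trivs E" "x \<in> U" using triv_around[OF x] .
  obtain d where d: "\<forall>J\<in>multi_indices (vrank E) p. smooth_fun_on M U (d J)"
    "\<forall>\<eta>\<in>forms M E p. \<forall>x\<in>U.
      lie_deriv_fun X (pairing \<eta> P) x - pairing (lie_deriv_form M E \<rho> br V p \<eta>) P x =
      (\<Sum>J\<in>multi_indices (vrank E) p. d J x * \<eta> x (map (frame E \<Psi> x) J))"
    using lie_multivector_local[OF P t(1)] by (elim exE conjE)
  show ?thesis
    using pairing_repr[where c="\<lambda>J. d J x" and P="lie_multivector p P", OF t lie_multivector_in_frame[OF t d(2)] \<eta>]
      d(2) \<eta> t(2) by simp
qed

text \<open>Existence and uniqueness in one equivalence, in the form in which the characterisation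
  of the Lie derivative in degree \<open>p\<close> is asserted.\<close>

lemma lie_multivector_unique:
  assumes P: "P \<in> multivectors M E p" and Q: "Q \<in> multivectors M E p"
  shows "(\<forall>\<eta>\<in>forms M E p. \<forall>x\<in>pts M. pairing \<eta> Q x =
      lie_deriv_fun X (pairing \<eta> P) x - pairing (lie_deriv_form M E \<rho> br V p \<eta>) P x) \<longleftrightarrow>
    Q = lie_multivector p P"
  using multivector_eqI[OF Q lie_multivector_multivector[OF P]] pairing_lie_multivector[OF P] by auto

text \<open>Checked after pairing with a form, where the right-hand side of the formula is visibly
  additive in the multivector.\<close>

lemma lie_multivector_add:
  assumes P: "P \<in> multivectors M E p" and Q: "Q \<in> multivectors M E p"
  shows "lie_multivector p (\<lambda>x \<eta>. P x \<eta> + Q x \<eta>) =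
    (\<lambda>x \<eta>. lie_multivector p P x \<eta> + lie_multivector p Q x \<eta>)"
proof (rule multivector_eqI)
  show "lie_multivector p (\<lambda>x \<eta>. P x \<eta> + Q x \<eta>) \<in> multivectors M E p"
    by (rule lie_multivector_multivector[OF multivector_add[OF P Q]])
  show "(\<lambda>x \<eta>. lie_multivector p P x \<eta> + lie_multivector p Q x \<eta>) \<in> multivectors M E p"
    by (intro multivector_add lie_multivector_multivector P Q)
  fix \<eta> x assume \<eta>: "\<eta> \<in> forms M E p" and x: "x \<in> pts M"
  show "pairing \<eta> (lie_multivector p (\<lambda>x \<eta>. P x \<eta> + Q x \<eta>)) x =
      pairing \<eta> (\<lambda>x \<eta>. lie_multivector p P x \<eta> + lie_multivector p Q x \<eta>) x"
    unfolding pairing_lie_multivector[OF multivector_add[OF P Q] \<eta> x] pairing_add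
      lie_deriv_fun_add[OF pairing_smooth[OF \<eta> P] pairing_smooth[OF \<eta> Q] x]
      pairing_lie_multivector[OF P \<eta> x] pairing_lie_multivector[OF Q \<eta> x] by simp
qed

lemma lie_multivector_scale:
  assumes P: "P \<in> multivectors M E p"
  shows "lie_multivector p (\<lambda>x \<eta>. a * P x \<eta>) = (\<lambda>x \<eta>. a * lie_multivector p P x \<eta>)"
proof (rule multivector_eqI)
  show "lie_multivector p (\<lambda>x \<eta>. a * P x \<eta>) \<in> multivectors M E p"
    by (rule lie_multivector_multivector[OF multivector_scale[OF P]])
  show "(\<lambda>x \<eta>. a * lie_multivector p P x \<eta>) \<in> multivectors M E p"
    by (intro multivector_scale lie_multivector_multivector P)
  fix \<eta> x assume \<eta>: "\<eta> \<in> forms M E p" and x: "x \<in> pts M"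
  \<comment> \<open>The product rule with a constant factor, whose derivative is 0.\<close>
  have "lie_deriv_fun X (\<lambda>y. a * pairing \<eta> P y) x = a * lie_deriv_fun X (pairing \<eta> P) x"
    using lie_deriv_fun_mult[OF smooth_fun_on_const[OF openin_topspace, of a] pairing_smooth[OF \<eta> P] x]
    by (simp add: lie_deriv_fun_const[OF x])
  then show "pairing \<eta> (lie_multivector p (\<lambda>x \<eta>. a * P x \<eta>)) x = pairing \<eta> (\<lambda>x \<eta>. a * lie_multivector p P x \<eta>) x"
    unfolding pairing_lie_multivector[OF multivector_scale[OF P] \<eta> x] pairing_scale
      pairing_lie_multivector[OF P \<eta> x] by (simp add: right_diff_distrib)
qed

text \<open>Keeps the families of Lie derivatives finite and homogeneous elements
  homogeneous.\<close>

lemma lie_multivector_zero: "lie_multivector p (\<lambda>x \<eta>. 0) = (\<lambda>x \<eta>. 0)"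
  using lie_multivector_scale[OF multivector_zero, of p 0] by simp

text \<open>The pairing is a product of \<open>f\<close> with the value of the 0-form, and the
  subtracted pairing removes the summand in which the 0-form is differentiated.\<close>

lemma lie_multivector_fun:
  assumes f: "f \<in> smooth_funs M"
  shows "lie_multivector 0 (fun_mv M E f) = fun_mv M E (lie_deriv_fun X f)"
proof -
  have Xf: "lie_deriv_fun X f \<in> smooth_funs M" by (rule lie_deriv_fun_in_smooth_funs[OF f])
  have pf: "pairing \<eta> (fun_mv M E g) x = g x * \<eta> x []" if "\<eta> \<in> forms M E 0" "x \<in> pts M" for \<eta> g x
    using form_alt[OF that] that(2) by (simp add: pairing_def fun_mv_def wedge_def)
  have "pairing \<eta> (fun_mv M E (lie_deriv_fun X f)) x =
      lie_deriv_fun X (pairing \<eta> (fun_mv M E f)) x - pairing (lie_deriv_form M E \<rho> br V 0 \<eta>) (fun_mv M E f) x"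
    if \<eta>: "\<eta> \<in> forms M E 0" and x: "x \<in> pts M" for \<eta> x
  proof -
    have h: "smooth_fun_on M (pts M) (\<lambda>y. \<eta> y [])"
      using form_on_sections_smooth[OF \<eta>, of "[]"] by simp
    have "lie_deriv_fun X (pairing \<eta> (fun_mv M E f)) x = lie_deriv_fun X (\<lambda>y. f y * \<eta> y []) x"
      by (rule lie_deriv_fun_cong[OF pairing_smooth[OF \<eta> fun_mv_multivector[OF f]] x]) (rule pf[OF \<eta>])
    also have "\<dots> = f x * lie_deriv_fun X (\<lambda>y. \<eta> y []) x + lie_deriv_fun X f x * \<eta> x []"
      using f by (intro lie_deriv_fun_mult[OF _ h x]) (simp add: smooth_funs_iff)
    moreover have "lie_deriv_form M E \<rho> br V 0 \<eta> x [] = lie_deriv_fun X (\<lambda>y. \<eta> y []) x"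
      using lie_deriv_form(2)[OF \<eta> _ _ x, of "[]"] by (simp add: lie_form_value_def)
    ultimately show ?thesis
      using pf[OF \<eta> x] pf[OF lie_deriv_form(1)[OF \<eta>] x] by simp
  qed
  then show ?thesis
    using lie_multivector_unique[OF fun_mv_multivector[OF f] fun_mv_multivector[OF Xf]] by simp
qed

section \<open>Assembly of the degrees into one endomorphism\<close>

definition lie_graded :: "('e, 'm) graded_mv \<Rightarrow> ('e, 'm) graded_mv" where
  "lie_graded = (\<lambda>a\<in>graded_multivectors M E. \<lambda>p. lie_multivector p (a p))"

lemma homogeneous_graded: "P \<in> multivectors M E p \<Longrightarrow> homogeneous p P \<in> graded_multivectors M E"
  unfolding graded_multivectors_def homogeneous_def
  using multivector_zero by (auto intro: finite_subset[of _ "{p}"])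

lemma graded_component: "a \<in> graded_multivectors M E \<Longrightarrow> a p \<in> multivectors M E p"
  by (simp add: graded_multivectors_def)

lemma graded_add:
  assumes "a \<in> graded_multivectors M E" "b \<in> graded_multivectors M E"
  shows "(\<lambda>p x \<eta>. a p x \<eta> + b p x \<eta>) \<in> graded_multivectors M E"
proof -
  have "{p. (\<lambda>x \<eta>. a p x \<eta> + b p x \<eta>) \<noteq> (\<lambda>x \<eta>. 0)} \<subseteq> {p. a p \<noteq> (\<lambda>x \<eta>. 0)} \<union> {p. b p \<noteq> (\<lambda>x \<eta>. 0)}"
    by auto
  then have "finite {p. (\<lambda>x \<eta>. a p x \<eta> + b p x \<eta>) \<noteq> (\<lambda>x \<eta>. 0)}"
    using assms by (elim finite_subset) (simp add: graded_multivectors_def)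
  then show ?thesis using assms multivector_add by (simp add: graded_multivectors_def)
qed

lemma graded_scale:
  assumes "a \<in> graded_multivectors M E"
  shows "(\<lambda>p x \<eta>. c * a p x \<eta>) \<in> graded_multivectors M E"
proof -
  have "{p. (\<lambda>x \<eta>. c * a p x \<eta>) \<noteq> (\<lambda>x \<eta>. 0)} \<subseteq> {p. a p \<noteq> (\<lambda>x \<eta>. 0)}" by auto
  then have "finite {p. (\<lambda>x \<eta>. c * a p x \<eta>) \<noteq> (\<lambda>x \<eta>. 0)}"
    using assms by (elim finite_subset) (simp add: graded_multivectors_def)
  then show ?thesis using assms multivector_scale by (simp add: graded_multivectors_def)
qed

lemma lie_graded_homogeneous:
  assumes "P \<in> multivectors M E p"
  shows "lie_graded (homogeneous p P) = homogeneous p (lie_multivector p P)"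
  using homogeneous_graded[OF assms]
  by (auto simp: lie_graded_def homogeneous_def lie_multivector_zero)

lemma lie_graded_endomorphism: "graded_endomorphism0 M E lie_graded"
  unfolding graded_endomorphism0_def
proof (intro conjI ballI allI)
  show "lie_graded \<in> graded_multivectors M E \<rightarrow>\<^sub>E graded_multivectors M E"
  proof (rule PiE_I)
    fix a assume a: "a \<in> graded_multivectors M E"
    \<comment> \<open>The support cannot grow, since a zero component has zero Lie
      derivative.\<close>
    have "{p. lie_multivector p (a p) \<noteq> (\<lambda>x \<eta>. 0)} \<subseteq> {p. a p \<noteq> (\<lambda>x \<eta>. 0)}"
      using lie_multivector_zero by auto
    then have "finite {p. lie_multivector p (a p) \<noteq> (\<lambda>x \<eta>. 0)}"
      using a by (elim finite_subset) (simp add: graded_multivectors_def)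
    then show "lie_graded a \<in> graded_multivectors M E"
      using a lie_multivector_multivector[OF graded_component[OF a]]
      by (simp add: lie_graded_def graded_multivectors_def)
  qed (simp add: lie_graded_def)
next
  fix a b assume "a \<in> graded_multivectors M E" "b \<in> graded_multivectors M E"
  then show "lie_graded (\<lambda>p x \<eta>. a p x \<eta> + b p x \<eta>) = (\<lambda>p x \<eta>. lie_graded a p x \<eta> + lie_graded b p x \<eta>)"
    by (simp add: lie_graded_def graded_add lie_multivector_add graded_component)
next
  fix c a assume "a \<in> graded_multivectors M E"
  then show "lie_graded (\<lambda>p x \<eta>. c * a p x \<eta>) = (\<lambda>p x \<eta>. c * lie_graded a p x \<eta>)"
    by (simp add: lie_graded_def graded_scale lie_multivector_scale graded_component)
next
  fix p P assume "P \<in> multivectors M E p"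
  then show "\<exists>Q \<in> multivectors M E p. lie_graded (homogeneous p P) = homogeneous p Q"
    using lie_graded_homogeneous lie_multivector_multivector by blast
qed

text \<open>A family with finite support is a finite sum of homogeneous elements, and additivity
  reaches it by induction on a finite set containing the support.\<close>

lemma graded_endomorphism_eqI:
  assumes L: "graded_endomorphism0 M E L" and K: "graded_endomorphism0 M E K"
    and eq: "\<And>p P. P \<in> multivectors M E p \<Longrightarrow> L (homogeneous p P) = K (homogeneous p P)"
  shows "L = K"
proof (rule PiE_ext)
  show "L \<in> graded_multivectors M E \<rightarrow>\<^sub>E graded_multivectors M E"
    using L unfolding graded_endomorphism0_def by (elim conjE)
  show "K \<in> graded_multivectors M E \<rightarrow>\<^sub>E graded_multivectors M E"
    using K unfolding graded_endomorphism0_def by (elim conjE)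
  have add: "F (\<lambda>p x \<eta>. a p x \<eta> + b p x \<eta>) = (\<lambda>p x \<eta>. F a p x \<eta> + F b p x \<eta>)"
    if "graded_endomorphism0 M E F" "a \<in> graded_multivectors M E" "b \<in> graded_multivectors M E" for F a b
    using that unfolding graded_endomorphism0_def by simp
  fix a assume a: "a \<in> graded_multivectors M E"
  have *: "L a = K a" if "finite F" "a \<in> graded_multivectors M E" "{p. a p \<noteq> (\<lambda>x \<eta>. 0)} \<subseteq> F" for F a
    using that
  proof (induction F arbitrary: a rule: finite_induct)
    case empty
    then have "a p = (\<lambda>x \<eta>. 0)" for p by blast
    \<comment> \<open>The zero family counts as homogeneous, so the hypothesis on homogeneous
      elements covers the base case.\<close>
    then have "a = homogeneous 0 (\<lambda>x \<eta>. 0)" by (simp add: homogeneous_def fun_eq_iff)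
    then show ?case using eq[OF multivector_zero] by simp
  next
    case (insert p F)
    \<comment> \<open>Removing component \<open>p\<close> leaves a family supported in
      \<open>F\<close>, to which the induction hypothesis applies.\<close>
    define b where "b = a(p := (\<lambda>x \<eta>. 0))"
    have sub: "{q. b q \<noteq> (\<lambda>x \<eta>. 0)} \<subseteq> {q. a q \<noteq> (\<lambda>x \<eta>. 0)}" by (auto simp: b_def)
    have "finite {q. b q \<noteq> (\<lambda>x \<eta>. 0)}"
      using insert.prems(1) by (intro finite_subset[OF sub]) (simp add: graded_multivectors_def)
    then have b: "b \<in> graded_multivectors M E"
      using graded_component[OF insert.prems(1)] multivector_zero by (simp add: graded_multivectors_def b_def)
    have h: "homogeneous p (a p) \<in> graded_multivectors M E"
      by (rule homogeneous_graded[OF graded_component[OF insert.prems(1)]])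
    have a: "a = (\<lambda>q x \<eta>. b q x \<eta> + homogeneous p (a p) q x \<eta>)"
      by (auto simp: b_def homogeneous_def fun_eq_iff)
    have "L b = K b" using insert.prems(2) by (intro insert.IH b) (auto simp: b_def)
    then have "L (\<lambda>q x \<eta>. b q x \<eta> + homogeneous p (a p) q x \<eta>) = K (\<lambda>q x \<eta>. b q x \<eta> + homogeneous p (a p) q x \<eta>)"
      using add[OF L b h] add[OF K b h] eq[OF graded_component[OF insert.prems(1)]] by simp
    then show ?case using a by simp
  qed
  show "L a = K a" by (rule *[OF _ a order_refl]) (use a in \<open>simp add: graded_multivectors_def\<close>)
qed

end

theorem proposition5p1p5:
  fixes M :: "'m manifold"
    and E :: "('e, 'm) vector_bundle"
    and \<rho> :: "'e \<Rightarrow> 'm \<times> 'm derivation"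
    and br :: "('m \<Rightarrow> 'e) \<Rightarrow> ('m \<Rightarrow> 'e) \<Rightarrow> 'm \<Rightarrow> 'e"
    and V :: "'m \<Rightarrow> 'e"
  assumes "lie_algebroid M E \<rho> br"
    and "V \<in> smooth_sections M E"
  shows "\<exists>!L. graded_endomorphism0 M E L \<and>
    (\<forall>f \<in> smooth_funs M.
       L (homogeneous 0 (fun_mv M E f)) =
         homogeneous 0 (fun_mv M E (contraction (\<rho> \<circ> V) (differential f))) \<and>
       contraction (\<rho> \<circ> V) (differential f) = lie_deriv_fun (\<rho> \<circ> V) f) \<and>
    (\<forall>p \<ge> 1. \<forall>P \<in> multivectors M E p. \<exists>Q \<in> multivectors M E p.
       L (homogeneous p P) = homogeneous p Q \<and>
       (\<forall>Q' \<in> multivectors M E p.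
          (\<forall>\<eta> \<in> forms M E p. \<forall>x \<in> pts M.
             pairing \<eta> Q' x =
               lie_deriv_fun (\<rho> \<circ> V) (pairing \<eta> P) x -
               pairing (lie_deriv_form M E \<rho> br V p \<eta>) P x)
          \<longleftrightarrow> Q' = Q))"
    (is "\<exists>!L. graded_endomorphism0 M E L \<and> ?fun L \<and> ?mv L")
proof -
  interpret lie_algebroid_section M E \<rho> br V using assms by unfold_locales
  have contr: "contraction (\<rho> \<circ> V) (differential f) = lie_deriv_fun (\<rho> \<circ> V) f" for f
    by (simp add: contraction_def differential_def lie_deriv_fun_def fun_eq_iff)
  have mv: "L (homogeneous p P) = homogeneous p (lie_multivector p P)"
    if L: "?mv L" and p: "p \<ge> 1" and P: "P \<in> multivectors M E p" for L p P
  proof -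
    obtain Q where Q: "Q \<in> multivectors M E p" "L (homogeneous p P) = homogeneous p Q" and
      "\<forall>Q' \<in> multivectors M E p. (\<forall>\<eta> \<in> forms M E p. \<forall>x \<in> pts M. pairing \<eta> Q' x =
         lie_deriv_fun X (pairing \<eta> P) x - pairing (lie_deriv_form M E \<rho> br V p \<eta>) P x) \<longleftrightarrow> Q' = Q"
      using L[rule_format, OF p P] by blast
    \<comment> \<open>The instance \<open>Q' = Q\<close> of the equivalence says that
      \<open>Q\<close> satisfies the formula.\<close>
    then have "Q = lie_multivector p P" using lie_multivector_unique[OF P Q(1)] by blast
    then show ?thesis using Q(2) by simp
  qed
  have hom: "L (homogeneous p P) = homogeneous p (lie_multivector p P)"
    if "?fun L" "?mv L" and P: "P \<in> multivectors M E p" for L p P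
  proof (cases "p = 0")
    case True
    \<comment> \<open>Degree 0 is governed by the clause on functions, which reaches every
      multivector of that degree.\<close>
    then obtain f where f: "f \<in> smooth_funs M" "P = fun_mv M E f" using multivector_0_fun P by blast
    then show ?thesis using \<open>?fun L\<close> True by (simp add: lie_multivector_fun contr)
  next
    case False
    then show ?thesis using mv[OF \<open>?mv L\<close> _ P] by simp
  qed
  show ?thesis
  proof (rule ex1I[of _ lie_graded])
    show "graded_endomorphism0 M E lie_graded \<and> ?fun lie_graded \<and> ?mv lie_graded"
    proof (intro conjI)
      show "graded_endomorphism0 M E lie_graded" by (rule lie_graded_endomorphism)
      show "?fun lie_graded"
        by (simp add: contr lie_graded_homogeneous fun_mv_multivector lie_multivector_fun)
      show "?mv lie_graded"
      proof (intro allI impI ballI)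
        fix p P assume P: "P \<in> multivectors M E p"
        show "\<exists>Q \<in> multivectors M E p. lie_graded (homogeneous p P) = homogeneous p Q \<and>
          (\<forall>Q' \<in> multivectors M E p. (\<forall>\<eta> \<in> forms M E p. \<forall>x \<in> pts M. pairing \<eta> Q' x =
             lie_deriv_fun (\<rho> \<circ> V) (pairing \<eta> P) x - pairing (lie_deriv_form M E \<rho> br V p \<eta>) P x) \<longleftrightarrow> Q' = Q)"
          using lie_graded_homogeneous[OF P] lie_multivector_unique[OF P]
          by (intro bexI[of _ "lie_multivector p P"] lie_multivector_multivector[OF P]) simp
      qed
    qed
  next
    fix L assume L: "graded_endomorphism0 M E L \<and> ?fun L \<and> ?mv L"
    show "L = lie_graded"
    proof (rule graded_endomorphism_eqI)
      show "graded_endomorphism0 M E L" using L by blast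
      show "graded_endomorphism0 M E lie_graded" by (rule lie_graded_endomorphism)
      show "L (homogeneous p P) = lie_graded (homogeneous p P)" if P: "P \<in> multivectors M E p" for p P
        using hom[of L, OF _ _ P] L lie_graded_homogeneous[OF P] by simp
    qed
  qed
qed

end
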